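(* Let $d\ge2$ and $\beta\ge0$. Then, for $(x,t),(y,s)\in\mathbb V_0^{d+1}$ and $0\le r<1$, $$\mathsf P^E\big(w_\beta;r,(x,t),(y,s)\big)=\frac{1}{(1-r^2)^{\beta+\frac d2}}\,e^{-\frac{s^2+t^2}{1-r^2}r^2}\int_{-1}^1\int_{-1}^1e^{\frac{2r}{1-r^2}\eta(x,t,y,s;z)}\,c_{\frac{d-2}2,\beta-1}\,c_\beta\,(1-z_1)^{\frac{d-2}2}(1+z_1)^{\beta-1}(1-z_2^2)^{\beta-\frac12}\,dz,$$ where $z=(z_1,z_2)$ and $$\eta(x,t,y,s;z)=\frac{1-z_1}2\langle x,y\rangle\,\mathrm{sign}(st)+\frac{1+z_1}2z_2\,st .$$ For $\beta=0$ the formula holds under the limit $\beta\to0$.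
   Context: $\mathbb V_0^{d+1}=\{(x,t)\in\mathbb R^d\times\mathbb R:\ \|x\|=|t|\}$ is the infinite double cone, and $w_\beta(t)=|t|^{2\beta}e^{-t^2}$. The inner product is $\langle f,g\rangle_{w_\beta}=b_\beta\int_{-\infty}^\infty|t|^{d-1}\int_{\mathbb S^{d-1}}(fg)(|t|\xi,t)\,d\sigma(\xi)\,w_\beta(t)\,dt$ with $b_\beta$ such that $\langle1,1\rangle_{w_\beta}=1$. $\mathcal V_n^E(\mathbb V_0^{d+1},w_\beta)$ is the space of restrictions to $\mathbb V_0^{d+1}$ of polynomials in $(x,t)$ of degree at most $n$ that are even in $t$ and orthogonal to all polynomials of degree at most $n-1$. $\mathsf P_n^E(w_\beta;\cdot,\cdot)$ is its reproducing kernel with respect to $\langle\cdot,\cdot\rangle_{w_\beta}$. The Poisson kernel is $\mathsf P^E(w_\beta;r,(x,t),(y,s))=\sum_{n=0}^\infty\mathsf P_n^E(w_\beta;(x,t),(y,s))\,r^n$, $0\le r<1$. Constants: $c_\lambda=\frac{\Gamma(\lambda+1)}{\Gamma(\frac12)\Gamma(\lambda+\frac12)}$, $c_{a,b}=\frac{\Gamma(a+b+2)}{\Gamma(a+1)\Gamma(b+1)}$.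
   Formalization: The right-hand side is divided by 2^(β+(d−2)/2), since with the given c_{a,b} it is not 1 at r=0, and η is evaluated at |t|,|s|, since the kernel is even in t while ⟨x,y⟩sign(st) is not; as printed the formula is false. *)

theory Defs
  imports "HOL-Analysis.Analysis"
begin

text \<open>Points \<open>(x, t)\<close> live in \<open>real ^ 'n \<times> real\<close>, and \<open>d = CARD('n)\<close>.\<close>

definition double_cone :: "((real ^ 'n) \<times> real) set" where
  "double_cone = {(x, t). norm x = \<bar>t\<bar>}"

definition poly_deg_le :: "nat \<Rightarrow> ((real ^ 'n) \<times> real \<Rightarrow> real) set" where
  "poly_deg_le n = {p. \<exists>c :: ('n \<Rightarrow> nat) \<Rightarrow> nat \<Rightarrow> real. \<forall>x t.
     p (x, t) = (\<Sum>(\<alpha>, k)\<in>{(\<alpha>, k). (\<Sum>i\<in>UNIV. \<alpha> i) + k \<le> n}.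
                   c \<alpha> k * (\<Prod>i\<in>UNIV. (x $ i) ^ \<alpha> i) * t ^ k)}"

lemma finite_multi_indices:
  "finite {(\<alpha> :: 'n::finite \<Rightarrow> nat, k :: nat). (\<Sum>i\<in>UNIV. \<alpha> i) + k \<le> n}"
proof (rule finite_subset)
  show "{(\<alpha> :: 'n \<Rightarrow> nat, k :: nat). (\<Sum>i\<in>UNIV. \<alpha> i) + k \<le> n}
          \<subseteq> (UNIV \<rightarrow>\<^sub>E {..n}) \<times> {..n}"
  proof clarify
    fix \<alpha> :: "'n \<Rightarrow> nat" and k
    assume le: "(\<Sum>i\<in>UNIV. \<alpha> i) + k \<le> n"
    have "\<alpha> i \<le> n" for i
      using member_le_sum[of i UNIV \<alpha>] le by simp
    with le show "\<alpha> \<in> UNIV \<rightarrow>\<^sub>E {..n} \<and> k \<in> {..n}" by auto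
  qed
qed (auto intro!: finite_PiE)

text \<open>
  Surface measure on the unit sphere, obtained from Lebesgue measure through polar coordinates:
  \<open>\<sigma> A = d * vol {x. 0 < norm x < 1 \<and> x / norm x \<in> A}\<close>.
\<close>
definition sphere_measure :: "(real ^ 'n) measure" where
  "sphere_measure = scale_measure (of_nat CARD('n))
     (distr (restrict_space lborel (ball 0 1 - {0})) (restrict_space borel (sphere 0 1)) sgn)"

definition cone_weight :: "real \<Rightarrow> real \<Rightarrow> real" where
  "cone_weight \<beta> t = \<bar>t\<bar> powr (2 * \<beta>) * exp (- t\<^sup>2)"

definition cone_integral :: "real \<Rightarrow> ((real ^ 'n) \<times> real \<Rightarrow> real) \<Rightarrow> real" where
  "cone_integral \<beta> h =
     (LINT t|lborel. \<bar>t\<bar> ^ (CARD('n) - 1) *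
        (LINT \<xi>|sphere_measure. h (\<bar>t\<bar> *\<^sub>R \<xi>, t)) * cone_weight \<beta> t)"

definition cone_normalization :: "('n::finite) itself \<Rightarrow> real \<Rightarrow> real" where
  "cone_normalization _ \<beta> = 1 / cone_integral \<beta> (\<lambda>_ :: (real ^ 'n) \<times> real. 1)"

definition cone_inner ::
  "real \<Rightarrow> ((real ^ 'n) \<times> real \<Rightarrow> real) \<Rightarrow> ((real ^ 'n) \<times> real \<Rightarrow> real) \<Rightarrow> real" where
  "cone_inner \<beta> f g = cone_normalization TYPE('n) \<beta> * cone_integral \<beta> (\<lambda>p. f p * g p)"

text \<open>
  Restrictions to the cone are represented by functions that vanish off the cone, so that equal
  restrictions are equal functions.
\<close>
definition orth_poly_even :: "real \<Rightarrow> nat \<Rightarrow> ((real ^ 'n) \<times> real \<Rightarrow> real) set" where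
  "orth_poly_even \<beta> n =
     {\<lambda>p. if p \<in> double_cone then q p else 0 | q.
        q \<in> poly_deg_le n \<and> (\<forall>x t. q (x, - t) = q (x, t)) \<and>
        (\<forall>m<n. \<forall>g\<in>poly_deg_le m. cone_inner \<beta> q g = 0)}"

text \<open>
  The space is finite-dimensional and the inner product is definite on it, so the element
  representing evaluation at \<open>p\<close> exists and is unique.
\<close>
definition repr_kernel_even ::
  "real \<Rightarrow> nat \<Rightarrow> (real ^ 'n) \<times> real \<Rightarrow> (real ^ 'n) \<times> real \<Rightarrow> real" where
  "repr_kernel_even \<beta> n p =
     (THE k. k \<in> orth_poly_even \<beta> n \<and> (\<forall>f\<in>orth_poly_even \<beta> n. cone_inner \<beta> f k = f p))"

definition poisson_kernel_even ::
  "real \<Rightarrow> real \<Rightarrow> (real ^ 'n) \<times> real \<Rightarrow> (real ^ 'n) \<times> real \<Rightarrow> real" where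
  "poisson_kernel_even \<beta> r p q = (\<Sum>n. repr_kernel_even \<beta> n p q * r ^ n)"

definition gegenbauer_const :: "real \<Rightarrow> real" where
  "gegenbauer_const l = Gamma (l + 1) / (Gamma (1 / 2) * Gamma (l + 1 / 2))"

text \<open>
  This normalizes the Jacobi weight \<open>u powr a * (1 - u) powr b\<close> on \<open>[0, 1]\<close>; the weight
  \<open>(1 - z) powr a * (1 + z) powr b\<close> on \<open>[-1, 1]\<close> has total mass
  \<open>2 powr (a + b + 1) / jacobi_const a b\<close>.
\<close>
definition jacobi_const :: "real \<Rightarrow> real \<Rightarrow> real" where
  "jacobi_const a b = Gamma (a + b + 2) / (Gamma (a + 1) * Gamma (b + 1))"

text \<open>
  The factor \<open>sgn (s * t)\<close> changes sign under \<open>t \<mapsto> - t\<close>, whereas the kernel above is even in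
  \<open>t\<close> and in \<open>s\<close>; the kernel is therefore given by \<open>cone_eta\<close> at \<open>\<bar>t\<bar>\<close> and \<open>\<bar>s\<bar>\<close>. When
  \<open>s * t \<ge> 0\<close>, passing to absolute values does not change \<open>cone_eta\<close>.
\<close>
definition cone_eta ::
  "real ^ 'n \<Rightarrow> real \<Rightarrow> real ^ 'n \<Rightarrow> real \<Rightarrow> real \<times> real \<Rightarrow> real" where
  "cone_eta x t y s z =
     (1 - fst z) / 2 * (x \<bullet> y) * sgn (s * t) + (1 + fst z) / 2 * snd z * (s * t)"

definition poisson_integral ::
  "real \<Rightarrow> real \<Rightarrow> (real ^ 'n) \<times> real \<Rightarrow> (real ^ 'n) \<times> real \<Rightarrow> real" where
  "poisson_integral \<beta> r = (\<lambda>(x, t) (y, s).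
     (let d = real CARD('n) in
      1 / (1 - r\<^sup>2) powr (\<beta> + d / 2) * exp (- ((s\<^sup>2 + t\<^sup>2) / (1 - r\<^sup>2)) * r\<^sup>2) *
      (LINT z:{-1..1} \<times> {-1..1}|lborel.
         exp (2 * r / (1 - r\<^sup>2) * cone_eta x t y s z) *
         jacobi_const ((d - 2) / 2) (\<beta> - 1) * gegenbauer_const \<beta> *
         (1 - fst z) powr ((d - 2) / 2) * (1 + fst z) powr (\<beta> - 1) *
         (1 - (snd z)\<^sup>2) powr (\<beta> - 1 / 2))))"

end

theory Submission
  imports Defs
begin

text \<open>
  On the cone, polynomials even in \<open>t\<close> are polynomials in \<open>x\<close>, and the inner product becomes that
  of the radial weight \<open>norm x powr (2 * \<beta>) * exp (- (norm x)\<^sup>2)\<close>. Put \<open>\<delta> = d / 2\<close>. The zonal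
  kernels \<open>Z\<^sub>j\<close> are defined by inverting
  \<open>(2 (x \<bullet> y)) ^ k / k! = (\<Sum>i. (norm x * norm y) ^ (2 * i) / (i! (\<delta>)\<^sub>k\<^sub>-\<^sub>i) * Z\<^sub>k\<^sub>-\<^sub>2\<^sub>i)\<close>; the moments of
  linear forms on the sphere then show that they reproduce each other. With Laguerre polynomials
  in \<open>(norm x)\<^sup>2\<close> this yields an explicit orthogonal basis, hence the reproducing kernels.

  On the other side, expanding the exponential in the double integral and integrating by Beta
  integrals gives \<open>E\<^sub>k\<close>, whose expansion in the \<open>Z\<^sub>j\<close> has the same shape as that of
  \<open>(x \<bullet> y) ^ k / k!\<close> with \<open>\<beta> + \<delta>\<close> in place of \<open>\<delta>\<close> (the Rothe--Hagen identity). The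
  Hille--Hardy formula, coefficient by coefficient, identifies the two sides. For \<open>\<beta> = 0\<close> one
  passes to the limit under the series by Tannery's theorem.
\<close>

section \<open>Hypergeometric summations\<close>

text \<open>The sphere contributes the denominators \<open>pochhammer \<delta> (k - i)\<close> in
  the zonal expansion of a power of \<open>x \<bullet> y\<close>, whereas the radial weight calls
  for \<open>pochhammer (\<beta> + \<delta>) (k - i)\<close>. The double integral is the correction
  between the two: averaging \<open>x \<bullet> y\<close> with a multiple of
  \<open>norm x * norm y\<close> changes these denominators and leaves the zonal kernels alone. At
  \<open>\<beta> = 0\<close> the weight \<open>(1 + z) powr (\<beta> - 1)\<close> is not integrable,
  so the integral is reached only as a limit, while the kernel side is algebraic in \<beta> and is
  treated for all \<beta> \<ge> 0 at once. The uniformity for the limit comes from reading the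
  double integral as a mean for a probability density: with \<open>T = norm x * norm y\<close>, the
  k-th coefficient is at most \<open>T ^ k / fact k\<close>, whatever \<beta> is. The same reading
  explains the divisor \<open>2 powr (\<beta> + (d - 2) / 2)\<close> of the theorem. Since
  \<open>jacobi_const\<close> normalizes on [0, 1], this is the mass that the weight, multiplied by
  that constant, has on [-1, 1].\<close>

text \<open>Chu-Vandermonde after the reflection \<open>(a)_k = (-1)^k (1 - a - k)_k\<close>. The
  reflected shift is -i, whose rising factorials are signed falling factorials of i, so the sum
  effectively stops at the smaller of i and n.\<close>

lemma pochhammer_shift_Vandermonde:
  fixes \<nu> :: "'a::field_char_0"
  shows "pochhammer (\<nu> + of_nat i) n =
    (\<Sum>h\<le>n. of_nat (n choose h) * of_nat (i choose h) * fact h * pochhammer (\<nu> + of_nat h) (n - h))"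
proof -
  have sg: "pochhammer a k = (-1)^k * pochhammer (1 - a - of_nat k) k" for a :: 'a and k
    using pochhammer_minus[of "- a" k] by (simp add: algebra_simps)
  have neg: "pochhammer (- of_nat i) h = ((-1)^h * of_nat (i choose h) * fact h :: 'a)" for h
    by (simp add: binomial_gbinomial gbinomial_pochhammer)
  have "pochhammer (\<nu> + of_nat i) n = (-1)^n * pochhammer (- of_nat i + (1 - \<nu> - of_nat n)) n"
    by (subst sg) (simp add: algebra_simps)
  also have "\<dots> = (-1)^n * (\<Sum>h\<le>n. of_nat (n choose h) * pochhammer (- of_nat i) h * pochhammer (1 - \<nu> - of_nat n) (n - h))"
    by (subst pochhammer_binomial_sum) (rule refl)
  also have "\<dots> = (\<Sum>h\<le>n. of_nat (n choose h) * of_nat (i choose h) * fact h * pochhammer (\<nu> + of_nat h) (n - h))"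
    unfolding sum_distrib_left
  proof (intro sum.cong refl)
    fix h assume "h \<in> {..n}"
    then have h: "h \<le> n" by simp
    have e1: "pochhammer (\<nu> + of_nat h) (n - h) = (-1)^(n-h) * pochhammer (1 - \<nu> - of_nat n) (n - h)"
      by (subst sg) (use h in \<open>simp add: algebra_simps of_nat_diff\<close>)
    have e2: "(-1::'a)^n * (-1)^h = (-1)^(n-h)"
    proof -
      obtain m where "n = h + m" using h le_Suc_ex by blast
      then show ?thesis by (simp add: power_add flip: power_mult_distrib)
    qed
    show "(-1)^n * (of_nat (n choose h) * pochhammer (- of_nat i) h * pochhammer (1 - \<nu> - of_nat n) (n - h))
      = of_nat (n choose h) * of_nat (i choose h) * fact h * pochhammer (\<nu> + of_nat h) (n - h)"
      unfolding neg e1 e2[symmetric] by (simp only: mult_ac)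
  qed
  finally show ?thesis .
qed

text \<open>Dividing the shifted Vandermonde sum by \<open>pochhammer \<nu> k\<close> cancels
  \<open>pochhammer (\<nu> + h) (k - h)\<close> in each term. Read from right to left, it collapses
  the sum over h in \<open>sum_power_pairs_zonal\<close> to a quotient.\<close>

lemma pochhammer_sum_inverse:
  fixes \<nu> :: real
  assumes \<nu>: "\<nu> > 0"
  shows "pochhammer \<nu> (i + k) / (fact i * fact k * pochhammer \<nu> i * pochhammer \<nu> k) =
    (\<Sum>h\<le>min i k. 1 / (fact h * fact (i - h) * fact (k - h) * pochhammer \<nu> h))"
proof -
  have p: "pochhammer \<nu> n > 0" for n using \<nu> by (rule pochhammer_pos)
  have "pochhammer \<nu> (i + k) = pochhammer \<nu> i * pochhammer (\<nu> + of_nat i) k"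
    by (simp add: pochhammer_product')
  then have "pochhammer \<nu> (i + k) / (fact i * fact k * pochhammer \<nu> i * pochhammer \<nu> k)
     = (\<Sum>h\<le>k. of_nat (k choose h) * of_nat (i choose h) * fact h * pochhammer (\<nu> + of_nat h) (k - h)) / (fact i * fact k * pochhammer \<nu> k)"
    using p[of i] by (simp add: pochhammer_shift_Vandermonde[of \<nu> i k])
  also have "\<dots> = (\<Sum>h\<le>k. of_nat (k choose h) * of_nat (i choose h) * fact h * pochhammer (\<nu> + of_nat h) (k - h) / (fact i * fact k * pochhammer \<nu> k))"
    by (simp add: sum_divide_distrib)
  also have "\<dots> = (\<Sum>h\<le>min i k. of_nat (k choose h) * of_nat (i choose h) * fact h * pochhammer (\<nu> + of_nat h) (k - h) / (fact i * fact k * pochhammer \<nu> k))"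
    by (rule sum.mono_neutral_right) (auto simp: binomial_eq_0)
  also have "\<dots> = (\<Sum>h\<le>min i k. 1 / (fact h * fact (i - h) * fact (k - h) * pochhammer \<nu> h))"
  proof (intro sum.cong refl)
    fix h assume "h \<in> {..min i k}"
    then have h: "h \<le> i" "h \<le> k" by auto
    have e: "pochhammer \<nu> k = pochhammer \<nu> h * pochhammer (\<nu> + of_nat h) (k - h)"
      using h by (simp add: pochhammer_product)
    have "pochhammer (\<nu> + of_nat h) (k - h) > 0" using \<nu> by (intro pochhammer_pos) auto
    then show "of_nat (k choose h) * of_nat (i choose h) * fact h * pochhammer (\<nu> + of_nat h) (k - h) / (fact i * fact k * pochhammer \<nu> k)
       = 1 / (fact h * fact (i - h) * fact (k - h) * pochhammer \<nu> h)"
      unfolding e using p[of h] h by (simp add: binomial_fact field_simps)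
  qed
  finally show ?thesis .
qed

text \<open>A balanced terminating 3F2 sum. Expanding the quotient of the rising factorials by
  Vandermonde makes the sum over h an ordinary Vandermonde convolution of binomials; what remains is
  the first expansion read backwards.\<close>

lemma pochhammer_Saalschuetz:
  fixes \<mu> :: real
  assumes \<mu>: "\<mu> > 0" and a: "a \<le> N"
  shows "(\<Sum>h\<le>b. real (a choose h) * real ((N - a) choose (b - h)) * pochhammer (\<mu> + real N) h / pochhammer \<mu> h)
    = real (N choose b) * pochhammer \<mu> (a + b) / (pochhammer \<mu> a * pochhammer \<mu> b)"
    (is "?L = _")
proof -
  have p: "pochhammer \<mu> n > 0" for n using \<mu> by (rule pochhammer_pos)
  have q: "pochhammer (\<mu> + real N) h / pochhammer \<mu> h =
      (\<Sum>m\<le>h. real (h choose m) * real (N choose m) * fact m / pochhammer \<mu> m)" for h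
    unfolding pochhammer_shift_Vandermonde[of \<mu> N h] sum_divide_distrib
  proof (intro sum.cong refl)
    fix m assume "m \<in> {..h}"
    then have e: "pochhammer \<mu> h = pochhammer \<mu> m * pochhammer (\<mu> + of_nat m) (h - m)"
      by (simp add: pochhammer_product)
    have "pochhammer (\<mu> + of_nat m) (h - m) > 0" using \<mu> by (intro pochhammer_pos) auto
    then show "real (h choose m) * real (N choose m) * fact m * pochhammer (\<mu> + real m) (h - m) / pochhammer \<mu> h = real (h choose m) * real (N choose m) * fact m / pochhammer \<mu> m"
      unfolding e by simp
  qed
  have ext: "(\<Sum>m\<le>h. real (h choose m) * real (N choose m) * fact m / pochhammer \<mu> m) =
     (\<Sum>m\<le>b. real (h choose m) * real (N choose m) * fact m / pochhammer \<mu> m)" if "h \<le> b" for h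
    by (rule sum.mono_neutral_left) (use that in \<open>auto simp: binomial_eq_0\<close>)
  have inner: "(\<Sum>h\<le>b. (a choose h) * ((N - a) choose (b - h)) * (h choose m)) = (a choose m) * ((N - m) choose (b - m))"
    if m: "m \<le> b" for m
  proof (cases "m \<le> a")
    case False
    then have "(a choose h) * ((N - a) choose (b - h)) * (h choose m) = 0" for h
      by (cases "h \<le> a") (auto simp: binomial_eq_0)
    then show ?thesis using False by (simp add: binomial_eq_0)
  next
    case True
    have "(\<Sum>h\<le>b. (a choose h) * ((N - a) choose (b - h)) * (h choose m))
      = (\<Sum>h\<in>{m..b}. (a choose h) * ((N - a) choose (b - h)) * (h choose m))"
      by (rule sum.mono_neutral_right) (auto simp: binomial_eq_0)
    also have "\<dots> = (\<Sum>h\<in>{m..b}. (a choose m) * (((a - m) choose (h - m)) * ((N - a) choose (b - h))))"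
    proof (intro sum.cong refl)
      fix h assume h: "h \<in> {m..b}"
      show "(a choose h) * ((N - a) choose (b - h)) * (h choose m) = (a choose m) * (((a - m) choose (h - m)) * ((N - a) choose (b - h)))"
      proof (cases "h \<le> a")
        case True
        have "(a choose h) * (h choose m) = (a choose m) * ((a - m) choose (h - m))"
          using h True by (intro choose_mult) auto
        then show ?thesis by (metis mult.assoc mult.commute)
      next
        case False
        then show ?thesis using h True by (simp add: binomial_eq_0)
      qed
    qed
    also have "\<dots> = (\<Sum>g\<le>b - m. (a choose m) * (((a - m) choose g) * ((N - a) choose ((b - m) - g))))"
      by (rule sum.reindex_bij_witness[of _ "\<lambda>g. g + m" "\<lambda>h. h - m"]) (use m in auto)
    also have "\<dots> = (a choose m) * (((a - m) + (N - a)) choose (b - m))"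
      unfolding sum_distrib_left[symmetric] vandermonde ..
    finally show ?thesis using a True by simp
  qed
  have "?L = (\<Sum>h\<le>b. \<Sum>m\<le>b. real (a choose h) * real ((N - a) choose (b - h)) * (real (h choose m) * real (N choose m) * fact m / pochhammer \<mu> m))"
    unfolding sum_distrib_left[symmetric] times_divide_eq_right[symmetric]
    by (intro sum.cong refl) (simp only: q ext times_divide_eq_right atMost_iff)
  also have "\<dots> = (\<Sum>m\<le>b. real (N choose m) * fact m / pochhammer \<mu> m * (\<Sum>h\<le>b. real ((a choose h) * ((N - a) choose (b - h)) * (h choose m))))"
    by (subst sum.swap) (simp add: sum_distrib_left mult_ac)
  also have "\<dots> = (\<Sum>m\<le>b. real (N choose m) * fact m / pochhammer \<mu> m * real ((a choose m) * ((N - m) choose (b - m))))"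
    by (intro sum.cong refl arg_cong2[where f="(*)"]) (simp only: inner atMost_iff flip: of_nat_sum)
  also have "\<dots> = (\<Sum>m\<le>b. real (N choose b) * (real (b choose m) * real (a choose m) * fact m / pochhammer \<mu> m))"
  proof (intro sum.cong refl)
    fix m assume m: "m \<in> {..b}"
    have "(N choose m) * ((N - m) choose (b - m)) = (N choose b) * (b choose m)"
    proof (cases "b \<le> N")
      case True
      then show ?thesis using m choose_mult[of m b N] by simp
    next
      case False
      then show ?thesis using m by (cases "m \<le> N") (auto simp: binomial_eq_0)
    qed
    then have "real (N choose m) * real ((N - m) choose (b - m)) = real (N choose b) * real (b choose m)"
      by (metis of_nat_mult)
    then show "real (N choose m) * fact m / pochhammer \<mu> m * real ((a choose m) * ((N - m) choose (b - m))) = real (N choose b) * (real (b choose m) * real (a choose m) * fact m / pochhammer \<mu> m)"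
      by (simp add: mult_ac)
  qed
  also have "\<dots> = real (N choose b) * (pochhammer (\<mu> + real a) b / pochhammer \<mu> b)"
    unfolding sum_distrib_left[symmetric]
  proof (intro arg_cong2[where f="(*)"] refl)
    show "(\<Sum>m\<le>b. real (b choose m) * real (a choose m) * fact m / pochhammer \<mu> m) = pochhammer (\<mu> + real a) b / pochhammer \<mu> b"
      unfolding pochhammer_shift_Vandermonde[of \<mu> a b] sum_divide_distrib
    proof (intro sum.cong refl)
      fix m assume "m \<in> {..b}"
      then have e: "pochhammer \<mu> b = pochhammer \<mu> m * pochhammer (\<mu> + of_nat m) (b - m)"
        by (simp add: pochhammer_product)
      have "pochhammer (\<mu> + of_nat m) (b - m) > 0" using \<mu> by (intro pochhammer_pos) auto
      then show "real (b choose m) * real (a choose m) * fact m / pochhammer \<mu> m = real (b choose m) * real (a choose m) * fact m * pochhammer (\<mu> + real m) (b - m) / pochhammer \<mu> b"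
        unfolding e by simp
    qed
  qed
  also have "\<dots> = real (N choose b) * pochhammer \<mu> (a + b) / (pochhammer \<mu> a * pochhammer \<mu> b)"
    using p[of a] by (simp add: pochhammer_product')
  finally show ?thesis .
qed

lemma sum_triangle_nested:
  fixes g :: "nat \<Rightarrow> nat \<Rightarrow> 'a::comm_monoid_add"
  shows "(\<Sum>j\<le>K. \<Sum>i\<le>K - j. g j i) = (\<Sum>n\<le>K. \<Sum>j\<le>n. g j (n - j))"
proof -
  have "(\<Sum>j\<le>K. \<Sum>i\<le>K - j. g j i) = (\<Sum>(j,i)\<in>(SIGMA j:{..K}. {..K - j}). g j i)"
    by (rule sum.Sigma) auto
  also have "(SIGMA j:{..K}. {..K - j}) = {(i,j). i + j \<le> K}" by auto
  finally show ?thesis by (simp add: sum.triangle_reindex_eq)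
qed

lemma sum_Sigma_Sigma:
  fixes f :: "'a \<Rightarrow> 'b \<Rightarrow> 'c \<Rightarrow> 'd::comm_monoid_add"
  assumes "finite A" "\<And>a. a \<in> A \<Longrightarrow> finite (B a)" "\<And>a b. a \<in> A \<Longrightarrow> b \<in> B a \<Longrightarrow> finite (C a b)"
  shows "(\<Sum>a\<in>A. \<Sum>b\<in>B a. \<Sum>c\<in>C a b. f a b c) = (\<Sum>(a,b,c)\<in>(SIGMA a:A. SIGMA b:B a. C a b). f a b c)"
proof -
  have "(\<Sum>a\<in>A. \<Sum>b\<in>B a. \<Sum>c\<in>C a b. f a b c) = (\<Sum>a\<in>A. \<Sum>(b,c)\<in>(SIGMA b:B a. C a b). f a b c)"
    by (intro sum.cong refl sum.Sigma) (use assms in auto)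
  also have "\<dots> = (\<Sum>(a,bc)\<in>(SIGMA a:A. SIGMA b:B a. C a b). case bc of (b,c) \<Rightarrow> f a b c)"
    by (rule sum.Sigma) (use assms in auto)
  finally show ?thesis by simp
qed

section \<open>Rothe numbers and the Rothe-Hagen identity\<close>

text \<open>The number x / (x + 2j) * binomial(x + 2j, j), that is, the coefficient of w^j in C(w)^x
  for the Catalan series C = 1 + w C^2. The factor x + 2j is cancelled so that it is a polynomial in
  x; j = 0 is separate because \<open>j - 1\<close> truncates there.\<close>

definition rothe_coeff :: "real \<Rightarrow> nat \<Rightarrow> real" where
  "rothe_coeff x j = (if j = 0 then 1 else x * pochhammer (x + real j + 1) (j - 1) / fact j)"

text \<open>The form in which the Beta integrals deliver the coefficient: the numerator comes from
  the Jacobi weight, \<open>pochhammer (\<beta> + 1) j\<close> from the Gegenbauer weight.\<close>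

lemma rothe_coeff_eq:
  assumes "\<beta> \<ge> 0"
  shows "rothe_coeff \<beta> j = pochhammer \<beta> (2 * j) / (pochhammer (\<beta> + 1) j * fact j)"
proof (cases j)
  case 0
  then show ?thesis by (simp add: rothe_coeff_def)
next
  case (Suc i)
  have "pochhammer \<beta> (2 * j) = \<beta> * pochhammer (\<beta> + 1) (j + i)"
    using Suc by (simp add: pochhammer_rec mult_2)
  also have "\<dots> = \<beta> * (pochhammer (\<beta> + 1) j * pochhammer (\<beta> + 1 + real j) i)"
    by (simp only: pochhammer_product')
  finally have e: "pochhammer \<beta> (2 * j) = \<beta> * (pochhammer (\<beta> + 1) j * pochhammer (\<beta> + 1 + real j) i)" .
  have "pochhammer (\<beta> + 1) j > 0" using assms by (intro pochhammer_pos) auto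
  then show ?thesis using Suc[THEN arg_cong[where f="\<lambda>m. m - 1"]] Suc
    unfolding e by (simp add: rothe_coeff_def add.commute add.left_commute del: pochhammer_Suc)
qed

text \<open>Coefficientwise C^x = C^(x-1) + w C^(x+1), the Catalan equation times C^(x-1).\<close>

lemma rothe_coeff_rec:
  "rothe_coeff x (Suc j) = rothe_coeff (x - 1) (Suc j) + rothe_coeff (x + 1) j"
proof (cases j)
  case 0
  then show ?thesis by (simp add: rothe_coeff_def)
next
  case (Suc i)
  let ?P = "pochhammer (x + real j + 2) i"
  have 1: "pochhammer (x + real j + 2) j = ?P * (x + 2 * real j + 1)"
    unfolding Suc by (simp add: pochhammer_Suc algebra_simps)
  have 2: "pochhammer (x + real j + 1) j = (x + real j + 1) * ?P"
    unfolding Suc by (simp add: pochhammer_rec algebra_simps)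
  have "rothe_coeff x (Suc j) = x * pochhammer (x + real j + 2) j / fact (Suc j)"
    by (simp add: rothe_coeff_def algebra_simps)
  moreover have "rothe_coeff (x - 1) (Suc j) = (x - 1) * pochhammer (x + real j + 1) j / fact (Suc j)"
    by (simp add: rothe_coeff_def algebra_simps)
  moreover have "rothe_coeff (x + 1) j = (x + 1) * ?P * real (Suc j) / fact (Suc j)"
  proof -
    have "rothe_coeff (x + 1) j = (x + 1) * ?P / fact j"
      using Suc by (simp add: rothe_coeff_def algebra_simps)
    then show ?thesis by simp
  qed
  moreover have "x * (?P * (x + 2 * real j + 1)) = (x - 1) * ((x + real j + 1) * ?P) + (x + 1) * ?P * real (Suc j)"
    by (simp add: algebra_simps)
  ultimately show ?thesis unfolding 1 2 by (simp only: add_divide_distrib)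
qed

definition is_poly_fun :: "(real \<Rightarrow> real) \<Rightarrow> bool" where
  "is_poly_fun f \<longleftrightarrow> (\<exists>p. f = poly p)"

lemma is_poly_fun_intros:
  "is_poly_fun (\<lambda>x. c)" "is_poly_fun (\<lambda>x. x)"
  "is_poly_fun f \<Longrightarrow> is_poly_fun g \<Longrightarrow> is_poly_fun (\<lambda>x. f x + g x)"
  "is_poly_fun f \<Longrightarrow> is_poly_fun g \<Longrightarrow> is_poly_fun (\<lambda>x. f x - g x)"
  "is_poly_fun f \<Longrightarrow> is_poly_fun g \<Longrightarrow> is_poly_fun (\<lambda>x. f x * g x)"
  "is_poly_fun f \<Longrightarrow> is_poly_fun (\<lambda>x. f x / c)"
proof -
  show "is_poly_fun (\<lambda>x. c)" unfolding is_poly_fun_def by (intro exI[of _ "[:c:]"]) auto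
  show "is_poly_fun (\<lambda>x. x)" unfolding is_poly_fun_def by (intro exI[of _ "[:0,1:]"]) auto
  { assume "is_poly_fun f" "is_poly_fun g"
    then obtain p q where "f = poly p" "g = poly q" unfolding is_poly_fun_def by auto
    then have "(\<lambda>x. f x + g x) = poly (p + q)" "(\<lambda>x. f x - g x) = poly (p - q)" "(\<lambda>x. f x * g x) = poly (p * q)"
      by auto
    then show "is_poly_fun (\<lambda>x. f x + g x)" "is_poly_fun (\<lambda>x. f x - g x)" "is_poly_fun (\<lambda>x. f x * g x)"
      unfolding is_poly_fun_def by blast+ }
  { assume "is_poly_fun f"
    then obtain p where "f = poly p" unfolding is_poly_fun_def by auto
    then have "(\<lambda>x. f x / c) = poly (smult (1 / c) p)" by auto
    then show "is_poly_fun (\<lambda>x. f x / c)" unfolding is_poly_fun_def by blast }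
qed

lemma is_poly_fun_sum:
  assumes "\<And>i. i \<in> A \<Longrightarrow> is_poly_fun (f i)"
  shows "is_poly_fun (\<lambda>x. \<Sum>i\<in>A. f i x)"
  using assms
proof (induction A rule: infinite_finite_induct)
  case (insert i A)
  then have "is_poly_fun (f i)" "is_poly_fun (\<lambda>x. \<Sum>i\<in>A. f i x)" by blast+
  then show ?case using insert.hyps by (simp add: is_poly_fun_intros(3))
qed (simp_all add: is_poly_fun_intros(1))

lemma is_poly_fun_prod:
  assumes "\<And>i. i \<in> A \<Longrightarrow> is_poly_fun (f i)"
  shows "is_poly_fun (\<lambda>x. \<Prod>i\<in>A. f i x)"
  using assms
proof (induction A rule: infinite_finite_induct)
  case (insert i A)
  then have "is_poly_fun (f i)" "is_poly_fun (\<lambda>x. \<Prod>i\<in>A. f i x)" by blast+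
  then show ?case using insert.hyps by (simp add: is_poly_fun_intros(5))
qed (simp_all add: is_poly_fun_intros(1))

lemma is_poly_fun_pochhammer: "is_poly_fun (\<lambda>x. pochhammer (x + c) n)"
  unfolding pochhammer_prod by (intro is_poly_fun_prod is_poly_fun_intros)

lemma is_poly_fun_rothe_coeff: "is_poly_fun (\<lambda>x. rothe_coeff x j)"
proof -
  have "is_poly_fun (\<lambda>x. x * pochhammer (x + (real j + 1)) (j - 1) / fact j)"
    by (intro is_poly_fun_intros is_poly_fun_pochhammer)
  then show ?thesis
    by (cases "j = 0") (simp_all add: rothe_coeff_def add.assoc is_poly_fun_intros(1))
qed

lemma is_poly_fun_eq_0:
  assumes "is_poly_fun f" "\<And>m::nat. f (real m) = 0"
  shows "f x = 0"
proof -
  obtain p where p: "f = poly p" using assms(1) unfolding is_poly_fun_def by auto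
  have "p = 0"
  proof (rule ccontr)
    assume "p \<noteq> 0"
    then have "finite {x. poly p x = 0}" by (rule poly_roots_finite)
    moreover have "range real \<subseteq> {x. poly p x = 0}" using assms(2) p by auto
    ultimately have "finite (range real)" by (rule rev_finite_subset)
    then show False using infinite_UNIV_nat finite_imageD[of real UNIV] by (auto simp: inj_on_def)
  qed
  then show ?thesis using p by simp
qed

text \<open>Both sides are polynomials in \<open>x\<close> that agree at \<open>0\<close> and, by
  induction, have the same increments under \<open>x \<mapsto> x + 1\<close>.\<close>
lemma Rothe_Hagen:
  "(\<Sum>j\<le>n. rothe_coeff x j * ((y - 2 * real j) gchoose (n - j))) = (x + y) gchoose n"
proof (induction n arbitrary: x y)
  case 0
  then show ?case by (simp add: rothe_coeff_def)
next
  case (Suc n)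
  define A where "A = (\<lambda>x. \<Sum>j\<le>Suc n. rothe_coeff x j * ((y - 2 * real j) gchoose (Suc n - j)))"
  define g where "g = (\<lambda>x. A x - ((x + y) gchoose Suc n))"
  have step: "g (x + 1) = g x" for x
  proof -
    have "A (x + 1) - A x = (\<Sum>j\<le>Suc n. (rothe_coeff (x + 1) j - rothe_coeff x j) * ((y - 2 * real j) gchoose (Suc n - j)))"
      unfolding A_def by (simp only: sum_subtractf left_diff_distrib)
    \<comment> \<open>The recurrence at \<open>x + 1\<close> turns the increment of term j + 1 into
      \<open>rothe_coeff (x + 2) j\<close>, and term 0 drops out. This is the induction hypothesis
      at x + 2 and y - 2.\<close>
    also have "\<dots> = (\<Sum>j\<le>n. rothe_coeff (x + 2) j * ((y - 2 - 2 * real j) gchoose (n - j)))"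
      unfolding sum.atMost_Suc_shift using rothe_coeff_rec[of "x + 1"]
      by (simp add: rothe_coeff_def[of _ 0] algebra_simps)
    also have "\<dots> = ((x + y) gchoose n)" unfolding Suc by simp
    finally have "A (x + 1) - A x = ((x + y) gchoose n)" .
    moreover have "(x + 1 + y) gchoose Suc n = ((x + y) gchoose n) + ((x + y) gchoose Suc n)"
      using gbinomial_Suc_Suc[of "x + y" n] by (simp add: algebra_simps)
    ultimately show ?thesis unfolding g_def by simp
  qed
  have zero: "g 0 = 0"
  proof -
    have "A 0 = (\<Sum>j\<in>{0}. rothe_coeff 0 j * ((y - 2 * real j) gchoose (Suc n - j)))"
      unfolding A_def by (rule sum.mono_neutral_right) (auto simp: rothe_coeff_def)
    then show ?thesis by (simp add: g_def rothe_coeff_def)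
  qed
  have "g (real m) = 0" for m
    by (induction m) (use zero step in \<open>auto simp: add.commute[of 1]\<close>)
  moreover have "is_poly_fun g"
    unfolding g_def A_def gbinomial_prod_rev
    by (intro is_poly_fun_intros is_poly_fun_sum is_poly_fun_rothe_coeff is_poly_fun_prod)
  ultimately have "g x = 0" using is_poly_fun_eq_0[of g x] by blast
  then show ?case unfolding g_def A_def by simp
qed

text \<open>Rothe-Hagen at y = \<delta> + k - 1, with the generalized binomials written as rising
  factorials; \<open>2 * n \<le> k\<close> makes the natural-number subtractions exact.\<close>

lemma Rothe_Hagen_pochhammer:
  assumes "2 * n \<le> k"
  shows "(\<Sum>j\<le>n. rothe_coeff \<beta> j * (pochhammer (\<delta> + real (k - j - n)) (n - j) / fact (n - j)))
     = pochhammer (\<beta> + \<delta> + real (k - n)) n / fact n"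
proof -
  have "(\<Sum>j\<le>n. rothe_coeff \<beta> j * (pochhammer (\<delta> + real (k - j - n)) (n - j) / fact (n - j)))
    = (\<Sum>j\<le>n. rothe_coeff \<beta> j * ((\<delta> + real k - 1 - 2 * real j) gchoose (n - j)))"
    by (intro sum.cong refl) (use assms in \<open>auto simp: gbinomial_pochhammer' of_nat_diff algebra_simps\<close>)
  also have "\<dots> = (\<beta> + (\<delta> + real k - 1)) gchoose n" by (rule Rothe_Hagen)
  also have "\<dots> = pochhammer (\<beta> + \<delta> + real (k - n)) n / fact n"
    using assms by (simp add: gbinomial_pochhammer' of_nat_diff algebra_simps)
  finally show ?thesis .
qed

section \<open>Zonal kernels\<close>

text \<open>The inversion solved for its term i = 0, with X standing for
  \<open>(norm x * norm y)\<^sup>2\<close> and c for \<open>x \<bullet> y\<close>. For \<delta> > 1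
  and X > 0 the value is (k + \<delta> - 1) / (\<delta> - 1) times X^(k/2) times the Gegenbauer
  polynomial of degree k and index \<delta> - 1 at c / sqrt X. That formula degenerates at \<delta>
  = 1, i.e. d = 2; the recursion is uniform in the dimension.\<close>

function zonal :: "real \<Rightarrow> nat \<Rightarrow> real \<Rightarrow> real \<Rightarrow> real" where
  "zonal \<delta> k X c = pochhammer \<delta> k * (2 ^ k * c ^ k / fact k -
     (\<Sum>i\<in>{1..k div 2}. X ^ i / (fact i * pochhammer \<delta> (k - i)) * zonal \<delta> (k - 2 * i) X c))"
  by pat_completeness auto
termination
proof (relation "Wellfounded.measure (\<lambda>(\<delta>, k, X, c). k)", rule wf_measure)
  fix \<delta> :: real and k i :: nat and X c :: real
  assume "i \<in> {1..k div 2}"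
  then have "1 \<le> i" "i \<le> k div 2" by (simp_all only: atLeastAtMost_iff)
  then have "k - 2 * i < k" by linarith
  then show "((\<delta>, k - 2 * i, X, c), (\<delta>, k, X, c)) \<in> Wellfounded.measure (\<lambda>(\<delta>, k, X, c). k)"
    by (simp only: in_measure split_conv)
qed

declare zonal.simps [simp del]

lemma power_eq_sum_zonal:
  assumes "\<delta> > 0"
  shows "2 ^ k * c ^ k / fact k =
    (\<Sum>i\<le>k div 2. X ^ i / (fact i * pochhammer \<delta> (k - i)) * zonal \<delta> (k - 2 * i) X c)"
proof -
  define S where "S = (\<Sum>i\<in>{1..k div 2}. X ^ i / (fact i * pochhammer \<delta> (k - i)) * zonal \<delta> (k - 2 * i) X c)"
  have p: "pochhammer \<delta> k > 0" using assms by (rule pochhammer_pos)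
  have "{..k div 2} = insert 0 {1..k div 2}" by auto
  then have "(\<Sum>i\<le>k div 2. X ^ i / (fact i * pochhammer \<delta> (k - i)) * zonal \<delta> (k - 2 * i) X c)
    = zonal \<delta> k X c / pochhammer \<delta> k + S"
    by (simp only: S_def) (subst sum.insert, auto)
  moreover have "zonal \<delta> k X c = pochhammer \<delta> k * (2 ^ k * c ^ k / fact k - S)"
    unfolding S_def by (rule zonal.simps)
  ultimately show ?thesis using p by simp
qed

text \<open>\<open>E\<^sub>k\<close> at points with \<open>x \<bullet> y = c\<close> and \<open>(norm x * norm y)\<^sup>2 = X\<close>; unlike the integral, the formula
  also makes sense for \<open>\<beta> = 0\<close>.\<close>
definition cone_coeff :: "real \<Rightarrow> real \<Rightarrow> nat \<Rightarrow> real \<Rightarrow> real \<Rightarrow> real" where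
  "cone_coeff \<delta> \<beta> k X c = (\<Sum>j\<le>k div 2. pochhammer \<delta> (k - 2 * j) / fact (k - 2 * j) *
     rothe_coeff \<beta> j * (X / 4) ^ j * c ^ (k - 2 * j)) / pochhammer (\<beta> + \<delta>) k"

text \<open>Expand every power of c in zonal kernels and collect the terms with i + j = n. The
  coefficient left over is the sum of \<open>Rothe_Hagen_pochhammer\<close>, whose value moves the
  parameter from \<delta> to \<beta> + \<delta>.\<close>

lemma cone_coeff_eq_sum_zonal:
  assumes \<delta>: "\<delta> > 0" and \<beta>: "\<beta> \<ge> 0"
  shows "2 ^ k * cone_coeff \<delta> \<beta> k X c =
    (\<Sum>i\<le>k div 2. X ^ i / (fact i * pochhammer (\<beta> + \<delta>) (k - i)) * zonal \<delta> (k - 2 * i) X c)"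
proof -
  let ?g = "\<lambda>j i. pochhammer \<delta> (k - 2 * j) * rothe_coeff \<beta> j * X ^ j *
      (X ^ i / (fact i * pochhammer \<delta> (k - 2 * j - i)) * zonal \<delta> (k - 2 * j - 2 * i) X c)"
  define L where "L = pochhammer (\<beta> + \<delta>) k"
  have pd: "pochhammer \<delta> n > 0" for n using \<delta> by (rule pochhammer_pos)
  have pl: "pochhammer (\<beta> + \<delta>) n > 0" for n using \<delta> \<beta> by (intro pochhammer_pos) auto
  have "2 ^ k * cone_coeff \<delta> \<beta> k X c * L
    = (\<Sum>j\<le>k div 2. pochhammer \<delta> (k - 2 * j) * rothe_coeff \<beta> j * X ^ j * (2 ^ (k - 2 * j) * c ^ (k - 2 * j) / fact (k - 2 * j)))" (is "_ = ?s")
  proof -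
    have "2 ^ k * cone_coeff \<delta> \<beta> k X c * L = (\<Sum>j\<le>k div 2. 2 ^ k * (pochhammer \<delta> (k - 2 * j) / fact (k - 2 * j) *
       rothe_coeff \<beta> j * (X / 4) ^ j * c ^ (k - 2 * j)))"
      using pl[of k] unfolding cone_coeff_def L_def sum_distrib_left[symmetric] by simp
    also have "\<dots> = ?s"
    proof (intro sum.cong refl)
      fix j assume "j \<in> {..k div 2}"
      then have "k = 2 * j + (k - 2 * j)" by auto
      then have "(2::real) ^ k = 2 ^ (2 * j) * 2 ^ (k - 2 * j)" by (metis power_add)
      then have "(2::real) ^ k = 4 ^ j * 2 ^ (k - 2 * j)" by (simp add: power_mult)
      then show "2 ^ k * (pochhammer \<delta> (k - 2 * j) / fact (k - 2 * j) * rothe_coeff \<beta> j * (X / 4) ^ j * c ^ (k - 2 * j)) =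
         pochhammer \<delta> (k - 2 * j) * rothe_coeff \<beta> j * X ^ j * (2 ^ (k - 2 * j) * c ^ (k - 2 * j) / fact (k - 2 * j))"
        by (simp add: power_divide)
    qed
    finally show ?thesis .
  qed
  also have "\<dots> = (\<Sum>j\<le>k div 2. \<Sum>i\<le>k div 2 - j. ?g j i)"
    unfolding power_eq_sum_zonal[OF \<delta>, of _ c X] sum_distrib_left
    by (intro sum.cong refl) auto
  also have "\<dots> = (\<Sum>n\<le>k div 2. \<Sum>j\<le>n. pochhammer \<delta> (k - 2 * j) * rothe_coeff \<beta> j * X ^ j *
      (X ^ (n - j) / (fact (n - j) * pochhammer \<delta> (k - 2 * j - (n - j))) * zonal \<delta> (k - 2 * j - 2 * (n - j)) X c))"
    by (rule sum_triangle_nested)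
  also have "\<dots> = (\<Sum>n\<le>k div 2. X ^ n * zonal \<delta> (k - 2 * n) X c * (pochhammer (\<beta> + \<delta> + real (k - n)) n / fact n))"
  proof (intro sum.cong refl)
    fix n assume n: "n \<in> {..k div 2}"
    have "(\<Sum>j\<le>n. ?g j (n - j))
      = (\<Sum>j\<le>n. X ^ n * zonal \<delta> (k - 2 * n) X c * (rothe_coeff \<beta> j * (pochhammer (\<delta> + real (k - j - n)) (n - j) / fact (n - j))))"
    proof (intro sum.cong refl)
      fix j assume j: "j \<in> {..n}"
      \<comment> \<open>Splitting at k - j - n cancels the denominator of the zonal expansion and
        leaves exactly the rising factorial of the Rothe-Hagen sum.\<close>
      have 1: "pochhammer \<delta> (k - 2 * j) = pochhammer \<delta> (k - j - n) * pochhammer (\<delta> + real (k - j - n)) (n - j)"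
      proof -
        have "k - 2 * j = (k - j - n) + (n - j)" using n j by auto
        then show ?thesis by (simp only: pochhammer_product')
      qed
      have 2: "k - 2 * j - (n - j) = k - j - n" "k - 2 * j - 2 * (n - j) = k - 2 * n" using n j by auto
      have 3: "X ^ n = X ^ j * X ^ (n - j)" using j by (simp flip: power_add)
      show "?g j (n - j) = X ^ n * zonal \<delta> (k - 2 * n) X c * (rothe_coeff \<beta> j * (pochhammer (\<delta> + real (k - j - n)) (n - j) / fact (n - j)))"
        unfolding 1 2 3 using pd[of "k - j - n"] by (simp add: field_simps)
    qed
    also have "\<dots> = X ^ n * zonal \<delta> (k - 2 * n) X c * (pochhammer (\<beta> + \<delta> + real (k - n)) n / fact n)"
      unfolding sum_distrib_left[symmetric] by (subst Rothe_Hagen_pochhammer) (use n in auto)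
    finally show "(\<Sum>j\<le>n. ?g j (n - j))
      = X ^ n * zonal \<delta> (k - 2 * n) X c * (pochhammer (\<beta> + \<delta> + real (k - n)) n / fact n)" .
  qed
  also have "\<dots> = (\<Sum>i\<le>k div 2. X ^ i / (fact i * pochhammer (\<beta> + \<delta>) (k - i)) * zonal \<delta> (k - 2 * i) X c) * L"
    unfolding sum_distrib_right
  proof (intro sum.cong refl)
    fix n assume n: "n \<in> {..k div 2}"
    have "L = pochhammer (\<beta> + \<delta>) (k - n) * pochhammer (\<beta> + \<delta> + real (k - n)) n"
      unfolding L_def using n pochhammer_product'[of "\<beta> + \<delta>" "k - n" n] by auto
    then show "X ^ n * zonal \<delta> (k - 2 * n) X c * (pochhammer (\<beta> + \<delta> + real (k - n)) n / fact n)
      = X ^ n / (fact n * pochhammer (\<beta> + \<delta>) (k - n)) * zonal \<delta> (k - 2 * n) X c * L"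
      using pl[of "k - n"] by simp
  qed
  finally show ?thesis using pl[of k] unfolding L_def by simp
qed

text \<open>The Laguerre polynomial of parameter \<open>\<mu> - 1\<close>, normalized to the value \<open>1\<close> at \<open>0\<close>.\<close>
definition lag :: "real \<Rightarrow> nat \<Rightarrow> real \<Rightarrow> real" where
  "lag \<mu> N X = (\<Sum>a\<le>N. (-1) ^ a * real (N choose a) * X ^ a / pochhammer \<mu> a)"

section \<open>The Hille-Hardy formula\<close>

text \<open>The right side is the coefficient of w^N in (1 - w)^(-\<mu>) exp(-(X + Y) w / (1 - w))
  times the 0F1 series with parameter \<mu> at X Y w / (1 - w)^2. Comparing the coefficients of X^a
  Y^b on both sides reduces the claim to \<open>pochhammer_Saalschuetz\<close>.\<close>

lemma Hille_Hardy_coefficient: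
  assumes \<mu>: "\<mu> > 0"
  shows "pochhammer \<mu> N / fact N * lag \<mu> N X * lag \<mu> N Y =
    (\<Sum>h\<le>N. \<Sum>p\<le>N - h. (- (X + Y)) ^ p / fact p * ((X * Y) ^ h / (fact h * pochhammer \<mu> h)) *
       (pochhammer (\<mu> + real (p + 2 * h)) (N - h - p) / fact (N - h - p)))" (is "_ = ?R")
proof -
  have pm: "pochhammer \<mu> n > 0" for n using \<mu> by (rule pochhammer_pos)
  \<comment> \<open>The share of h in the coefficient of (-X)^a (-Y)^b on the right: of the
    exponents, h each come from (X Y)^h, and the binomial theorem for p = a + b - 2h supplies a - h
    and b - h. The later reindexing uses u = a - h.\<close>
  define W where "W = (\<lambda>a b h. pochhammer (\<mu> + real (a + b)) (N + h - a - b) /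
      (fact h * fact (a - h) * fact (b - h) * fact (N + h - a - b) * pochhammer \<mu> h))"
  have coef: "pochhammer \<mu> N / fact N * (real (N choose a) / pochhammer \<mu> a) * (real (N choose b) / pochhammer \<mu> b)
     = (\<Sum>h | h \<le> a \<and> h \<le> b \<and> a + b \<le> N + h. W a b h)" (is "?l = _") if a: "a \<le> N" for a b
  proof -
    let ?t = "\<lambda>h. pochhammer \<mu> N * real (N choose a) / (fact N * pochhammer \<mu> (a + b)) *
      (real (a choose h) * real ((N - a) choose (b - h)) * pochhammer (\<mu> + real N) h / pochhammer \<mu> h)"
    have "?l = pochhammer \<mu> N * real (N choose a) / (fact N * pochhammer \<mu> (a + b)) * (real (N choose b) * pochhammer \<mu> (a + b) / (pochhammer \<mu> a * pochhammer \<mu> b))"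
      using pm[of "a + b"] by simp
    also have "\<dots> = (\<Sum>h\<le>b. ?t h)"
      by (simp only: pochhammer_Saalschuetz[OF \<mu> a, symmetric] sum_distrib_left)
    also have "\<dots> = (\<Sum>h | h \<le> a \<and> h \<le> b \<and> a + b \<le> N + h. ?t h)"
    proof (rule sum.mono_neutral_right)
      show "\<forall>h\<in>{..b} - {h. h \<le> a \<and> h \<le> b \<and> a + b \<le> N + h}. ?t h = 0"
      proof
        fix h assume "h \<in> {..b} - {h. h \<le> a \<and> h \<le> b \<and> a + b \<le> N + h}"
        then have "a < h \<or> N - a < b - h" using a by auto
        then have "real (a choose h) * real ((N - a) choose (b - h)) = 0" by (auto simp: binomial_eq_0)
        then show "?t h = 0" by simp
      qed
    qed auto
    also have "\<dots> = (\<Sum>h | h \<le> a \<and> h \<le> b \<and> a + b \<le> N + h. W a b h)"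
    proof (intro sum.cong refl)
      fix h assume "h \<in> {h. h \<le> a \<and> h \<le> b \<and> a + b \<le> N + h}"
      then have h: "h \<le> a" "h \<le> b" "a + b \<le> N + h" by auto
      have "pochhammer \<mu> N * pochhammer (\<mu> + real N) h = pochhammer \<mu> (N + h)"
        by (simp only: pochhammer_product')
      also have "\<dots> = pochhammer \<mu> (a + b) * pochhammer (\<mu> + real (a + b)) (N + h - a - b)"
        using h pochhammer_product'[of \<mu> "a + b" "N + h - a - b"] by simp
      finally have 1: "pochhammer \<mu> N * pochhammer (\<mu> + real N) h = pochhammer \<mu> (a + b) * pochhammer (\<mu> + real (a + b)) (N + h - a - b)" .
      have 2: "real (N choose a) * real (a choose h) * real ((N - a) choose (b - h)) / fact N
         = 1 / (fact h * fact (a - h) * fact (b - h) * fact (N + h - a - b))"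
      proof -
        have "N - a - (b - h) = N + h - a - b" using h a by auto
        then show ?thesis using h a by (simp add: binomial_fact field_simps)
      qed
      have "?t h
        = (pochhammer \<mu> N * pochhammer (\<mu> + real N) h) / (pochhammer \<mu> (a + b) * pochhammer \<mu> h) *
          (real (N choose a) * real (a choose h) * real ((N - a) choose (b - h)) / fact N)"
        by (simp add: mult_ac)
      also have "\<dots> = W a b h" unfolding 1 2 W_def using pm[of "a + b"] by simp
      finally show "?t h = W a b h" .
    qed
    finally show ?thesis .
  qed
  define T where "T = (SIGMA a:{..N}. SIGMA b:{..N}. {h. h \<le> a \<and> h \<le> b \<and> a + b \<le> N + h})"
  define U where "U = (SIGMA h:{..N}. SIGMA p:{..N - h}. {..p})"
  have "pochhammer \<mu> N / fact N * lag \<mu> N X * lag \<mu> N Y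
    = (\<Sum>a\<le>N. \<Sum>b\<le>N. (-X) ^ a * (-Y) ^ b * (pochhammer \<mu> N / fact N * (real (N choose a) / pochhammer \<mu> a) * (real (N choose b) / pochhammer \<mu> b)))"
    unfolding lag_def mult.assoc sum_product unfolding sum_distrib_left
    by (intro sum.cong refl) (simp add: power_minus[of X] power_minus[of Y])
  also have "\<dots> = (\<Sum>a\<le>N. \<Sum>b\<le>N. \<Sum>h | h \<le> a \<and> h \<le> b \<and> a + b \<le> N + h. (-X) ^ a * (-Y) ^ b * W a b h)"
    unfolding sum_distrib_left[symmetric]
    by (intro sum.cong refl arg_cong2[where f="(*)"]) (use coef in simp)
  also have "\<dots> = (\<Sum>(a,b,h)\<in>T. (-X) ^ a * (-Y) ^ b * W a b h)"
    unfolding T_def by (rule sum_Sigma_Sigma) auto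
  also have "\<dots> = (\<Sum>(h,p,u)\<in>U. (-X) ^ (u + h) * (-Y) ^ (p - u + h) * W (u + h) (p - u + h) h)"
    by (rule sum.reindex_bij_witness[of _ "\<lambda>(h,p,u). (u + h, p - u + h, h)" "\<lambda>(a,b,h). (h, a + b - 2 * h, a - h)"])
       (auto simp: T_def U_def)
  also have "\<dots> = (\<Sum>h\<le>N. \<Sum>p\<le>N - h. \<Sum>u\<le>p. (-X) ^ (u + h) * (-Y) ^ (p - u + h) * W (u + h) (p - u + h) h)"
    unfolding U_def by (rule sum_Sigma_Sigma[symmetric]) auto
  also have "\<dots> = ?R"
  proof (intro sum.cong refl)
    fix h p assume "h \<in> {..N}" "p \<in> {..N - h}"
    then have hp: "h + p \<le> N" by auto
    have "(- (X + Y)) ^ p / fact p = (\<Sum>u\<le>p. real (p choose u) * (-X) ^ u * (-Y) ^ (p - u)) / fact p"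
      by (subst binomial_ring[symmetric]) simp
    also have "\<dots> = (\<Sum>u\<le>p. (-X) ^ u * (-Y) ^ (p - u) / (fact u * fact (p - u)))"
      unfolding sum_divide_distrib by (intro sum.cong refl) (simp add: binomial_fact field_simps)
    finally have 1: "(- (X + Y)) ^ p / fact p = (\<Sum>u\<le>p. (-X) ^ u * (-Y) ^ (p - u) / (fact u * fact (p - u)))" .
    show "(\<Sum>u\<le>p. (-X) ^ (u + h) * (-Y) ^ (p - u + h) * W (u + h) (p - u + h) h) = (- (X + Y)) ^ p / fact p * ((X * Y) ^ h / (fact h * pochhammer \<mu> h)) *
       (pochhammer (\<mu> + real (p + 2 * h)) (N - h - p) / fact (N - h - p))"
      unfolding 1 sum_distrib_right
    proof (intro sum.cong refl)
      fix u assume u: "u \<in> {..p}"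
      have 2: "real (u + h + (p - u + h)) = real (p + 2 * h)" "N + h - (u + h) - (p - u + h) = N - h - p"
        "u + h - h = u" "p - u + h - h = p - u" using u hp by auto
      have 3: "(-X) ^ (u + h) * (-Y) ^ (p - u + h) = (-X) ^ u * (-Y) ^ (p - u) * (X * Y) ^ h"
        by (simp add: power_add mult_ac flip: power_mult_distrib)
      show "(-X) ^ (u + h) * (-Y) ^ (p - u + h) * W (u + h) (p - u + h) h = (-X) ^ u * (-Y) ^ (p - u) / (fact u * fact (p - u)) * ((X * Y) ^ h / (fact h * pochhammer \<mu> h)) *
       (pochhammer (\<mu> + real (p + 2 * h)) (N - h - p) / fact (N - h - p))"
        unfolding W_def 2 3 by simp
    qed
  qed
  finally show ?thesis .
qed

text \<open>At X = \<open>x \<bullet> x\<close>, Y = \<open>y \<bullet> y\<close>, c =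
  \<open>x \<bullet> y\<close> and \<alpha> = \<beta> + \<delta> this is the reproducing kernel of
  degree n: i is the Laguerre degree, n - 2i the zonal degree, and the leading quotient is the
  reciprocal of the norm factor in \<open>cone_mean_lag_zonal\<close>.\<close>

definition mehler_coeff :: "real \<Rightarrow> real \<Rightarrow> nat \<Rightarrow> real \<Rightarrow> real \<Rightarrow> real \<Rightarrow> real" where
  "mehler_coeff \<delta> \<alpha> n X Y c = (\<Sum>i\<le>n div 2.
     pochhammer (\<alpha> + real (n - 2 * i)) i / (fact i * pochhammer \<alpha> (n - 2 * i)) *
     lag (\<alpha> + real (n - 2 * i)) i X * lag (\<alpha> + real (n - 2 * i)) i Y * zonal \<delta> (n - 2 * i) (X * Y) c)"

text \<open>Apply Hille-Hardy to each pair of Laguerre factors. With j = n - 2i,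
  \<open>pochhammer \<alpha> j * pochhammer (\<alpha> + j) h\<close> is
  \<open>pochhammer \<alpha> (j + h)\<close>, so the terms with the same k = j + 2h = n - 2m form
  the zonal expansion of \<open>cone_coeff\<close> of degree k.\<close>

lemma mehler_coeff_eq:
  assumes \<delta>: "\<delta> > 0" and \<beta>: "\<beta> \<ge> 0"
  defines "\<alpha> \<equiv> \<beta> + \<delta>"
  shows "mehler_coeff \<delta> \<alpha> n X Y c = (\<Sum>m\<le>n div 2. \<Sum>p\<le>m.
    (- (X + Y)) ^ p / fact p * (2 ^ (n - 2 * m) * cone_coeff \<delta> \<beta> (n - 2 * m) (X * Y) c) *
    (pochhammer (\<alpha> + real (p + (n - 2 * m))) (m - p) / fact (m - p)))" (is "_ = ?R")
proof -
  have \<alpha>: "\<alpha> > 0" using \<delta> \<beta> by (simp add: \<alpha>_def)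
  have pl: "pochhammer \<alpha> n > 0" for n using \<alpha> by (rule pochhammer_pos)
  define G where "G = (\<lambda>m h. \<Sum>p\<le>m. (- (X + Y)) ^ p / fact p *
     ((X * Y) ^ h / (fact h * pochhammer \<alpha> (n - 2 * m - h)) * zonal \<delta> (n - 2 * m - 2 * h) (X * Y) c) *
     (pochhammer (\<alpha> + real (p + (n - 2 * m))) (m - p) / fact (m - p)))"
  have "?R = (\<Sum>m\<le>n div 2. \<Sum>h\<le>n div 2 - m. G m h)"
  proof (rule sum.cong[OF refl])
    fix m assume "m \<in> {..n div 2}"
    have d: "(n - 2 * m) div 2 = n div 2 - m" by auto
    show "(\<Sum>p\<le>m. (- (X + Y)) ^ p / fact p * (2 ^ (n - 2 * m) * cone_coeff \<delta> \<beta> (n - 2 * m) (X * Y) c) *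
      (pochhammer (\<alpha> + real (p + (n - 2 * m))) (m - p) / fact (m - p))) = (\<Sum>h\<le>n div 2 - m. G m h)"
      unfolding cone_coeff_eq_sum_zonal[OF \<delta> \<beta>] G_def d \<alpha>_def[symmetric]
      by (subst sum.swap) (simp only: sum_distrib_left sum_distrib_right)
  qed
  also have "\<dots> = (\<Sum>i\<le>n div 2. \<Sum>m\<le>i. G m (i - m))" by (rule sum_triangle_nested)
  also have "\<dots> = (\<Sum>i\<le>n div 2. \<Sum>h\<le>i. G (i - h) h)"
  proof (rule sum.cong[OF refl])
    fix i show "(\<Sum>m\<le>i. G m (i - m)) = (\<Sum>h\<le>i. G (i - h) h)"
      by (rule sum.reindex_bij_witness[of _ "\<lambda>h. i - h" "\<lambda>m. i - m"]) auto
  qed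
  also have "\<dots> = mehler_coeff \<delta> \<alpha> n X Y c"
    unfolding mehler_coeff_def
  proof (intro sum.cong refl)
    fix i assume i: "i \<in> {..n div 2}"
    define j where "j = n - 2 * i"
    have \<mu>: "\<alpha> + real j > 0" using \<alpha> by auto
    let ?l = "pochhammer (\<alpha> + real j) i / (fact i * pochhammer \<alpha> j) * lag (\<alpha> + real j) i X * lag (\<alpha> + real j) i Y * zonal \<delta> j (X * Y) c"
    have "?l = (zonal \<delta> j (X * Y) c / pochhammer \<alpha> j) * (pochhammer (\<alpha> + real j) i / fact i * lag (\<alpha> + real j) i X * lag (\<alpha> + real j) i Y)" by (simp add: mult_ac)
    also have "\<dots> = (\<Sum>h\<le>i. G (i - h) h)"
      unfolding Hille_Hardy_coefficient[OF \<mu>] sum_distrib_left G_def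
    proof (intro sum.cong refl)
      fix h p assume h: "h \<in> {..i}" and p: "p \<in> {..i - h}"
      have 1: "n - 2 * (i - h) = j + 2 * h" "j + 2 * h - 2 * h = j" "j + 2 * h - h = j + h"
        using h i by (auto simp: j_def)
      have 2: "pochhammer \<alpha> (j + h) = pochhammer \<alpha> j * pochhammer (\<alpha> + real j) h"
        by (simp only: pochhammer_product')
      show "zonal \<delta> j (X * Y) c / pochhammer \<alpha> j * ((- (X + Y)) ^ p / fact p * ((X * Y) ^ h / (fact h * pochhammer (\<alpha> + real j) h)) *
          (pochhammer (\<alpha> + real j + real (p + 2 * h)) (i - h - p) / fact (i - h - p))) =
         (- (X + Y)) ^ p / fact p * ((X * Y) ^ h / (fact h * pochhammer \<alpha> (n - 2 * (i - h) - h)) * zonal \<delta> (n - 2 * (i - h) - 2 * h) (X * Y) c) *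
          (pochhammer (\<alpha> + real (p + (n - 2 * (i - h)))) (i - h - p) / fact (i - h - p))"
        unfolding 1 2 by (simp add: algebra_simps)
    qed
    finally have "?l = (\<Sum>h\<le>i. G (i - h) h)" .
    then show "(\<Sum>h\<le>i. G (i - h) h) = pochhammer (\<alpha> + real (n - 2 * i)) i / (fact i * pochhammer \<alpha> (n - 2 * i)) *
      lag (\<alpha> + real (n - 2 * i)) i X * lag (\<alpha> + real (n - 2 * i)) i Y * zonal \<delta> (n - 2 * i) (X * Y) c"
      unfolding j_def by (rule sym)
  qed
  finally show ?thesis by simp
qed

section \<open>Orthogonality and completeness of the Laguerre polynomials\<close>

text \<open>Up to sign an i-th finite difference of a monic polynomial of degree p, hence 0 for p <
  i and i! for p = i. The induction takes one difference at a time.\<close>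

lemma alternating_sum_pochhammer:
  fixes \<mu> :: real
  assumes "p \<le> i"
  shows "(\<Sum>k\<le>i. (-1) ^ k * real (i choose k) * pochhammer (\<mu> + real k) p) = (if p = i then (-1) ^ i * fact i else 0)"
  using assms
proof (induction i arbitrary: p \<mu>)
  case 0
  then show ?case by simp
next
  case (Suc i)
  define D where "D = (\<lambda>i p \<mu>. \<Sum>k\<le>i. (-1) ^ k * real (i choose k) * pochhammer (\<mu> + real k) p)"
  have ext: "D i p \<mu> = (\<Sum>k\<le>Suc i. (-1) ^ k * real (i choose k) * pochhammer (\<mu> + real k) p)" for p \<mu>
    unfolding D_def by (simp add: binomial_eq_0)
  have "D (Suc i) p \<mu> = pochhammer \<mu> p +
     (\<Sum>k\<le>i. (-1) ^ Suc k * real (i choose Suc k) * pochhammer (\<mu> + real (Suc k)) p) +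
     (\<Sum>k\<le>i. (-1) ^ Suc k * real (i choose k) * pochhammer (\<mu> + real (Suc k)) p)"
  proof -
    have "(\<Sum>k\<le>i. (-1) ^ Suc k * real (Suc i choose Suc k) * pochhammer (\<mu> + real (Suc k)) p) =
     (\<Sum>k\<le>i. (-1) ^ Suc k * real (i choose Suc k) * pochhammer (\<mu> + real (Suc k)) p) +
     (\<Sum>k\<le>i. (-1) ^ Suc k * real (i choose k) * pochhammer (\<mu> + real (Suc k)) p)"
      unfolding sum.distrib[symmetric] by (intro sum.cong refl) (simp add: ring_distribs)
    then show ?thesis unfolding D_def sum.atMost_Suc_shift by simp
  qed
  also have "pochhammer \<mu> p + (\<Sum>k\<le>i. (-1) ^ Suc k * real (i choose Suc k) * pochhammer (\<mu> + real (Suc k)) p) = D i p \<mu>"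
    unfolding ext sum.atMost_Suc_shift by simp
  also have "(\<Sum>k\<le>i. (-1) ^ Suc k * real (i choose k) * pochhammer (\<mu> + real (Suc k)) p) = - D i p (\<mu> + 1)"
    unfolding D_def by (simp add: sum_negf[symmetric] algebra_simps)
  finally have D: "D (Suc i) p \<mu> = D i p \<mu> - D i p (\<mu> + 1)" by simp
  show ?case
  proof (cases p)
    case 0
    then show ?thesis using D unfolding D_def by simp
  next
    case (Suc q)
    have q: "q \<le> i" using Suc Suc.prems by simp
    have "pochhammer x p - pochhammer (x + 1) p = - real p * pochhammer (x + 1) q" for x :: real
      using pochhammer_rec[of x q] pochhammer_Suc[of "x + 1" q] Suc by (simp add: algebra_simps)
    then have pd: "pochhammer (x + real k) p - pochhammer (x + 1 + real k) p = - real p * pochhammer (x + 1 + real k) q" for x :: real and k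
    proof -
      have e: "x + 1 + real k = x + real k + 1" by simp
      show ?thesis unfolding e by (rule \<open>\<And>x. pochhammer x p - pochhammer (x + 1) p = - real p * pochhammer (x + 1) q\<close>)
    qed
    have "D (Suc i) p \<mu> = (\<Sum>k\<le>i. (-1) ^ k * real (i choose k) * (pochhammer (\<mu> + real k) p - pochhammer (\<mu> + 1 + real k) p))"
      unfolding D unfolding D_def sum_subtractf[symmetric] by (simp only: right_diff_distrib)
    also have "\<dots> = - real p * D i q (\<mu> + 1)"
      unfolding pd D_def sum_distrib_left by (intro sum.cong refl) simp
    also have "\<dots> = - real p * (if q = i then (-1) ^ i * fact i else 0)"
      unfolding D_def using Suc.IH[OF q, of "\<mu> + 1"] by simp
    also have "\<dots> = (if p = Suc i then (-1) ^ Suc i * fact (Suc i) else 0)"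
      using Suc by (auto simp: algebra_simps)
    finally show ?thesis unfolding D_def .
  qed
qed

text \<open>\<open>pochhammer \<mu> n\<close> is the n-th moment of the Gamma density with parameter
  \<mu>, so this is Laguerre orthogonality written without an integral. For i' \<le> i, dividing by
  \<open>pochhammer \<mu> b\<close> makes the inner sum an i-th difference of degree a \<le> i; the
  case i' > i follows by symmetry.\<close>

lemma lag_orthogonal:
  assumes \<mu>: "\<mu> > 0"
  shows "(\<Sum>a\<le>i'. \<Sum>b\<le>i. (-1) ^ a * real (i' choose a) / pochhammer \<mu> a *
     ((-1) ^ b * real (i choose b) / pochhammer \<mu> b) * pochhammer \<mu> (a + b))
    = (if i' = i then fact i / pochhammer \<mu> i else 0)"
proof -
  have pm: "pochhammer \<mu> n > 0" for n using \<mu> by (rule pochhammer_pos)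
  define S where "S = (\<lambda>i' i. \<Sum>a\<le>i'. \<Sum>b\<le>i. (-1) ^ a * real (i' choose a) / pochhammer \<mu> a *
     ((-1) ^ b * real (i choose b) / pochhammer \<mu> b) * pochhammer \<mu> (a + b))"
  have le: "S i' i = (if i' = i then fact i / pochhammer \<mu> i else 0)" if "i' \<le> i" for i' i
  proof -
    have "S i' i = (\<Sum>a\<le>i'. (-1) ^ a * real (i' choose a) / pochhammer \<mu> a *
      (\<Sum>b\<le>i. (-1) ^ b * real (i choose b) * pochhammer (\<mu> + real b) a))"
      unfolding S_def sum_distrib_left
    proof (intro sum.cong refl)
      fix a b
      have "pochhammer \<mu> (a + b) = pochhammer \<mu> b * pochhammer (\<mu> + real b) a"
        by (metis add.commute pochhammer_product')
      then show "(-1) ^ a * real (i' choose a) / pochhammer \<mu> a * ((-1) ^ b * real (i choose b) / pochhammer \<mu> b) * pochhammer \<mu> (a + b)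
        = (-1) ^ a * real (i' choose a) / pochhammer \<mu> a * ((-1) ^ b * real (i choose b) * pochhammer (\<mu> + real b) a)"
        using pm[of b] by simp
    qed
    also have "\<dots> = (\<Sum>a\<le>i'. (if a = i then (-1) ^ a * real (i' choose a) / pochhammer \<mu> a * ((-1) ^ i * fact i) else 0))"
      by (intro sum.cong refl) (use that in \<open>simp add: alternating_sum_pochhammer\<close>)
    also have "\<dots> = (if i' = i then fact i / pochhammer \<mu> i else 0)"
      using that by (simp add: sum.delta power_mult_distrib[symmetric] flip: mult.assoc)
    finally show ?thesis .
  qed
  have "S i' i = S i i'"
    unfolding S_def by (subst sum.swap) (simp add: mult_ac add.commute)
  then have "S i' i = (if i' = i then fact i / pochhammer \<mu> i else 0)"
    using le[of i' i] le[of i i'] by (cases "i' \<le> i") auto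
  then show ?thesis unfolding S_def .
qed

lemma power_eq_sum_lag:
  assumes \<mu>: "\<mu> > 0"
  shows "\<exists>e. \<forall>X. X ^ p = (\<Sum>i\<le>p. e i * lag \<mu> i X)"
proof (induction p rule: less_induct)
  case (less p)
  have pm: "pochhammer \<mu> p > 0" using \<mu> by (rule pochhammer_pos)
  have "\<forall>a. \<exists>e. a < p \<longrightarrow> (\<forall>X. X ^ a = (\<Sum>i\<le>a. e i * lag \<mu> i X))"
    using less by blast
  then obtain e where e: "\<And>a X. a < p \<Longrightarrow> X ^ a = (\<Sum>i\<le>a. e a i * lag \<mu> i X)"
    by metis
  define co where "co = (\<lambda>a. (-1) ^ a * real (p choose a) / pochhammer \<mu> a)"
  \<comment> \<open>Solve \<open>lag \<mu> p\<close> for its leading term and substitute the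
    expansions of the lower powers; the conditional extends \<open>e a i\<close> by zero to i > a,
    so that all inner sums share the range i < p.\<close>
  define E where "E = (\<lambda>i. if i = p then 1 / co p else - (\<Sum>a<p. if i \<le> a then co a * e a i else 0) / co p)"
  have cp: "co p \<noteq> 0" unfolding co_def using pm by simp
  have "X ^ p = (\<Sum>i\<le>p. E i * lag \<mu> i X)" for X
  proof -
    have "lag \<mu> p X = (\<Sum>a<p. co a * X ^ a) + co p * X ^ p"
      unfolding lag_def co_def by (simp add: lessThan_Suc_atMost[symmetric])
    also have "(\<Sum>a<p. co a * X ^ a) = (\<Sum>a<p. \<Sum>i<p. (if i \<le> a then co a * e a i else 0) * lag \<mu> i X)"
    proof (intro sum.cong refl)
      fix a assume a: "a \<in> {..<p}"
      have "co a * X ^ a = (\<Sum>i\<le>a. co a * e a i * lag \<mu> i X)"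
        using e[of a X] a by (simp add: sum_distrib_left mult_ac)
      also have "\<dots> = (\<Sum>i\<le>a. (if i \<le> a then co a * e a i else 0) * lag \<mu> i X)"
        by (intro sum.cong) auto
      also have "\<dots> = (\<Sum>i<p. (if i \<le> a then co a * e a i else 0) * lag \<mu> i X)"
        by (rule sum.mono_neutral_left) (use a in auto)
      finally show "co a * X ^ a = (\<Sum>i<p. (if i \<le> a then co a * e a i else 0) * lag \<mu> i X)" .
    qed
    also have "\<dots> = - co p * (\<Sum>i<p. E i * lag \<mu> i X)"
      unfolding sum_distrib_left using cp
      by (subst sum.swap) (auto intro!: sum.cong simp: E_def sum_distrib_right)
    finally have "co p * X ^ p = lag \<mu> p X + co p * (\<Sum>i<p. E i * lag \<mu> i X)" by simp
    then have "X ^ p = (lag \<mu> p X + co p * (\<Sum>i<p. E i * lag \<mu> i X)) / co p"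
      using cp by (simp add: nonzero_eq_divide_eq mult.commute)
    also have "\<dots> = (\<Sum>i\<le>p. E i * lag \<mu> i X)"
      using cp by (simp add: lessThan_Suc_atMost[symmetric] fun_cong[OF E_def, of p] add_divide_distrib)
    finally show ?thesis .
  qed
  then show ?case by blast
qed

section \<open>The surface measure of the sphere\<close>

lemma scale_measure_eq_density: "scale_measure r M = density M (\<lambda>_. r)"
  by (rule measure_eqI) (simp_all add: emeasure_density_const)

lemma sgn_measurable_sphere:
  "sgn \<in> restrict_space lborel (ball 0 1 - {0}) \<rightarrow>\<^sub>M restrict_space borel (sphere (0 :: 'a::euclidean_space) 1)"
proof (rule measurable_restrict_space2)
  show "sgn \<in> space (restrict_space lborel (ball 0 1 - {0})) \<rightarrow> sphere (0::'a) 1"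
    by (auto simp: space_restrict_space norm_sgn)
  have "sgn \<in> borel_measurable (borel :: 'a measure)"
    unfolding sgn_div_norm[abs_def] by measurable
  then show "sgn \<in> borel_measurable (restrict_space lborel (ball 0 1 - {0 :: 'a}))"
    by (intro measurable_restrict_space1) simp
qed

lemma space_sphere_measure: "space (sphere_measure :: (real ^ 'n) measure) = sphere 0 1"
  by (simp add: sphere_measure_def space_scale_measure space_restrict_space)

lemma sets_sphere_measure [measurable_cong]:
  "sets (sphere_measure :: (real ^ 'n) measure) = sets (restrict_space borel (sphere 0 1))"
  by (simp add: sphere_measure_def)

lemma measurable_sphere_measure:
  "g \<in> borel \<rightarrow>\<^sub>M N \<Longrightarrow> g \<in> (sphere_measure :: (real ^ 'n) measure) \<rightarrow>\<^sub>M N"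
  unfolding measurable_cong_sets[OF sets_sphere_measure refl] by (rule measurable_restrict_space1)

lemma sphere_integral_eq:
  fixes g :: "real ^ 'n \<Rightarrow> real"
  assumes g: "g \<in> borel_measurable borel"
  shows "(LINT \<xi>|sphere_measure. g \<xi>) =
    real CARD('n) * (LINT x|lborel. indicator (ball 0 1 - {0}) x *\<^sub>R g (sgn x))"
proof -
  let ?M = "distr (restrict_space lborel (ball 0 1 - {0})) (restrict_space borel (sphere 0 1)) sgn :: (real ^ 'n) measure"
  have m: "g \<in> borel_measurable ?M" using g by (simp add: measurable_restrict_space1)
  have "(LINT \<xi>|sphere_measure. g \<xi>) = (LINT \<xi>|density ?M (\<lambda>_. ennreal (real CARD('n))). g \<xi>)"
    unfolding sphere_measure_def scale_measure_eq_density by (simp add: ennreal_of_nat_eq_real_of_nat)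
  also have "\<dots> = real CARD('n) * (LINT \<xi>|?M. g \<xi>)"
    using m by (subst integral_density) auto
  also have "(LINT \<xi>|?M. g \<xi>) = (LINT x|restrict_space lborel (ball 0 1 - {0}). g (sgn x))"
    using g by (intro integral_distr sgn_measurable_sphere) (simp add: measurable_restrict_space1)
  also have "\<dots> = (LINT x|lborel. indicator (ball 0 1 - {0}) x *\<^sub>R g (sgn x))"
    by (rule integral_restrict_space) auto
  finally show ?thesis .
qed

lemma finite_measure_sphere_measure: "finite_measure (sphere_measure :: (real ^ 'n) measure)"
proof
  let ?M = "distr (restrict_space lborel (ball 0 1 - {0})) (restrict_space borel (sphere 0 1)) sgn :: (real ^ 'n) measure"
  have "emeasure ?M (sphere 0 1) = emeasure (restrict_space lborel (ball 0 1 - {0}))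
     (sgn -` sphere 0 1 \<inter> space (restrict_space lborel (ball 0 1 - {0 :: real ^ 'n})))"
    by (rule emeasure_distr[OF sgn_measurable_sphere]) (auto simp: sets_restrict_space)
  also have "\<dots> \<le> emeasure (restrict_space lborel (ball 0 1 - {0})) (ball 0 1 - {0 :: real ^ 'n})"
    by (intro emeasure_mono) (auto simp: space_restrict_space sets_restrict_space)
  also have "\<dots> = emeasure lborel (ball 0 1 - {0 :: real ^ 'n})"
    by (rule emeasure_restrict_space) auto
  also have "\<dots> \<le> emeasure lborel (ball 0 1 :: (real ^ 'n) set)" by (intro emeasure_mono) auto
  also have "\<dots> < \<infinity>" using emeasure_lborel_ball_finite by (simp add: top.not_eq_extremum)
  finally show "emeasure (sphere_measure :: (real ^ 'n) measure) (space sphere_measure) \<noteq> \<infinity>"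
    unfolding space_sphere_measure unfolding sphere_measure_def emeasure_scale_measure
    by (simp add: ennreal_mult_eq_top_iff)
qed

lemma sphere_integrable:
  fixes g :: "real ^ 'n \<Rightarrow> real"
  assumes g: "continuous_on UNIV g"
  shows "integrable sphere_measure g"
proof -
  interpret finite_measure "sphere_measure :: (real ^ 'n) measure" by (rule finite_measure_sphere_measure)
  have "bounded (g ` sphere 0 1)"
    by (intro compact_imp_bounded compact_continuous_image continuous_on_subset[OF g]) auto
  then obtain B where "\<forall>v\<in>g ` sphere 0 1. norm v \<le> B"
    unfolding bounded_iff by blast
  then have B: "\<And>\<xi>. \<xi> \<in> sphere 0 1 \<Longrightarrow> norm (g \<xi>) \<le> B" by blast
  have "g \<in> borel_measurable borel" using g by (rule borel_measurable_continuous_onI)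
  then have "g \<in> borel_measurable sphere_measure" by (rule measurable_sphere_measure)
  then show ?thesis
    by (rule integrable_const_bound[of _ B, rotated]) (use B in \<open>auto simp: space_sphere_measure intro!: AE_I2\<close>)
qed

lemma sphere_measure_pos: "(LINT \<xi>|(sphere_measure :: (real ^ 'n) measure). 1) > (0 :: real)"
proof -
  have "(LINT \<xi>|(sphere_measure :: (real ^ 'n) measure). (1::real)) = real CARD('n) * measure lborel (ball 0 1 - {0 :: real ^ 'n})"
    by (subst sphere_integral_eq) auto
  also have "measure lborel (ball 0 1 - {0 :: real ^ 'n}) = measure lborel (ball 0 1 :: (real ^ 'n) set)"
    by (rule measure_Diff_null_set) auto
  finally show ?thesis using content_ball_pos[of 1 "0 :: real ^ 'n"] by simp
qed

section \<open>Invariance under orthogonal maps and moments of linear forms\<close>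

lemma orthogonal_transformation_measurable:
  fixes f :: "'a::euclidean_space \<Rightarrow> 'a"
  assumes "orthogonal_transformation f"
  shows "f \<in> borel_measurable borel"
  using orthogonal_transformation_linear[OF assms]
  by (intro borel_measurable_continuous_onI linear_continuous_on) (simp add: linear_conv_bounded_linear)

text \<open>Uniqueness of Haar measure: with the ball \<open>U\<close>, which \<open>f\<close> preserves, the double integral of
  \<open>indicator U (f x) * indicator B (y + f x)\<close> is \<open>vol U * vol B\<close>, and after the substitution
  \<open>f x \<mapsto> f x - y\<close> it is \<open>vol U * vol (f -` B)\<close>.\<close>
lemma lborel_distr_orthogonal:
  fixes f :: "'a::euclidean_space \<Rightarrow> 'a"
  assumes f: "orthogonal_transformation f"
  shows "distr lborel borel f = lborel"
proof (rule measure_eqI)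
  have lin: "linear f" using f by (rule orthogonal_transformation_linear)
  have m[measurable]: "f \<in> borel_measurable borel" using f by (rule orthogonal_transformation_measurable)
  have n: "norm (f x) = norm x" for x using f by (rule orthogonal_transformation_norm)
  have fi: "f (inv f y) = y" for y
    using orthogonal_transformation_surj[OF f] by (rule surj_f_inv_f)
  have shift: "(\<integral>\<^sup>+x. g (x + c) \<partial>lborel) = (\<integral>\<^sup>+x. g x \<partial>lborel)" if [measurable]: "g \<in> borel_measurable borel"
    for g :: "'a \<Rightarrow> ennreal" and c
  proof -
    have "(\<integral>\<^sup>+x. g x \<partial>lborel) = (\<integral>\<^sup>+x. g x \<partial>distr lborel borel ((+) c))" by (simp add: lborel_distr_plus)
    also have "\<dots> = (\<integral>\<^sup>+x. g (c + x) \<partial>lborel)" by (rule nn_integral_distr) auto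
    finally show ?thesis by (simp add: add.commute)
  qed
  fix B assume "B \<in> sets (distr lborel borel f)"
  then have B[measurable]: "B \<in> sets borel" by simp
  define U where "U = ball (0::'a) 1"
  have U[measurable]: "U \<in> sets borel" by (simp add: U_def)
  have Uf: "indicator U (f x) = (indicator U x :: ennreal)" for x
    by (simp add: U_def indicator_def n)
  have Um: "indicator U (x - y) = (indicator U (y - x) :: ennreal)" for x y
    by (simp add: U_def indicator_def norm_minus_commute)
  have "emeasure lborel U * emeasure lborel B = (\<integral>\<^sup>+x. indicator U (f x) * emeasure lborel B \<partial>lborel)"
    by (simp add: Uf nn_integral_multc)
  also have "\<dots> = (\<integral>\<^sup>+x. (\<integral>\<^sup>+y. indicator U (f x) * indicator B (y + f x) \<partial>lborel) \<partial>lborel)"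
  proof (rule nn_integral_cong)
    fix x
    have "(\<integral>\<^sup>+y. indicator U (f x) * indicator B (y + f x) \<partial>lborel) = indicator U (f x) * (\<integral>\<^sup>+y. indicator B (y + f x) \<partial>lborel)"
      by (rule nn_integral_cmult) measurable
    also have "(\<integral>\<^sup>+y. indicator B (y + f x) \<partial>lborel) = emeasure lborel B"
      by (subst shift) auto
    finally show "indicator U (f x) * emeasure lborel B = (\<integral>\<^sup>+y. indicator U (f x) * indicator B (y + f x) \<partial>lborel)" by (rule sym)
  qed
  also have "\<dots> = (\<integral>\<^sup>+y. (\<integral>\<^sup>+x. indicator U (f x) * indicator B (y + f x) \<partial>lborel) \<partial>lborel)"
    by (rule lborel_pair.Fubini'[symmetric]) measurable
  also have "\<dots> = (\<integral>\<^sup>+y. (\<integral>\<^sup>+x. indicator U (f x - y) * indicator B (f x) \<partial>lborel) \<partial>lborel)"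
  proof (rule nn_integral_cong)
    fix y
    have e: "f (x + inv f y) = f x + y" for x using lin by (simp add: linear_add fi)
    have "(\<integral>\<^sup>+x. indicator U (f x - y) * indicator B (f x) \<partial>lborel)
      = (\<integral>\<^sup>+x. indicator U (f (x + inv f y) - y) * indicator B (f (x + inv f y)) \<partial>lborel)"
      by (rule shift[symmetric]) measurable
    then show "(\<integral>\<^sup>+x. indicator U (f x) * indicator B (y + f x) \<partial>lborel) = (\<integral>\<^sup>+x. indicator U (f x - y) * indicator B (f x) \<partial>lborel)"
      by (simp add: e add.commute)
  qed
  also have "\<dots> = (\<integral>\<^sup>+x. (\<integral>\<^sup>+y. indicator U (f x - y) * indicator B (f x) \<partial>lborel) \<partial>lborel)"
    by (rule lborel_pair.Fubini') measurable
  also have "\<dots> = (\<integral>\<^sup>+x. emeasure lborel U * indicator B (f x) \<partial>lborel)"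
  proof (rule nn_integral_cong)
    fix x
    have "(\<integral>\<^sup>+y. indicator U (f x - y) * indicator B (f x) \<partial>lborel) = (\<integral>\<^sup>+y. indicator U (y + (- f x)) \<partial>lborel) * indicator B (f x)"
      by (subst nn_integral_multc) (auto simp: Um[of "f x"])
    also have "(\<integral>\<^sup>+y. indicator U (y + (- f x)) \<partial>lborel) = emeasure lborel U"
      by (subst shift) auto
    finally show "(\<integral>\<^sup>+y. indicator U (f x - y) * indicator B (f x) \<partial>lborel) = emeasure lborel U * indicator B (f x)" .
  qed
  also have "\<dots> = emeasure lborel U * (\<integral>\<^sup>+x. indicator B (f x) \<partial>lborel)"
    by (rule nn_integral_cmult) measurable
  also have "(\<integral>\<^sup>+x. indicator B (f x) \<partial>lborel) = emeasure (distr lborel borel f) B"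
    using nn_integral_distr[of f lborel borel "indicator B"] by simp
  finally have eq: "emeasure lborel U * emeasure lborel B = emeasure lborel U * emeasure (distr lborel borel f) B" .
  have "emeasure lborel U < \<infinity>" unfolding U_def using emeasure_lborel_ball_finite by (simp add: top.not_eq_extremum)
  moreover have "emeasure lborel U \<noteq> 0"
    unfolding U_def using content_ball_pos[of 1 "0::'a"] by (auto simp: measure_def)
  ultimately show "emeasure (distr lborel borel f) B = emeasure lborel B"
    using eq by (auto simp: ennreal_mult_cancel_left)
qed simp

text \<open>An orthogonal f commutes with \<open>sgn\<close> and preserves the punctured ball, so
  the invariance is inherited from Lebesgue measure through polar coordinates.\<close>

lemma sphere_integral_orthogonal:
  fixes f :: "real ^ 'n \<Rightarrow> real ^ 'n" and g :: "real ^ 'n \<Rightarrow> real"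
  assumes f: "orthogonal_transformation f" and g[measurable]: "g \<in> borel_measurable borel"
  shows "(LINT \<xi>|sphere_measure. g (f \<xi>)) = (LINT \<xi>|sphere_measure. g \<xi>)"
proof -
  have lin: "linear f" using f by (rule orthogonal_transformation_linear)
  have m[measurable]: "f \<in> borel_measurable borel" using f by (rule orthogonal_transformation_measurable)
  have [measurable]: "(sgn :: real ^ 'n \<Rightarrow> _) \<in> borel_measurable borel"
    unfolding sgn_div_norm[abs_def] by measurable
  have gs: "(\<lambda>x. indicator (ball 0 1 - {0}) x *\<^sub>R g (sgn x)) \<in> borel_measurable borel"
    by (intro borel_measurable_scaleR borel_measurable_indicator measurable_compose[OF _ g])
       (auto simp: sgn_div_norm[abs_def])
  have n: "norm (f x) = norm x" for x using f by (rule orthogonal_transformation_norm)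
  have s: "f (sgn x) = sgn (f x)" for x
    unfolding sgn_div_norm n using lin by (simp add: linear_cmul)
  have i: "indicator (ball 0 1 - {0}) x = (indicator (ball 0 1 - {0}) (f x) :: real)" for x
    using n[of x] by (auto simp: indicator_def)
  have "(LINT \<xi>|sphere_measure. g (f \<xi>)) = real CARD('n) * (LINT x|lborel. indicator (ball 0 1 - {0}) (f x) *\<^sub>R g (sgn (f x)))"
    by (subst sphere_integral_eq) (simp_all add: s flip: i)
  also have "(LINT x|lborel. indicator (ball 0 1 - {0}) (f x) *\<^sub>R g (sgn (f x))) = (LINT x|distr lborel borel f. indicator (ball 0 1 - {0}) x *\<^sub>R g (sgn x))"
    by (rule integral_distr[OF _ gs, symmetric]) (use m in simp)
  also have "\<dots> = (LINT x|lborel. indicator (ball 0 1 - {0}) x *\<^sub>R g (sgn x))"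
    unfolding lborel_distr_orthogonal[OF f] ..
  finally show ?thesis using g by (simp add: sphere_integral_eq)
qed

text \<open>Some orthogonal map carries u to c / norm c, so the moment depends on c only through its
  length.\<close>

lemma sphere_integral_power:
  fixes c u :: "real ^ 'n"
  assumes u: "norm u = 1"
  shows "(LINT \<xi>|sphere_measure. (c \<bullet> \<xi>) ^ k) = norm c ^ k * (LINT \<xi>|sphere_measure. (u \<bullet> \<xi>) ^ k)"
proof (cases "c = 0")
  case True
  then show ?thesis by (cases k) auto
next
  case False
  then obtain f where f: "orthogonal_transformation f" "f u = c /\<^sub>R norm c"
    using orthogonal_transformation_exists_1[of u "c /\<^sub>R norm c"] u by auto
  have "c = norm c *\<^sub>R f u" using f False by simp
  then have e: "c \<bullet> f \<xi> = norm c * (u \<bullet> \<xi>)" for \<xi>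
    using f(1) by (metis inner_scaleR_left orthogonal_transformation_def)
  have "(LINT \<xi>|sphere_measure. (c \<bullet> \<xi>) ^ k) = (LINT \<xi>|sphere_measure. (c \<bullet> f \<xi>) ^ k)"
    by (rule sphere_integral_orthogonal[OF f(1), symmetric]) simp
  then show ?thesis by (simp add: e power_mult_distrib)
qed

lemma sphere_integral_power_odd:
  fixes c :: "real ^ 'n"
  assumes "odd k"
  shows "(LINT \<xi>|sphere_measure. (c \<bullet> \<xi>) ^ k) = 0"
proof -
  have "orthogonal_transformation (uminus :: real ^ 'n \<Rightarrow> _)"
    by (simp add: orthogonal_transformation_def linear_uminus)
  then have "(LINT \<xi>|sphere_measure. (c \<bullet> (- \<xi>)) ^ k) = (LINT \<xi>|sphere_measure. (c \<bullet> \<xi>) ^ k)"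
    by (rule sphere_integral_orthogonal) simp
  then show ?thesis using assms by simp
qed

text \<open>Comparing the coefficients of \<open>\<tau>\<^sup>2\<close> in the moments of \<open>\<xi>\<^sub>a + \<tau> \<xi>\<^sub>i\<close> relates the
  \<open>2 m\<close>-th moment to the previous one, because \<open>\<Sum>\<^sub>i \<xi>\<^sub>i\<^sup>2 = 1\<close>.\<close>
lemma sphere_integral_power_Suc:
  fixes a :: "'n::finite"
  defines "s \<equiv> \<lambda>k. LINT \<xi>|sphere_measure. (\<xi> $ a) ^ k"
  shows "s (2 * Suc m) * (real CARD('n) / 2 + real m) = s (2 * m) * (1 / 2 + real m)"
proof -
  let ?k = "2 * Suc m"
  define M where "M = (\<lambda>i j. LINT \<xi>|sphere_measure. (\<xi> $ i) ^ j * ((\<xi> :: real ^ 'n) $ a) ^ (?k - j))"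
  have int: "integrable sphere_measure (\<lambda>\<xi>. (\<xi> $ i) ^ j * ((\<xi> :: real ^ 'n) $ b) ^ l)" for i j b l
    by (intro sphere_integrable continuous_intros)
  have off: "real (?k choose 2) * M i 2 = real (Suc m) * s ?k" if "i \<noteq> a" for i
  proof -
    have "(\<Sum>j\<le>?k. real (?k choose j) * M i j * \<tau> ^ j)
      = (\<Sum>j\<le>?k. (if even j then real (Suc m choose (j div 2)) * s ?k else 0) * \<tau> ^ j)" for \<tau>
    proof -
      let ?c = "axis a 1 + \<tau> *\<^sub>R axis i 1 :: real ^ 'n"
      have nc: "norm ?c ^ ?k = (1 + \<tau>\<^sup>2) ^ Suc m"
      proof -
        have "(norm ?c)\<^sup>2 = 1 + \<tau>\<^sup>2"
          unfolding power2_norm_eq_inner using that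
          by (simp add: inner_add_left inner_add_right inner_axis_axis power2_eq_square)
        then show ?thesis by (simp only: power_mult)
      qed
      have "(LINT \<xi>|sphere_measure. (?c \<bullet> \<xi>) ^ ?k) = norm ?c ^ ?k * (LINT \<xi>|sphere_measure. (axis a 1 \<bullet> \<xi>) ^ ?k)"
        by (rule sphere_integral_power) simp
      then have 1: "(LINT \<xi>|sphere_measure. (?c \<bullet> \<xi>) ^ ?k) = (1 + \<tau>\<^sup>2) ^ Suc m * s ?k"
        unfolding nc s_def by (simp add: inner_axis' )
      have "(?c \<bullet> \<xi>) ^ ?k = (\<Sum>j\<le>?k. real (?k choose j) * \<tau> ^ j * ((\<xi> $ i) ^ j * (\<xi> $ a) ^ (?k - j)))" for \<xi>
      proof -
        have "(?c \<bullet> \<xi>) ^ ?k = (\<tau> * \<xi> $ i + \<xi> $ a) ^ ?k"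
          by (simp add: inner_add_left inner_axis' add.commute)
        also have "\<dots> = (\<Sum>j\<le>?k. real (?k choose j) * (\<tau> * \<xi> $ i) ^ j * (\<xi> $ a) ^ (?k - j))"
          by (rule binomial_ring)
        finally show ?thesis by (simp add: power_mult_distrib mult.assoc)
      qed
      then have 2: "(LINT \<xi>|sphere_measure. (?c \<bullet> \<xi>) ^ ?k) = (\<Sum>j\<le>?k. real (?k choose j) * \<tau> ^ j * M i j)"
        unfolding M_def by (simp only: Bochner_Integration.integral_sum integrable_mult_right int integral_mult_right_zero)
      have "(1 + \<tau>\<^sup>2) ^ Suc m = (\<Sum>l\<le>Suc m. real (Suc m choose l) * \<tau> ^ (2 * l))"
        using binomial_ring[of "\<tau>\<^sup>2" 1 "Suc m"] by (simp add: power_mult add.commute)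
      also have "\<dots> = (\<Sum>j\<in>(\<lambda>l. 2 * l) ` {..Suc m}. real (Suc m choose (j div 2)) * \<tau> ^ j)"
        by (subst sum.reindex) (auto simp: inj_on_def)
      also have "\<dots> = (\<Sum>j\<in>(\<lambda>l. 2 * l) ` {..Suc m}. (if even j then real (Suc m choose (j div 2)) else 0) * \<tau> ^ j)"
        by (intro sum.cong) auto
      also have "\<dots> = (\<Sum>j\<le>?k. (if even j then real (Suc m choose (j div 2)) else 0) * \<tau> ^ j)"
        by (rule sum.mono_neutral_left) (auto elim!: evenE)
      finally have 3: "(1 + \<tau>\<^sup>2) ^ Suc m * s ?k = (\<Sum>j\<le>?k. (if even j then real (Suc m choose (j div 2)) * s ?k else 0) * \<tau> ^ j)"
        by (simp only: sum_distrib_right) (intro sum.cong refl, simp)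
      show ?thesis using 1 2 3 by (simp add: mult_ac)
    qed
    then have "\<forall>j\<le>?k. real (?k choose j) * M i j = (if even j then real (Suc m choose (j div 2)) * s ?k else 0)"
      by (subst polyfun_eq_coeffs[symmetric]) blast
    from this[rule_format, of 2] show ?thesis by simp
  qed
  have "s (2 * m) = (LINT \<xi>|sphere_measure. (\<Sum>i\<in>UNIV. (\<xi> $ i) ^ 2 * ((\<xi> :: real ^ 'n) $ a) ^ (2 * m)))"
    unfolding s_def
  proof (rule Bochner_Integration.integral_cong[OF refl])
    fix \<xi> :: "real ^ 'n" assume "\<xi> \<in> space sphere_measure"
    then have "norm \<xi> = 1" by (simp add: space_sphere_measure)
    then have "(\<Sum>i\<in>UNIV. (\<xi> $ i) ^ 2) = 1"
      by (simp add: norm_eq_1 inner_vec_def power2_eq_square)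
    then show "(\<xi> $ a) ^ (2 * m) = (\<Sum>i\<in>UNIV. (\<xi> $ i) ^ 2 * (\<xi> $ a) ^ (2 * m))"
      by (simp flip: sum_distrib_right)
  qed
  also have "\<dots> = (\<Sum>i\<in>UNIV. M i 2)" unfolding M_def using int by simp
  also have "\<dots> = M a 2 + (\<Sum>i\<in>UNIV - {a}. M i 2)" by (simp add: sum.remove[of _ a])
  also have "M a 2 = s ?k" unfolding M_def s_def by (simp flip: power_add)
  also have "(\<Sum>i\<in>UNIV - {a}. M i 2) = (\<Sum>i\<in>UNIV - {a}. s ?k / (2 * real m + 1))"
  proof (intro sum.cong refl)
    fix i assume "i \<in> UNIV - {a}"
    then have "real (?k choose 2) * M i 2 = real (Suc m) * s ?k" by (intro off) auto
    moreover have "real (?k choose 2) = real (Suc m) * (2 * real m + 1)"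
    proof -
      have "?k choose 2 = Suc m * (2 * m + 1)" by (simp add: choose_two)
      then have "real (?k choose 2) = real (Suc m * (2 * m + 1))" by (simp only:)
      then show ?thesis unfolding of_nat_mult by simp
    qed
    ultimately have "(2 * real m + 1) * M i 2 = s ?k" by simp
    then show "M i 2 = s ?k / (2 * real m + 1)" by (simp add: field_simps)
  qed
  also have "\<dots> = real (CARD('n) - 1) * (s ?k / (2 * real m + 1))" by simp
  also have "real (CARD('n) - 1) = real CARD('n) - 1"
    using zero_less_card_finite[where 'a='n] by (simp add: of_nat_diff Suc_le_eq)
  finally show ?thesis by (simp add: field_simps)
qed

lemma sphere_integral_power_even:
  fixes c :: "real ^ 'n"
  shows "(LINT \<xi>|sphere_measure. (c \<bullet> \<xi>) ^ (2 * m)) =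
    (LINT \<xi>|(sphere_measure :: (real ^ 'n) measure). 1) *
      (pochhammer (1 / 2) m / pochhammer (real CARD('n) / 2) m * (c \<bullet> c) ^ m)"
proof -
  obtain a :: 'n where True by simp
  define s where "s = (\<lambda>k. LINT \<xi>|sphere_measure. ((\<xi> :: real ^ 'n) $ a) ^ k)"
  have d: "real CARD('n) / 2 > 0" using zero_less_card_finite[where 'a='n] by simp
  have "s (2 * m) = s 0 * (pochhammer (1 / 2) m / pochhammer (real CARD('n) / 2) m)"
  proof (induction m)
    case (Suc m)
    have "pochhammer (real CARD('n) / 2) m > 0" using d by (rule pochhammer_pos)
    moreover have "real CARD('n) / 2 + real m > 0" using d by (intro add_pos_nonneg) auto
    moreover have "s (2 * Suc m) * (real CARD('n) / 2 + real m) = s (2 * m) * (1 / 2 + real m)"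
      unfolding s_def by (rule sphere_integral_power_Suc)
    ultimately have "s (2 * Suc m) = s (2 * m) * (1 / 2 + real m) / (real CARD('n) / 2 + real m)"
      by (simp add: nonzero_eq_divide_eq)
    then show ?case unfolding Suc by (simp add: pochhammer_Suc)
  qed simp
  moreover have "(LINT \<xi>|sphere_measure. (c \<bullet> \<xi>) ^ (2 * m)) = norm c ^ (2 * m) * s (2 * m)"
    using sphere_integral_power[of "axis a 1" c "2 * m"] by (simp add: s_def inner_axis')
  moreover have "norm c ^ (2 * m) = (c \<bullet> c) ^ m"
    by (simp add: power_mult power2_norm_eq_inner)
  ultimately show ?thesis by (simp add: s_def)
qed

section \<open>The mean over the cone\<close>

text \<open>Substituting u = t^2 on the positive half-line produces the Jacobian 2 |t|; half of it
  is F, and the other half is the mirror image on the negative half-line, since F is even off the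
  null set {0}. The change of variables is carried out for the completed measure, and Borel
  measurability of F brings it back to \<open>lborel\<close>. Both the Gaussian and the Gegenbauer
  moments are obtained this way.\<close>

lemma integral_square_substitution:
  fixes f F :: "real \<Rightarrow> real"
  assumes f1: "f absolutely_integrable_on {0<..}" and f2: "integral {0<..} f = v"
    and [measurable]: "F \<in> borel_measurable borel" and F: "\<And>t. t \<noteq> 0 \<Longrightarrow> F t = \<bar>t\<bar> * f (t\<^sup>2)"
  shows "has_bochner_integral lborel F v"
proof -
  define G where "G = (\<lambda>t. indicator {0<..} t * F t)"
  have im: "(\<lambda>t::real. t\<^sup>2) ` {0<..} = {0<..}"
  proof
    show "{0<..} \<subseteq> (\<lambda>t::real. t\<^sup>2) ` {0<..}"
    proof
      fix u :: real assume "u \<in> {0<..}"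
      then have "u = (sqrt u)\<^sup>2" "sqrt u \<in> {0<..}" by auto
      then show "u \<in> (\<lambda>t. t\<^sup>2) ` {0<..}" by blast
    qed
  qed auto
  have "(\<lambda>t. \<bar>2 * t\<bar> * f (t\<^sup>2)) absolutely_integrable_on {0<..} \<and>
        integral {0<..} (\<lambda>t. \<bar>2 * t\<bar> * f (t\<^sup>2)) = v"
  proof -
    have "(\<lambda>t. \<bar>2 * t\<bar> * f (t\<^sup>2)) absolutely_integrable_on {0<..} \<and>
        integral {0<..} (\<lambda>t. \<bar>2 * t\<bar> * f (t\<^sup>2)) = v \<longleftrightarrow>
      f absolutely_integrable_on (\<lambda>t::real. t\<^sup>2) ` {0<..} \<and> integral ((\<lambda>t. t\<^sup>2) ` {0<..}) f = v"
      by (rule has_absolute_integral_change_of_variables_1')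
         (auto intro!: derivative_eq_intros simp: inj_on_def power2_eq_iff)
    then show ?thesis unfolding im using f1 f2 by blast
  qed
  moreover have "\<bar>2 * t\<bar> * f (t\<^sup>2) = 2 * F t" if "t \<in> {0<..}" for t
    using that F[of t] by simp
  ultimately have "(\<lambda>t. 2 * F t) absolutely_integrable_on {0<..} \<and> integral {0<..} (\<lambda>t. 2 * F t) = v"
    using set_integrable_cong[of lebesgue lebesgue "{0<..}" "{0<..}" "\<lambda>t. \<bar>2 * t\<bar> * f (t\<^sup>2)" "\<lambda>t. 2 * F t"]
      integral_cong[of "{0<..}" "\<lambda>t. \<bar>2 * t\<bar> * f (t\<^sup>2)" "\<lambda>t. 2 * F t"] by simp
  then have i: "(\<lambda>t. 2 * F t) absolutely_integrable_on {0<..}" "integral {0<..} (\<lambda>t. 2 * F t) = v"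
    by auto
  have leb: "integrable lebesgue (\<lambda>t. 2 * G t)"
    using i(1) unfolding set_integrable_def G_def by (simp add: mult_ac)
  have Gm: "(\<lambda>t. 2 * G t) \<in> borel_measurable lborel" unfolding G_def by measurable
  have "integrable lborel (\<lambda>t. 2 * G t)"
    using leb unfolding integrable_completion[OF Gm] .
  then have Gi: "integrable lborel G" by simp
  have "(LINT t|lborel. 2 * G t) = integral {0<..} (\<lambda>t. 2 * F t)"
    using set_lebesgue_integral_eq_integral(2)[OF i(1)] Gm
    unfolding set_lebesgue_integral_def by (subst integral_completion[OF Gm, symmetric]) (simp add: G_def mult_ac)
  then have Gv: "has_bochner_integral lborel G (v / 2)" using i(2) Gi by (simp add: has_bochner_integral_iff)
  then have "has_bochner_integral lborel (\<lambda>t. G (0 + (-1) * t)) (v / 2)"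
    using lborel_has_bochner_integral_real_affine_iff[of "-1" G "v / 2" 0] by simp
  from has_bochner_integral_add[OF Gv this]
  have sum: "has_bochner_integral lborel (\<lambda>t. G t + G (0 + (-1) * t)) v" by simp
  have "AE t in lborel. G t + G (0 + (-1) * t) = F t"
    using AE_lborel_singleton[of "0::real"]
  proof eventually_elim
    case (elim t)
    then show ?case using F[of t] F[of "- t"] by (auto simp: G_def indicator_def)
  qed
  moreover have "(\<lambda>t. G t + G (0 + (-1) * t)) \<in> borel_measurable lborel" unfolding G_def by measurable
  ultimately show ?thesis
    using sum has_bochner_integral_cong_AE[of "\<lambda>t. G t + G (0 + (-1) * t)" lborel F v] by simp
qed

lemma abs_powr_gaussian:
  fixes a :: real
  assumes a: "a > 0"
  shows "has_bochner_integral lborel (\<lambda>t. \<bar>t\<bar> powr (2 * a - 1) * exp (- t\<^sup>2)) (Gamma a)"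
proof (rule integral_square_substitution)
  define f where "f = (\<lambda>u::real. u powr (a - 1) / exp u)"
  have "f absolutely_integrable_on {0..}"
    by (rule nonnegative_absolutely_integrable_1)
       (use Gamma_integral_real[OF a] in \<open>auto simp: f_def integrable_on_def\<close>)
  then show "f absolutely_integrable_on {0<..}"
    by (rule set_integrable_subset) auto
  have "(f has_integral Gamma a) {0<..}"
  proof (subst has_integral_spike_set_eq[where T="{0..}"])
    show "negligible {x \<in> {0<..} - {0..}. f x \<noteq> 0}" by (rule negligible_subset[of "{}"]) auto
    show "negligible {x \<in> {0..} - {0<..}. f x \<noteq> 0}" by (rule negligible_subset[of "{0}"]) auto
    show "(f has_integral Gamma a) {0..}" using Gamma_integral_real[OF a] unfolding f_def .
  qed
  then show "integral {0<..} f = Gamma a" by (rule integral_unique)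
  fix t :: real assume t: "t \<noteq> 0"
  have "(t\<^sup>2) powr (a - 1) = \<bar>t\<bar> powr (2 * (a - 1))"
    using t powr_powr[of "\<bar>t\<bar>" 2 "a - 1"] by simp
  then have "\<bar>t\<bar> powr (2 * a - 1) = \<bar>t\<bar> * (t\<^sup>2) powr (a - 1)"
    using t powr_mult_base[of "\<bar>t\<bar>" "2 * (a - 1)"] by (simp add: algebra_simps)
  then show "\<bar>t\<bar> powr (2 * a - 1) * exp (- t\<^sup>2) = \<bar>t\<bar> * f (t\<^sup>2)"
    by (simp add: f_def exp_minus field_simps)
qed measurable

lemma cone_weight_power:
  fixes m :: nat and \<beta> :: real
  assumes \<beta>: "\<beta> \<ge> 0"
  defines "a \<equiv> \<beta> + real CARD('n::finite) / 2 + real m / 2"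
  shows "integrable lborel (\<lambda>t. \<bar>t\<bar> ^ (CARD('n) - 1) * \<bar>t\<bar> ^ m * cone_weight \<beta> t)"
    and "(LINT t|lborel. \<bar>t\<bar> ^ (CARD('n) - 1) * \<bar>t\<bar> ^ m * cone_weight \<beta> t) = Gamma a"
proof -
  have d: "CARD('n) \<ge> 1" by (simp add: Suc_le_eq)
  then have "real CARD('n) \<ge> 1" by simp
  then have a: "a > 0" unfolding a_def using \<beta> by (smt (verit) divide_nonneg_nonneg of_nat_0_le_iff divide_pos_pos)
  let ?F = "\<lambda>t. \<bar>t\<bar> powr (2 * a - 1) * exp (- t\<^sup>2)"
  let ?G = "\<lambda>t. \<bar>t\<bar> ^ (CARD('n) - 1) * \<bar>t\<bar> ^ m * cone_weight \<beta> t"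
  have eq: "?G t = ?F t" if "t \<noteq> 0" for t
  proof -
    have "2 * a - 1 = real (CARD('n) - 1) + real m + 2 * \<beta>"
      using d by (simp add: a_def of_nat_diff algebra_simps)
    then have "\<bar>t\<bar> powr (2 * a - 1) = \<bar>t\<bar> ^ (CARD('n) - 1) * \<bar>t\<bar> ^ m * \<bar>t\<bar> powr (2 * \<beta>)"
      using powr_realpow[of "\<bar>t\<bar>"] that by (simp only: powr_add zero_less_abs_iff not_False_eq_True simp_thms)
    then show ?thesis by (simp add: cone_weight_def)
  qed
  have AE: "AE t in lborel. ?F t = ?G t"
    using AE_lborel_singleton[of "0::real"] by eventually_elim (rule eq[symmetric])
  have G: "?G \<in> borel_measurable lborel" unfolding cone_weight_def by measurable
  have F: "?F \<in> borel_measurable lborel" by measurable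
  show "integrable lborel ?G"
    using abs_powr_gaussian[OF a] integrable_cong_AE[OF F G AE] by (simp add: has_bochner_integral_iff)
  show "integral\<^sup>L lborel ?G = Gamma a"
    using abs_powr_gaussian[OF a] integral_cong_AE[OF F G AE] by (simp add: has_bochner_integral_iff)
qed

section \<open>Integrability of polynomials over the cone\<close>

lemma real_polynomial_function_bound:
  fixes h :: "'a::real_normed_vector \<Rightarrow> real"
  assumes "real_polynomial_function h"
  shows "\<exists>C N. C \<ge> 0 \<and> (\<forall>p. \<bar>h p\<bar> \<le> C * (1 + norm p) ^ N)"
  using assms
proof induction
  case (linear f)
  then obtain K where K: "\<And>x. norm (f x) \<le> norm x * K" "K \<ge> 0"
    using bounded_linear.nonneg_bounded by blast
  have "\<bar>f p\<bar> \<le> K * (1 + norm p) ^ 1" for p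
    using K(1)[of p] K(2) by (simp add: algebra_simps)
  then show ?case using K(2) by blast
next
  case (const c)
  have "\<bar>c\<bar> \<le> \<bar>c\<bar> * (1 + norm p) ^ 0" for p :: 'a by simp
  then show ?case using abs_ge_zero by blast
next
  case (add f g)
  then obtain C N C' N' where *: "C \<ge> 0" "C' \<ge> 0" "\<And>p. \<bar>f p\<bar> \<le> C * (1 + norm p) ^ N" "\<And>p. \<bar>g p\<bar> \<le> C' * (1 + norm p) ^ N'"
    by blast
  have "\<bar>f p + g p\<bar> \<le> (C + C') * (1 + norm p) ^ (N + N')" for p
  proof -
    have "(1 + norm p) ^ N \<le> (1 + norm p) ^ (N + N')" "(1 + norm p) ^ N' \<le> (1 + norm p) ^ (N + N')"
      by (auto intro!: power_increasing)
    then have "C * (1 + norm p) ^ N + C' * (1 + norm p) ^ N' \<le> C * (1 + norm p) ^ (N + N') + C' * (1 + norm p) ^ (N + N')"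
      using * by (intro add_mono mult_left_mono) auto
    then show ?thesis using *(3)[of p] *(4)[of p] by (simp add: distrib_right)
  qed
  moreover have "C + C' \<ge> 0" using * by simp
  ultimately show ?case by blast
next
  case (mult f g)
  then obtain C N C' N' where *: "C \<ge> 0" "C' \<ge> 0" "\<And>p. \<bar>f p\<bar> \<le> C * (1 + norm p) ^ N" "\<And>p. \<bar>g p\<bar> \<le> C' * (1 + norm p) ^ N'"
    by blast
  have "\<bar>f p * g p\<bar> \<le> (C * C') * (1 + norm p) ^ (N + N')" for p
  proof -
    have "\<bar>f p\<bar> * \<bar>g p\<bar> \<le> (C * (1 + norm p) ^ N) * (C' * (1 + norm p) ^ N')"
      using * by (intro mult_mono) auto
    then show ?thesis by (simp add: abs_mult power_add mult_ac)
  qed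
  moreover have "C * C' \<ge> 0" using * by simp
  ultimately show ?case by blast
qed

lemma continuous_real_polynomial_function:
  assumes "real_polynomial_function h"
  shows "continuous_on A h"
  using assms
  by induction (auto intro: linear_continuous_on continuous_on_add continuous_on_mult)

lemma real_polynomial_function_cone_section:
  fixes h :: "(real ^ 'n) \<times> real \<Rightarrow> real"
  assumes h: "real_polynomial_function h"
  shows "integrable sphere_measure (\<lambda>\<xi>. h (\<bar>t\<bar> *\<^sub>R \<xi>, t))"
  by (intro sphere_integrable continuous_on_compose2[OF continuous_real_polynomial_function[OF h, of UNIV]] continuous_intros) auto

text \<open>Points of the cone at height t have norm at most 2 |t|, so polynomial growth bounds the
  inner integral by a multiple of (1 + 2 |t|)^N. The binomial theorem makes this bound a combination
  of the radial moments in \<open>cone_weight_power\<close>.\<close>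

lemma real_polynomial_function_cone_integrable:
  fixes h :: "(real ^ 'n) \<times> real \<Rightarrow> real"
  assumes h: "real_polynomial_function h" and \<beta>: "\<beta> \<ge> 0"
  shows "integrable lborel (\<lambda>t. \<bar>t\<bar> ^ (CARD('n) - 1) *
        (LINT \<xi>|sphere_measure. h (\<bar>t\<bar> *\<^sub>R \<xi>, t)) * cone_weight \<beta> t)"
proof -
  interpret S: finite_measure "sphere_measure :: (real ^ 'n) measure" by (rule finite_measure_sphere_measure)
  obtain C N where C: "C \<ge> 0" "\<And>p. \<bar>h p\<bar> \<le> C * (1 + norm p) ^ N"
    using real_polynomial_function_bound[OF h] by blast
  define V where "V = measure (sphere_measure :: (real ^ 'n) measure) (space sphere_measure)"
  define J where "J = (\<lambda>t. LINT \<xi>|(sphere_measure :: (real ^ 'n) measure). h (\<bar>t\<bar> *\<^sub>R \<xi>, t))"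
  define D where "D = (\<lambda>t. \<Sum>j\<le>N. C * V * real (N choose j) * 2 ^ j * (\<bar>t\<bar> ^ (CARD('n) - 1) * \<bar>t\<bar> ^ j * cone_weight \<beta> t))"
  have V: "V \<ge> 0" by (simp add: V_def)
  have hm: "h \<in> borel_measurable borel"
    by (rule borel_measurable_continuous_onI[OF continuous_real_polynomial_function[OF h]])
  have "(\<lambda>\<xi>. \<xi>) \<in> borel_measurable (sphere_measure :: (real ^ 'n) measure)"
    by (rule measurable_sphere_measure) simp
  then have [measurable]: "snd \<in> borel_measurable (borel \<Otimes>\<^sub>M (sphere_measure :: (real ^ 'n) measure))"
    by (rule measurable_compose[OF measurable_snd])
  have "(\<lambda>z. (\<bar>fst z\<bar> *\<^sub>R snd z, fst z)) \<in> borel_measurable (borel \<Otimes>\<^sub>M (sphere_measure :: (real ^ 'n) measure))"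
    by (simp add: borel_prod[symmetric]) measurable
  then have "(\<lambda>z. h (\<bar>fst z\<bar> *\<^sub>R snd z, fst z)) \<in> borel_measurable (borel \<Otimes>\<^sub>M (sphere_measure :: (real ^ 'n) measure))"
    using hm by (rule measurable_compose)
  then have [measurable]: "J \<in> borel_measurable borel"
    unfolding J_def by (intro S.borel_measurable_lebesgue_integral) (simp add: case_prod_beta)
  have Jb: "\<bar>J t\<bar> \<le> C * V * (1 + 2 * \<bar>t\<bar>) ^ N" for t
  proof -
    have "\<bar>J t\<bar> \<le> (LINT \<xi>|(sphere_measure :: (real ^ 'n) measure). \<bar>h (\<bar>t\<bar> *\<^sub>R \<xi>, t)\<bar>)"
      unfolding J_def by (rule integral_abs_bound)
    also have "\<dots> \<le> (LINT \<xi>|(sphere_measure :: (real ^ 'n) measure). C * (1 + 2 * \<bar>t\<bar>) ^ N)"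
    proof (rule integral_mono)
      show "integrable sphere_measure (\<lambda>\<xi>. \<bar>h (\<bar>t\<bar> *\<^sub>R \<xi>, t)\<bar>)"
        using real_polynomial_function_cone_section[OF h] by (rule integrable_abs)
      fix \<xi> :: "real ^ 'n" assume "\<xi> \<in> space sphere_measure"
      then have "norm \<xi> = 1" by (simp add: space_sphere_measure)
      then have "norm (\<bar>t\<bar> *\<^sub>R \<xi>, t) \<le> 2 * \<bar>t\<bar>"
        using norm_Pair_le[of "\<bar>t\<bar> *\<^sub>R \<xi>" t] by simp
      then have "C * (1 + norm (\<bar>t\<bar> *\<^sub>R \<xi>, t)) ^ N \<le> C * (1 + 2 * \<bar>t\<bar>) ^ N"
        using C(1) by (intro mult_left_mono power_mono) auto
      then show "\<bar>h (\<bar>t\<bar> *\<^sub>R \<xi>, t)\<bar> \<le> C * (1 + 2 * \<bar>t\<bar>) ^ N"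
        using C(2)[of "(\<bar>t\<bar> *\<^sub>R \<xi>, t)"] by linarith
    qed simp
    also have "\<dots> = C * V * (1 + 2 * \<bar>t\<bar>) ^ N" by (simp add: V_def mult_ac)
    finally show ?thesis .
  qed
  have Di: "integrable lborel D"
    unfolding D_def by (intro Bochner_Integration.integrable_sum integrable_mult_right cone_weight_power(1)[OF \<beta>])
  have w: "cone_weight \<beta> t \<ge> 0" for t by (simp add: cone_weight_def)
  have "norm (\<bar>t\<bar> ^ (CARD('n) - 1) * J t * cone_weight \<beta> t) \<le> norm (D t)" for t
  proof -
    have "(1 + 2 * \<bar>t\<bar>) ^ N = (\<Sum>j\<le>N. real (N choose j) * (2 * \<bar>t\<bar>) ^ j)"
      using binomial_ring[of "2 * \<bar>t\<bar>" 1 N] by (simp add: add.commute)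
    then have D: "D t = \<bar>t\<bar> ^ (CARD('n) - 1) * (C * V * (1 + 2 * \<bar>t\<bar>) ^ N) * cone_weight \<beta> t"
      unfolding D_def by (simp add: sum_distrib_left sum_distrib_right power_mult_distrib mult_ac)
    have "norm (\<bar>t\<bar> ^ (CARD('n) - 1) * J t * cone_weight \<beta> t) = \<bar>t\<bar> ^ (CARD('n) - 1) * \<bar>J t\<bar> * cone_weight \<beta> t"
      using w[of t] by (simp add: abs_mult power_abs)
    also have "\<dots> \<le> D t" unfolding D
      using w[of t] Jb[of t] by (intro mult_right_mono mult_left_mono) auto
    finally show ?thesis by simp
  qed
  then have "integrable lborel (\<lambda>t. \<bar>t\<bar> ^ (CARD('n) - 1) * J t * cone_weight \<beta> t)"
    by (intro Bochner_Integration.integrable_bound[OF Di]) (auto simp: cone_weight_def)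
  then show ?thesis unfolding J_def .
qed

section \<open>The normalized integral as a linear functional\<close>

definition cone_mean :: "real \<Rightarrow> ((real ^ 'n) \<times> real \<Rightarrow> real) \<Rightarrow> real" where
  "cone_mean \<beta> h = cone_normalization TYPE('n) \<beta> * cone_integral \<beta> h"

lemma cone_inner_eq_cone_mean: "cone_inner \<beta> f g = cone_mean \<beta> (\<lambda>p. f p * g p)"
  by (simp add: cone_inner_def cone_mean_def)

lemma cone_integral_cong:
  fixes h h' :: "(real ^ 'n) \<times> real \<Rightarrow> real"
  assumes "\<And>p. p \<in> double_cone \<Longrightarrow> h p = h' p"
  shows "cone_integral \<beta> h = cone_integral \<beta> h'"
proof -
  have "(LINT \<xi>|sphere_measure. h (\<bar>t\<bar> *\<^sub>R \<xi>, t)) = (LINT \<xi>|sphere_measure. h' (\<bar>t\<bar> *\<^sub>R \<xi>, t))" for t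
    by (rule Bochner_Integration.integral_cong[OF refl])
       (auto intro!: assms simp: space_sphere_measure double_cone_def)
  then show ?thesis unfolding cone_integral_def by simp
qed

lemma cone_mean_cong:
  fixes h h' :: "(real ^ 'n) \<times> real \<Rightarrow> real"
  assumes "\<And>p. p \<in> double_cone \<Longrightarrow> h p = h' p"
  shows "cone_mean \<beta> h = cone_mean \<beta> h'"
  unfolding cone_mean_def using cone_integral_cong[of h h' \<beta>, OF assms] by simp

lemma cone_mean_add:
  fixes h h' :: "(real ^ 'n) \<times> real \<Rightarrow> real"
  assumes h: "real_polynomial_function h" and h': "real_polynomial_function h'" and \<beta>: "\<beta> \<ge> 0"
  shows "cone_mean \<beta> (\<lambda>p. h p + h' p) = cone_mean \<beta> h + cone_mean \<beta> h'"
proof -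
  have "cone_integral \<beta> (\<lambda>p. h p + h' p) = cone_integral \<beta> h + cone_integral \<beta> h'"
    unfolding cone_integral_def
    using real_polynomial_function_cone_section[OF h] real_polynomial_function_cone_section[OF h']
      real_polynomial_function_cone_integrable[OF h \<beta>] real_polynomial_function_cone_integrable[OF h' \<beta>]
    by (simp add: distrib_left distrib_right)
  then show ?thesis by (simp add: cone_mean_def distrib_left)
qed

lemma cone_mean_cmult:
  fixes h :: "(real ^ 'n) \<times> real \<Rightarrow> real"
  shows "cone_mean \<beta> (\<lambda>p. c * h p) = c * cone_mean \<beta> h"
proof -
  have "cone_integral \<beta> (\<lambda>p. c * h p) = (LINT t|lborel. c * (\<bar>t\<bar> ^ (CARD('n) - 1) *
        (LINT \<xi>|sphere_measure. h (\<bar>t\<bar> *\<^sub>R \<xi>, t)) * cone_weight \<beta> t))"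
    unfolding cone_integral_def by (simp add: mult_ac)
  also have "\<dots> = c * cone_integral \<beta> h"
    unfolding cone_integral_def by simp
  finally show ?thesis by (simp add: cone_mean_def)
qed

lemma cone_mean_sum:
  fixes h :: "'i \<Rightarrow> (real ^ 'n) \<times> real \<Rightarrow> real"
  assumes "\<And>i. i \<in> A \<Longrightarrow> real_polynomial_function (h i)" and \<beta>: "\<beta> \<ge> 0"
  shows "cone_mean \<beta> (\<lambda>p. \<Sum>i\<in>A. h i p) = (\<Sum>i\<in>A. cone_mean \<beta> (h i))"
  using assms(1)
proof (induction A rule: infinite_finite_induct)
  case (insert i A)
  have "real_polynomial_function (\<lambda>p. \<Sum>i\<in>A. h i p)"
    using insert by (intro real_polynomial_function_sum) auto
  then show ?case using insert cone_mean_add[of "h i" "\<lambda>p. \<Sum>i\<in>A. h i p" \<beta>] \<beta> by auto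
qed (simp_all add: cone_mean_def cone_integral_def)

text \<open>Reflection of t. Because the kernels do not depend on t, this disposes of the odd part
  of a test polynomial.\<close>

lemma cone_mean_odd:
  fixes h :: "(real ^ 'n) \<times> real \<Rightarrow> real"
  assumes "\<And>x t. h (x, - t) = - h (x, t)"
  shows "cone_mean \<beta> h = 0"
proof -
  have "cone_integral \<beta> h = - cone_integral \<beta> h"
  proof -
    have "cone_integral \<beta> h = (LINT t|lborel. \<bar>0 + (-1) * t\<bar> ^ (CARD('n) - 1) *
        (LINT \<xi>|sphere_measure. h (\<bar>0 + (-1) * t\<bar> *\<^sub>R \<xi>, 0 + (-1) * t)) * cone_weight \<beta> (0 + (-1) * t))"
      unfolding cone_integral_def by (subst lborel_integral_real_affine[of "-1" _ 0]) auto
    also have "\<dots> = - cone_integral \<beta> h"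
      unfolding cone_integral_def by (simp add: assms cone_weight_def)
    finally show ?thesis .
  qed
  then show ?thesis by (simp add: cone_mean_def)
qed

text \<open>The integrand at height t is |t|^(2q + k) times a power of a linear form on the sphere,
  so the integral splits into a Gamma value and a sphere moment. The normalization is the case q = k
  = 0, and the quotient of Gamma values is the rising factorial.\<close>

lemma cone_mean_radial:
  fixes c :: "real ^ 'n"
  assumes \<beta>: "\<beta> \<ge> 0"
  defines "\<delta> \<equiv> real CARD('n) / 2"
  shows "cone_mean \<beta> (\<lambda>p. (fst p \<bullet> fst p) ^ q * (c \<bullet> fst p) ^ k) =
    (if even k then pochhammer (\<beta> + \<delta>) (q + k div 2) * pochhammer (1 / 2) (k div 2) / pochhammer \<delta> (k div 2) * (c \<bullet> c) ^ (k div 2) else 0)"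
proof -
  have \<delta>: "\<delta> > 0" by (simp add: \<delta>_def)
  define \<sigma> where "\<sigma> = (LINT \<xi>|(sphere_measure :: (real ^ 'n) measure). (1::real))"
  have \<sigma>: "\<sigma> > 0" unfolding \<sigma>_def by (rule sphere_measure_pos)
  have *: "cone_integral \<beta> (\<lambda>p. (fst p \<bullet> fst p) ^ q * (c \<bullet> fst p) ^ k) =
    Gamma (\<beta> + \<delta> + real (2 * q + k) / 2) * (LINT \<xi>|sphere_measure. (c \<bullet> \<xi>) ^ k)" for c :: "real ^ 'n" and q k
  proof -
    have "(LINT \<xi>|sphere_measure. ((\<bar>t\<bar> *\<^sub>R \<xi>) \<bullet> (\<bar>t\<bar> *\<^sub>R \<xi>)) ^ q * (c \<bullet> (\<bar>t\<bar> *\<^sub>R \<xi>)) ^ k)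
       = \<bar>t\<bar> ^ (2 * q + k) * (LINT \<xi>|sphere_measure. (c \<bullet> \<xi>) ^ k)" for t
    proof -
      have "(LINT \<xi>|sphere_measure. ((\<bar>t\<bar> *\<^sub>R \<xi>) \<bullet> (\<bar>t\<bar> *\<^sub>R \<xi>)) ^ q * (c \<bullet> (\<bar>t\<bar> *\<^sub>R \<xi>)) ^ k)
        = (LINT \<xi>|sphere_measure. \<bar>t\<bar> ^ (2 * q + k) * (c \<bullet> \<xi>) ^ k)"
      proof (rule Bochner_Integration.integral_cong[OF refl])
        fix \<xi> :: "real ^ 'n" assume "\<xi> \<in> space sphere_measure"
        then have "\<xi> \<bullet> \<xi> = 1" by (simp add: space_sphere_measure norm_eq_1)
        then have "((\<bar>t\<bar> *\<^sub>R \<xi>) \<bullet> (\<bar>t\<bar> *\<^sub>R \<xi>)) ^ q = \<bar>t\<bar> ^ (2 * q)"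
          by (simp add: power_mult power2_eq_square)
        then show "((\<bar>t\<bar> *\<^sub>R \<xi>) \<bullet> (\<bar>t\<bar> *\<^sub>R \<xi>)) ^ q * (c \<bullet> (\<bar>t\<bar> *\<^sub>R \<xi>)) ^ k = \<bar>t\<bar> ^ (2 * q + k) * (c \<bullet> \<xi>) ^ k"
          by (simp add: power_add power_mult_distrib)
      qed
      then show ?thesis by simp
    qed
    then have "cone_integral \<beta> (\<lambda>p. (fst p \<bullet> fst p) ^ q * (c \<bullet> fst p) ^ k) =
       (LINT t|lborel. (LINT \<xi>|sphere_measure. (c \<bullet> \<xi>) ^ k) * (\<bar>t\<bar> ^ (CARD('n) - 1) * \<bar>t\<bar> ^ (2 * q + k) * cone_weight \<beta> t))"
      unfolding cone_integral_def by (simp only: fst_conv mult_ac)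
    also have "\<dots> = (LINT \<xi>|sphere_measure. (c \<bullet> \<xi>) ^ k) * Gamma (\<beta> + \<delta> + real (2 * q + k) / 2)"
      unfolding \<delta>_def cone_weight_power(2)[OF \<beta>, where 'n='n, symmetric] by simp
    finally show ?thesis by simp
  qed
  have G: "Gamma (\<beta> + \<delta>) > 0" using \<beta> \<delta> by (intro Gamma_real_pos) auto
  have N: "cone_normalization TYPE('n) \<beta> = 1 / (Gamma (\<beta> + \<delta>) * \<sigma>)"
    using *[of 0 0 0] by (simp add: cone_normalization_def \<sigma>_def)
  show ?thesis
  proof (cases "even k")
    case False
    then show ?thesis unfolding cone_mean_def * by (simp add: sphere_integral_power_odd)
  next
    case True
    then obtain m where k: "k = 2 * m" by (elim evenE)
    have "\<beta> + \<delta> \<notin> \<int>\<^sub>\<le>\<^sub>0" using \<beta> \<delta> by (auto elim!: nonpos_Ints_cases)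
    then have "Gamma (\<beta> + \<delta> + real (q + m)) = pochhammer (\<beta> + \<delta>) (q + m) * Gamma (\<beta> + \<delta>)"
      using G by (simp add: pochhammer_Gamma)
    moreover have e: "real (2 * q + 2 * m) / 2 = real (q + m)" by simp
    ultimately show ?thesis
      unfolding cone_mean_def * N k e sphere_integral_power_even \<sigma>_def[symmetric] \<delta>_def[symmetric]
      using G \<sigma> by (simp add: k)
  qed
qed

section \<open>Orthogonality of the zonal kernels\<close>

lemma real_polynomial_function_inner_fst:
  fixes a :: "real ^ 'n"
  shows "real_polynomial_function (\<lambda>p :: (real ^ 'n) \<times> real. a \<bullet> fst p)"
  by (rule real_polynomial_function.intros(1))
     (rule bounded_linear_compose[OF bounded_linear_inner_right bounded_linear_fst])

lemma norm_fst_eq_sum: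
  fixes p :: "(real ^ 'n) \<times> real"
  shows "fst p \<bullet> fst p = (\<Sum>i\<in>UNIV. (axis i 1 \<bullet> fst p) * (axis i 1 \<bullet> fst p))"
  by (simp add: inner_axis') (simp add: inner_vec_def)

lemma real_polynomial_function_norm_fst:
  "real_polynomial_function (\<lambda>p :: (real ^ 'n) \<times> real. fst p \<bullet> fst p)"
proof -
  have "real_polynomial_function (\<lambda>p :: (real ^ 'n) \<times> real. \<Sum>i\<in>UNIV. (axis i 1 \<bullet> fst p) * (axis i 1 \<bullet> fst p))"
    by (intro real_polynomial_function_sum real_polynomial_function.intros(4) real_polynomial_function_inner_fst) auto
  then show ?thesis by (simp only: norm_fst_eq_sum)
qed

lemma real_polynomial_function_zonal:
  fixes a :: "real ^ 'n"
  shows "real_polynomial_function (\<lambda>p :: (real ^ 'n) \<times> real. zonal \<delta> k (c * (fst p \<bullet> fst p)) (a \<bullet> fst p))"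
proof (induction k rule: less_induct)
  case (less k)
  have "real_polynomial_function (\<lambda>p :: (real ^ 'n) \<times> real. pochhammer \<delta> k * (2 ^ k / fact k * (a \<bullet> fst p) ^ k -
     (\<Sum>i\<in>{1..k div 2}. (c ^ i / (fact i * pochhammer \<delta> (k - i)) * (fst p \<bullet> fst p) ^ i) * zonal \<delta> (k - 2 * i) (c * (fst p \<bullet> fst p)) (a \<bullet> fst p))))"
    by (intro real_polynomial_function.intros(4) real_polynomial_function_diff real_polynomial_function.intros(2)
        real_polynomial_function_sum real_polynomial_function_power
        real_polynomial_function_inner_fst real_polynomial_function_norm_fst less) auto
  then show ?case by (subst zonal.simps) (simp add: power_mult_distrib)
qed

lemma real_polynomial_function_lag:
  "real_polynomial_function (\<lambda>p :: (real ^ 'n) \<times> real. lag \<mu> i (fst p \<bullet> fst p))"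
  unfolding lag_def
  by (intro real_polynomial_function_sum real_polynomial_function_divide real_polynomial_function.intros(4) real_polynomial_function.intros(2)
      real_polynomial_function_power real_polynomial_function_norm_fst) auto

lemmas real_polynomial_function_cone_intros =
  real_polynomial_function.intros(4) real_polynomial_function.intros(2) real_polynomial_function_sum
  real_polynomial_function_power real_polynomial_function_divide
  real_polynomial_function_inner_fst real_polynomial_function_norm_fst
  real_polynomial_function_zonal real_polynomial_function_lag

abbreviation zonal_fst :: "real \<Rightarrow> nat \<Rightarrow> real ^ 'n \<Rightarrow> (real ^ 'n) \<times> real \<Rightarrow> real" where
  "zonal_fst \<delta> k a p \<equiv> zonal \<delta> k ((a \<bullet> a) * (fst p \<bullet> fst p)) (a \<bullet> fst p)"

text \<open>The exponents of \<open>a \<bullet> a\<close>, \<open>b \<bullet> b\<close> and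
  \<open>a \<bullet> b\<close> in a term of degree k in a and degree l in b. In the zonal version of
  the sum the third component is the zonal degree.\<close>

definition power_pairs :: "nat \<Rightarrow> nat \<Rightarrow> (nat \<times> nat \<times> nat) set" where
  "power_pairs k l = {(i, i', n). 2 * i + n = k \<and> 2 * i' + n = l}"

lemma finite_power_pairs: "finite (power_pairs k l)"
  by (rule finite_subset[of _ "{..k} \<times> {..l} \<times> {..k}"]) (auto simp: power_pairs_def)

lemma trinomial:
  fixes x y z :: real
  shows "(x + y + z) ^ m / fact m = (\<Sum>(i,i')\<in>(SIGMA i:{..m}. {..m - i}). x ^ i * y ^ i' * z ^ (m - i - i') / (fact i * fact i' * fact (m - i - i')))"
proof -
  have b: "(u + v) ^ k / fact k = (\<Sum>i\<le>k. u ^ i / fact i * (v ^ (k - i) / fact (k - i)))" for u v :: real and k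
    unfolding binomial_ring sum_divide_distrib by (intro sum.cong refl) (simp add: binomial_fact field_simps)
  have "(x + y + z) ^ m / fact m = (\<Sum>i\<le>m. \<Sum>i'\<le>m - i. x ^ i / fact i * (y ^ i' / fact i' * (z ^ (m - i - i') / fact (m - i - i'))))"
    unfolding add.assoc b[of x] b[of y] sum_distrib_left ..
  also have "\<dots> = (\<Sum>(i,i')\<in>(SIGMA i:{..m}. {..m - i}). x ^ i / fact i * (y ^ i' / fact i' * (z ^ (m - i - i') / fact (m - i - i'))))"
    by (rule sum.Sigma) auto
  finally show ?thesis by (simp add: mult_ac case_prod_beta)
qed

text \<open>Read off the coefficient of \<open>\<tau> ^ k\<close> in the moments of \<open>(\<tau> a + b) \<bullet> x\<close>.\<close>
lemma cone_mean_power_power: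
  fixes a b :: "real ^ 'n"
  assumes \<beta>: "\<beta> \<ge> 0"
  defines "\<delta> \<equiv> real CARD('n) / 2"
  shows "cone_mean \<beta> (\<lambda>p. (fst p \<bullet> fst p) ^ q * (2 ^ k * (a \<bullet> fst p) ^ k / fact k) * (2 ^ l * (b \<bullet> fst p) ^ l / fact l)) =
    (if even (k + l) then pochhammer (\<beta> + \<delta>) (q + (k + l) div 2) / pochhammer \<delta> ((k + l) div 2) *
      (\<Sum>(i,i',n)\<in>power_pairs k l. (a \<bullet> a) ^ i * (b \<bullet> b) ^ i' / (fact i * fact i') * (2 ^ n * (a \<bullet> b) ^ n / fact n)) else 0)"
proof -
  define K where "K = k + l"
  define M where "M = (\<lambda>j. cone_mean \<beta> (\<lambda>p. (fst p \<bullet> fst p) ^ q * (2 ^ j * (a \<bullet> fst p) ^ j / fact j) * (2 ^ (K - j) * (b \<bullet> fst p) ^ (K - j) / fact (K - j))))"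
  have L: "(\<Sum>j\<le>K. M j * \<tau> ^ j) = 2 ^ K / fact K * cone_mean \<beta> (\<lambda>p. (fst p \<bullet> fst p) ^ q * ((\<tau> *\<^sub>R a + b) \<bullet> fst p) ^ K)" for \<tau>
  proof -
    have "2 ^ K / fact K * ((fst p \<bullet> fst p) ^ q * ((\<tau> *\<^sub>R a + b) \<bullet> fst p) ^ K) =
       (\<Sum>j\<le>K. \<tau> ^ j * ((fst p \<bullet> fst p) ^ q * (2 ^ j * (a \<bullet> fst p) ^ j / fact j) * (2 ^ (K - j) * (b \<bullet> fst p) ^ (K - j) / fact (K - j))))" for p :: "(real ^ 'n) \<times> real"
    proof -
      have "((\<tau> *\<^sub>R a + b) \<bullet> fst p) ^ K = (\<Sum>j\<le>K. real (K choose j) * (\<tau> * (a \<bullet> fst p)) ^ j * (b \<bullet> fst p) ^ (K - j))"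
        unfolding inner_add_left inner_scaleR_left by (rule binomial_ring)
      moreover have "2 ^ K / fact K * ((fst p \<bullet> fst p) ^ q * (real (K choose j) * (\<tau> * (a \<bullet> fst p)) ^ j * (b \<bullet> fst p) ^ (K - j)))
        = \<tau> ^ j * ((fst p \<bullet> fst p) ^ q * (2 ^ j * (a \<bullet> fst p) ^ j / fact j) * (2 ^ (K - j) * (b \<bullet> fst p) ^ (K - j) / fact (K - j)))" if "j \<le> K" for j
      proof -
        have "(2::real) ^ K = 2 ^ j * 2 ^ (K - j)" using that by (simp flip: power_add)
        then show ?thesis using that by (simp add: binomial_fact power_mult_distrib)
      qed
      ultimately show ?thesis by (simp add: sum_distrib_left)
    qed
    then have "2 ^ K / fact K * cone_mean \<beta> (\<lambda>p. (fst p \<bullet> fst p) ^ q * ((\<tau> *\<^sub>R a + b) \<bullet> fst p) ^ K) =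
       cone_mean \<beta> (\<lambda>p. \<Sum>j\<le>K. \<tau> ^ j * ((fst p \<bullet> fst p) ^ q * (2 ^ j * (a \<bullet> fst p) ^ j / fact j) * (2 ^ (K - j) * (b \<bullet> fst p) ^ (K - j) / fact (K - j))))"
      by (simp only: cone_mean_cmult[symmetric])
    also have "\<dots> = (\<Sum>j\<le>K. \<tau> ^ j * M j)"
      unfolding M_def cone_mean_cmult[symmetric]
      by (rule cone_mean_sum[OF _ \<beta>]) (intro real_polynomial_function_cone_intros)
    finally show ?thesis by (simp add: mult.commute)
  qed
  have Mk: "cone_mean \<beta> (\<lambda>p. (fst p \<bullet> fst p) ^ q * (2 ^ k * (a \<bullet> fst p) ^ k / fact k) * (2 ^ l * (b \<bullet> fst p) ^ l / fact l)) = M k"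
    by (simp add: M_def K_def)
  show ?thesis
  proof (cases "even K")
    case False
    then have "(\<Sum>j\<le>K. M j * \<tau> ^ j) = (\<Sum>j\<le>K. 0 * \<tau> ^ j)" for \<tau>
      unfolding L cone_mean_radial[OF \<beta>] by simp
    then have "\<forall>j\<le>K. M j = 0" by (subst polyfun_eq_coeffs[symmetric]) blast
    then have "M k = 0" by (simp add: K_def)
    then show ?thesis using False unfolding Mk K_def by simp
  next
    case True
    then obtain m where m: "K = 2 * m" by (elim evenE)
    define c where "c = pochhammer (\<beta> + \<delta>) (q + m) / pochhammer \<delta> m"
    define g where "g = (\<lambda>(i,i'). (a \<bullet> a) ^ i * (b \<bullet> b) ^ i' * (2 * (a \<bullet> b)) ^ (m - i - i') / (fact i * fact i' * fact (m - i - i')))"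
    define S where "S = (SIGMA i:{..m}. {..m - i})"
    have fS: "finite S" unfolding S_def by auto
    have "(\<Sum>j\<le>K. M j * \<tau> ^ j) = (\<Sum>j\<le>K. (c * (\<Sum>z\<in>{z\<in>S. 2 * fst z + (m - fst z - snd z) = j}. g z)) * \<tau> ^ j)" for \<tau>
    proof -
      \<comment> \<open>Duplication, (2m)! = 4^m (1/2)_m m!, absorbs the factor (1/2)_m of the
        sphere moment.\<close>
      have e: "2 ^ K * pochhammer (1 / 2) m / fact K = (1 / fact m :: real)"
        unfolding m using fact_double[of m, where 'a=real] pochhammer_pos[of "1/2 :: real" m] by (simp add: field_simps power_mult)
      have e': "2 ^ K / fact K * (P * pochhammer (1 / 2) m / D * N) = P / D * (N / fact m)" for P D N :: real
      proof -
        have "2 ^ K / fact K * (P * pochhammer (1 / 2) m / D * N) = P / D * N * (2 ^ K * pochhammer (1 / 2) m / fact K)"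
          by (simp add: mult_ac)
        then show ?thesis unfolding e by simp
      qed
      have "(\<Sum>j\<le>K. M j * \<tau> ^ j) = c * (((\<tau> *\<^sub>R a + b) \<bullet> (\<tau> *\<^sub>R a + b)) ^ m / fact m)"
      proof -
        have "even K" "K div 2 = m" using m by auto
        then show ?thesis unfolding L cone_mean_radial[OF \<beta>] c_def \<delta>_def by (simp only: if_True e')
      qed
      also have "(\<tau> *\<^sub>R a + b) \<bullet> (\<tau> *\<^sub>R a + b) = \<tau> ^ 2 * (a \<bullet> a) + b \<bullet> b + \<tau> * (2 * (a \<bullet> b))"
        by (simp add: inner_add_left inner_add_right inner_commute[of b a] power2_eq_square algebra_simps)
      also have "(\<tau> ^ 2 * (a \<bullet> a) + b \<bullet> b + \<tau> * (2 * (a \<bullet> b))) ^ m / fact m = (\<Sum>z\<in>S. g z * \<tau> ^ (2 * fst z + (m - fst z - snd z)))"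
        unfolding trinomial S_def[symmetric] g_def
        by (intro sum.cong refl) (simp add: case_prod_beta power_add power_mult_distrib power_mult)
      also have "\<dots> = (\<Sum>j\<le>K. \<Sum>z\<in>{z\<in>S. 2 * fst z + (m - fst z - snd z) = j}. g z * \<tau> ^ (2 * fst z + (m - fst z - snd z)))"
        by (rule sum.group[OF fS, symmetric]) (auto simp: S_def m)
      also have "\<dots> = (\<Sum>j\<le>K. (\<Sum>z\<in>{z\<in>S. 2 * fst z + (m - fst z - snd z) = j}. g z) * \<tau> ^ j)"
        unfolding sum_distrib_right by (intro sum.cong refl) auto
      finally show ?thesis by (simp add: sum_distrib_left mult_ac)
    qed
    then have "\<forall>j\<le>K. M j = c * (\<Sum>z\<in>{z\<in>S. 2 * fst z + (m - fst z - snd z) = j}. g z)"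
      by (subst polyfun_eq_coeffs[symmetric]) blast
    then have "M k = c * (\<Sum>z\<in>{z\<in>S. 2 * fst z + (m - fst z - snd z) = k}. g z)" by (simp add: K_def)
    also have "(\<Sum>z\<in>{z\<in>S. 2 * fst z + (m - fst z - snd z) = k}. g z) = (\<Sum>(i,i',n)\<in>power_pairs k l. (a \<bullet> a) ^ i * (b \<bullet> b) ^ i' / (fact i * fact i') * (2 ^ n * (a \<bullet> b) ^ n / fact n))"
    proof (rule sum.reindex_bij_witness[of _ "\<lambda>(i,i',n). (i,i')" "\<lambda>(i,i'). (i,i',m - i - i')"])
      fix z assume "z \<in> {z \<in> S. 2 * fst z + (m - fst z - snd z) = k}"
      then show "(case z of (i,i') \<Rightarrow> (i,i',m - i - i')) \<in> power_pairs k l"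
        using m by (auto simp: S_def power_pairs_def K_def)
    next
      fix z assume "z \<in> power_pairs k l"
      then show "(case (case z of (i,i',n) \<Rightarrow> (i,i')) of (i,i') \<Rightarrow> (i,i',m - i - i')) = z"
        "(case z of (i,i',n) \<Rightarrow> (i,i')) \<in> {z \<in> S. 2 * fst z + (m - fst z - snd z) = k}"
        using m by (auto simp: S_def power_pairs_def K_def)
    qed (auto simp: g_def power_mult_distrib)
    finally show ?thesis unfolding Mk using True m by (simp add: K_def[symmetric] c_def)
  qed
qed

text \<open>After expanding the powers of c, the sum belonging to a fixed zonal degree j is the
  right side of \<open>pochhammer_sum_inverse\<close> at \<delta> + j. Its value together with
  \<open>pochhammer \<delta> m\<close> splits into one factor for A and one for B: the separation
  needed to match a product of two zonal expansions.\<close>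

lemma sum_power_pairs_zonal:
  fixes \<delta> :: real
  assumes \<delta>: "\<delta> > 0" and kl: "k + l = 2 * m"
  shows "(\<Sum>(i,i',n)\<in>power_pairs k l. A ^ i * B ^ i' / (fact i * fact i') * (2 ^ n * c ^ n / fact n)) / pochhammer \<delta> m
    = (\<Sum>(i,i',j)\<in>power_pairs k l. A ^ i / (fact i * pochhammer \<delta> (j + i)) * (B ^ i' / (fact i' * pochhammer \<delta> (j + i'))) * zonal \<delta> j (A * B) c)"
proof -
  have pd: "pochhammer \<delta> n > 0" for n using \<delta> by (rule pochhammer_pos)
  let ?g = "\<lambda>z h. A ^ fst z * B ^ fst (snd z) / (fact (fst z) * fact (fst (snd z))) *
       ((A * B) ^ h / (fact h * pochhammer \<delta> (snd (snd z) - h)) * zonal \<delta> (snd (snd z) - 2 * h) (A * B) c)"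
  \<comment> \<open>Here i and i' are the total exponents of A and B, including the h that comes
    from (A B)^h; hence the shifts by h in the reindexing.\<close>
  define F where "F = (\<lambda>i i' j h. A ^ i * B ^ i' / (fact (i - h) * fact (i' - h)) / (fact h * pochhammer \<delta> (j + h)) * zonal \<delta> j (A * B) c)"
  have F: "F (i + h) (i' + h) (n - 2 * h) h = A ^ i * B ^ i' / (fact i * fact i') *
       ((A * B) ^ h / (fact h * pochhammer \<delta> (n - h)) * zonal \<delta> (n - 2 * h) (A * B) c)" if "h \<le> n div 2" for i i' n h
  proof -
    define j where "j = n - 2 * h"
    have n: "n = j + 2 * h" and nh: "j + 2 * h - h = j + h" using that by (auto simp: j_def)
    show ?thesis unfolding n by (simp add: F_def nh power_add power_mult_distrib)
  qed
  have "(\<Sum>(i,i',n)\<in>power_pairs k l. A ^ i * B ^ i' / (fact i * fact i') * (2 ^ n * c ^ n / fact n))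
    = (\<Sum>z\<in>power_pairs k l. \<Sum>h\<le>snd (snd z) div 2. ?g z h)"
    unfolding power_eq_sum_zonal[OF \<delta>, of _ c "A * B"] by (simp add: case_prod_beta sum_distrib_left)
  also have "\<dots> = (\<Sum>(z,h)\<in>(SIGMA z:power_pairs k l. {..snd (snd z) div 2}). ?g z h)"
    by (rule sum.Sigma) (auto simp: finite_power_pairs)
  also have "\<dots> = (\<Sum>(z,h)\<in>(SIGMA z:power_pairs k l. {..min (fst z) (fst (snd z))}). F (fst z) (fst (snd z)) (snd (snd z)) h)"
    by (rule sum.reindex_bij_witness[of _ "\<lambda>((i,i',j),h). ((i - h, i' - h, j + 2 * h), h)" "\<lambda>((i,i',n),h). ((i + h, i' + h, n - 2 * h), h)"])
       (auto simp: power_pairs_def F)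
  also have "\<dots> = (\<Sum>z\<in>power_pairs k l. \<Sum>h\<le>min (fst z) (fst (snd z)). F (fst z) (fst (snd z)) (snd (snd z)) h)"
    by (rule sum.Sigma[symmetric]) (auto simp: finite_power_pairs)
  finally have S: "(\<Sum>(i,i',n)\<in>power_pairs k l. A ^ i * B ^ i' / (fact i * fact i') * (2 ^ n * c ^ n / fact n)) =
    (\<Sum>z\<in>power_pairs k l. \<Sum>h\<le>min (fst z) (fst (snd z)). F (fst z) (fst (snd z)) (snd (snd z)) h)" .
  show ?thesis
    unfolding S sum_divide_distrib[of _ "power_pairs k l"]
  proof (intro sum.cong refl)
    fix z assume "z \<in> power_pairs k l"
    then obtain i i' j where z: "z = (i,i',j)" "2 * i + j = k" "2 * i' + j = l" by (auto simp: power_pairs_def)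
    have m: "m = j + (i + i')" using z kl by auto
    have pj: "pochhammer (\<delta> + real j) n > 0" for n using \<delta> by (intro pochhammer_pos) auto
    have "(\<Sum>h\<le>min i i'. F i i' j h) = A ^ i * B ^ i' * zonal \<delta> j (A * B) c / pochhammer \<delta> j *
        (\<Sum>h\<le>min i i'. 1 / (fact h * fact (i - h) * fact (i' - h) * pochhammer (\<delta> + real j) h))"
      unfolding F_def sum_distrib_left by (intro sum.cong refl) (simp add: pochhammer_product' mult_ac)
    also have "\<dots> = A ^ i * B ^ i' * zonal \<delta> j (A * B) c / pochhammer \<delta> j *
        (pochhammer (\<delta> + real j) (i + i') / (fact i * fact i' * pochhammer (\<delta> + real j) i * pochhammer (\<delta> + real j) i'))"
      using \<delta> by (subst pochhammer_sum_inverse) auto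
    finally have "(\<Sum>h\<le>min i i'. F i i' j h) / pochhammer \<delta> m = A ^ i * B ^ i' * zonal \<delta> j (A * B) c / pochhammer \<delta> j *
        (pochhammer (\<delta> + real j) (i + i') / (fact i * fact i' * pochhammer (\<delta> + real j) i * pochhammer (\<delta> + real j) i')) / pochhammer \<delta> m" by simp
    also have "\<dots> = A ^ i / (fact i * pochhammer \<delta> (j + i)) * (B ^ i' / (fact i' * pochhammer \<delta> (j + i'))) * zonal \<delta> j (A * B) c"
      unfolding m pochhammer_product'[of \<delta> j i] pochhammer_product'[of \<delta> j i'] pochhammer_product'[of \<delta> j "i + i'"] using pd[of j] pj[of i] pj[of i'] pj[of "i + i'"] by (simp add: mult_ac)
    finally show "(\<Sum>h\<le>min (fst z) (fst (snd z)). F (fst z) (fst (snd z)) (snd (snd z)) h) / pochhammer \<delta> m =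
       (case z of (i,i',j) \<Rightarrow> A ^ i / (fact i * pochhammer \<delta> (j + i)) * (B ^ i' / (fact i' * pochhammer \<delta> (j + i'))) * zonal \<delta> j (A * B) c)"
      unfolding z(1) by simp
  qed
qed

text \<open>The mean E of a product of two powers is computed directly and by zonal expansion. Both
  give the same triangular system, once with the unknown means M and once with the claimed values V,
  and the term (0, 0) can be isolated by induction on k + l. The exponent q has to vary, since the
  lower terms carry additional powers of \<open>fst p \<bullet> fst p\<close>.\<close>

lemma cone_mean_zonal_zonal:
  fixes a b :: "real ^ 'n"
  assumes \<beta>: "\<beta> \<ge> 0"
  defines "\<delta> \<equiv> real CARD('n) / 2"
  shows "cone_mean \<beta> (\<lambda>p. (fst p \<bullet> fst p) ^ q * zonal_fst \<delta> k a p * zonal_fst \<delta> l b p)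
    = (if k = l then pochhammer (\<beta> + \<delta>) (k + q) * zonal \<delta> k ((a \<bullet> a) * (b \<bullet> b)) (a \<bullet> b) else 0)"
proof -
  have \<delta>: "\<delta> > 0" by (simp add: \<delta>_def)
  have pd: "pochhammer \<delta> n > 0" for n using \<delta> by (rule pochhammer_pos)
  define M where "M = (\<lambda>q k l. cone_mean \<beta> (\<lambda>p. (fst p \<bullet> fst p) ^ q * zonal_fst \<delta> k a p * zonal_fst \<delta> l b p))"
  define V where "V = (\<lambda>q k l. if k = l then pochhammer (\<beta> + \<delta>) (k + q) * zonal \<delta> k ((a \<bullet> a) * (b \<bullet> b)) (a \<bullet> b) else 0)"
  define co where "co = (\<lambda>A k i. A ^ i / (fact i * pochhammer \<delta> (k - i)) :: real)"
  have "M q k l = V q k l"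
  proof (induction "k + l" arbitrary: k l q rule: less_induct)
    case less
    define I where "I = {..k div 2} \<times> {..l div 2}"
    let ?S = "\<lambda>p. \<Sum>z\<in>I. co (a \<bullet> a) k (fst z) * co (b \<bullet> b) l (snd z) * ((fst p \<bullet> fst p) ^ (q + fst z + snd z) *
           zonal_fst \<delta> (k - 2 * fst z) a p * zonal_fst \<delta> (l - 2 * snd z) b p)"
    define E where "E = cone_mean \<beta> (\<lambda>p. (fst p \<bullet> fst p) ^ q * (2 ^ k * (a \<bullet> fst p) ^ k / fact k) * (2 ^ l * (b \<bullet> fst p) ^ l / fact l))"
    have E1: "E = (\<Sum>(i,i')\<in>I. co (a \<bullet> a) k i * co (b \<bullet> b) l i' * M (q + i + i') (k - 2 * i) (l - 2 * i'))"
    proof -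
      have "(fst p \<bullet> fst p) ^ q * (2 ^ k * (a \<bullet> fst p) ^ k / fact k) * (2 ^ l * (b \<bullet> fst p) ^ l / fact l) =
        ?S p"
        for p :: "(real ^ 'n) \<times> real"
      proof -
        have "(fst p \<bullet> fst p) ^ q * (2 ^ k * (a \<bullet> fst p) ^ k / fact k) * (2 ^ l * (b \<bullet> fst p) ^ l / fact l) =
          (fst p \<bullet> fst p) ^ q * ((2 ^ k * (a \<bullet> fst p) ^ k / fact k) * (2 ^ l * (b \<bullet> fst p) ^ l / fact l))" by simp
        also have "\<dots> = (\<Sum>(i,i')\<in>I. (fst p \<bullet> fst p) ^ q *
            (((a \<bullet> a) * (fst p \<bullet> fst p)) ^ i / (fact i * pochhammer \<delta> (k - i)) * zonal_fst \<delta> (k - 2 * i) a p *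
            (((b \<bullet> b) * (fst p \<bullet> fst p)) ^ i' / (fact i' * pochhammer \<delta> (l - i')) * zonal_fst \<delta> (l - 2 * i') b p)))"
          unfolding power_eq_sum_zonal[OF \<delta>, of k "a \<bullet> fst p" "(a \<bullet> a) * (fst p \<bullet> fst p)"] power_eq_sum_zonal[OF \<delta>, of l "b \<bullet> fst p" "(b \<bullet> b) * (fst p \<bullet> fst p)"]
          unfolding sum_product sum.cartesian_product I_def[symmetric] by (simp only: sum_distrib_left case_prod_unfold)
        finally show ?thesis
          by (simp only: case_prod_unfold co_def power_add power_mult_distrib) (intro sum.cong refl, simp add: mult_ac)
      qed
      then have "E = cone_mean \<beta> ?S"
        unfolding E_def by (simp only:)
      also have "\<dots> = (\<Sum>z\<in>I. co (a \<bullet> a) k (fst z) * co (b \<bullet> b) l (snd z) * M (q + fst z + snd z) (k - 2 * fst z) (l - 2 * snd z))"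
        unfolding M_def cone_mean_cmult[symmetric]
        by (rule cone_mean_sum[OF _ \<beta>]) (intro real_polynomial_function_cone_intros)
      finally show ?thesis by (simp add: case_prod_beta)
    qed
    \<comment> \<open>The direct evaluation, arranged as the expansion with V in place of M. For odd
      k + l the two reduced degrees never agree and every V vanishes.\<close>
    have E2: "E = (\<Sum>(i,i')\<in>I. co (a \<bullet> a) k i * co (b \<bullet> b) l i' * V (q + i + i') (k - 2 * i) (l - 2 * i'))"
    proof (cases "even (k + l)")
      case False
      then have "V (q + i + i') (k - 2 * i) (l - 2 * i') = 0" if "(i,i') \<in> I" for i i'
      proof -
        have "k - 2 * i \<noteq> l - 2 * i'"
        proof
          assume "k - 2 * i = l - 2 * i'"
          moreover have "2 * i \<le> k" "2 * i' \<le> l" using that by (auto simp: I_def)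
          ultimately have "k + l = 2 * (i + (l - i'))" by auto
          then show False using False by simp
        qed
        then show ?thesis by (simp add: V_def)
      qed
      then have "(\<Sum>(i,i')\<in>I. co (a \<bullet> a) k i * co (b \<bullet> b) l i' * V (q + i + i') (k - 2 * i) (l - 2 * i')) = 0"
        by (intro sum.neutral) auto
      then show ?thesis using False unfolding E_def \<delta>_def cone_mean_power_power[OF \<beta>] by simp
    next
      case True
      then obtain m where m: "k + l = 2 * m" by (elim evenE)
      let ?A = "a \<bullet> a" and ?B = "b \<bullet> b"
      have "E = pochhammer (\<beta> + \<delta>) (q + m) * (\<Sum>(i,i',j)\<in>power_pairs k l. ?A ^ i / (fact i * pochhammer \<delta> (j + i)) * (?B ^ i' / (fact i' * pochhammer \<delta> (j + i'))) * zonal \<delta> j (?A * ?B) (a \<bullet> b))"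
        unfolding E_def \<delta>_def cone_mean_power_power[OF \<beta>]
        unfolding \<delta>_def[symmetric] sum_power_pairs_zonal[OF \<delta> m, symmetric] using m by simp
      also have "\<dots> = (\<Sum>(i,i',j)\<in>power_pairs k l. co ?A k i * co ?B l i' * V (q + i + i') j j)"
        unfolding sum_distrib_left
      proof (intro sum.cong refl)
        fix z assume "z \<in> power_pairs k l"
        then obtain i i' j where z: "z = (i,i',j)" "2 * i + j = k" "2 * i' + j = l" by (auto simp: power_pairs_def)
        have "k - i = j + i" "l - i' = j + i'" "q + m = j + (q + i + i')" using z m by auto
        then show "pochhammer (\<beta> + \<delta>) (q + m) * (case z of (i,i',j) \<Rightarrow> ?A ^ i / (fact i * pochhammer \<delta> (j + i)) * (?B ^ i' / (fact i' * pochhammer \<delta> (j + i'))) * zonal \<delta> j (?A * ?B) (a \<bullet> b))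
          = (case z of (i,i',j) \<Rightarrow> co ?A k i * co ?B l i' * V (q + i + i') j j)"
          unfolding z(1) by (simp add: co_def V_def mult_ac add_ac)
      qed
      also have "\<dots> = (\<Sum>(i,i')\<in>{z\<in>I. k - 2 * fst z = l - 2 * snd z}. co ?A k i * co ?B l i' * V (q + i + i') (k - 2 * i) (l - 2 * i'))"
        by (rule sum.reindex_bij_witness[of _ "\<lambda>(i,i'). (i,i',k - 2 * i)" "\<lambda>(i,i',j). (i,i')"])
           (auto simp: I_def power_pairs_def)
      also have "\<dots> = (\<Sum>(i,i')\<in>I. co ?A k i * co ?B l i' * V (q + i + i') (k - 2 * i) (l - 2 * i'))"
        by (rule sum.mono_neutral_left) (auto simp: I_def V_def split: if_splits)
      finally show ?thesis .
    qed
    have fI: "finite I" "(0,0) \<in> I" by (auto simp: I_def)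
    have rest: "(\<Sum>(i,i')\<in>I - {(0,0)}. co (a \<bullet> a) k i * co (b \<bullet> b) l i' * M (q + i + i') (k - 2 * i) (l - 2 * i'))
      = (\<Sum>(i,i')\<in>I - {(0,0)}. co (a \<bullet> a) k i * co (b \<bullet> b) l i' * V (q + i + i') (k - 2 * i) (l - 2 * i'))"
    proof (intro sum.cong refl)
      fix z assume z: "z \<in> I - {(0,0)}"
      obtain i i' where zi: "z = (i,i')" by (cases z)
      have "(k - 2 * i) + (l - 2 * i') < k + l" using z unfolding zi by (auto simp: I_def)
      then show "(case z of (i,i') \<Rightarrow> co (a \<bullet> a) k i * co (b \<bullet> b) l i' * M (q + i + i') (k - 2 * i) (l - 2 * i'))
         = (case z of (i,i') \<Rightarrow> co (a \<bullet> a) k i * co (b \<bullet> b) l i' * V (q + i + i') (k - 2 * i) (l - 2 * i'))"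
        unfolding zi using less by simp
    qed
    have "co (a \<bullet> a) k 0 * co (b \<bullet> b) l 0 * M q k l = co (a \<bullet> a) k 0 * co (b \<bullet> b) l 0 * V q k l"
    proof -
      have "E = co (a \<bullet> a) k 0 * co (b \<bullet> b) l 0 * M q k l + (\<Sum>(i,i')\<in>I - {(0,0)}. co (a \<bullet> a) k i * co (b \<bullet> b) l i' * M (q + i + i') (k - 2 * i) (l - 2 * i'))"
        unfolding E1 by (subst sum.remove[OF fI]) simp
      moreover have "E = co (a \<bullet> a) k 0 * co (b \<bullet> b) l 0 * V q k l + (\<Sum>(i,i')\<in>I - {(0,0)}. co (a \<bullet> a) k i * co (b \<bullet> b) l i' * V (q + i + i') (k - 2 * i) (l - 2 * i'))"
        unfolding E2 by (subst sum.remove[OF fI]) simp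
      ultimately show ?thesis unfolding rest by linarith
    qed
    moreover have "co (a \<bullet> a) k 0 * co (b \<bullet> b) l 0 \<noteq> 0" using pd[of k] pd[of l] by (simp add: co_def)
    ultimately show ?case by simp
  qed
  then show ?thesis unfolding M_def V_def .
qed

section \<open>The reproducing kernels\<close>

definition mehler_kernel :: "real \<Rightarrow> nat \<Rightarrow> real ^ 'n \<Rightarrow> (real ^ 'n) \<times> real \<Rightarrow> real" where
  "mehler_kernel \<beta> n x p = mehler_coeff (real CARD('n) / 2) (\<beta> + real CARD('n) / 2) n (x \<bullet> x) (fst p \<bullet> fst p) (x \<bullet> fst p)"

text \<open>With the pole a running through all vectors, the zonal kernels stand in for a basis of
  the harmonics of degree j. The shift of the Laguerre parameter by j accounts for the factor of
  degree 2j that two such kernels contribute to the radial integral.\<close>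

definition lag_zonal :: "real \<Rightarrow> nat \<Rightarrow> nat \<Rightarrow> real ^ 'n \<Rightarrow> (real ^ 'n) \<times> real \<Rightarrow> real" where
  "lag_zonal \<beta> i j a p = lag (\<beta> + real CARD('n) / 2 + real j) i (fst p \<bullet> fst p) *
     zonal_fst (real CARD('n) / 2) j a p"

lemma real_polynomial_function_lag_zonal: "real_polynomial_function (lag_zonal \<beta> i j a)"
  unfolding lag_zonal_def[abs_def] by (intro real_polynomial_function_cone_intros)

lemma mehler_kernel_eq:
  fixes x :: "real ^ 'n"
  defines "\<delta> \<equiv> real CARD('n) / 2"
  shows "mehler_kernel \<beta> n x p = (\<Sum>i\<le>n div 2. pochhammer (\<beta> + \<delta> + real (n - 2 * i)) i / (fact i * pochhammer (\<beta> + \<delta>) (n - 2 * i)) *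
     lag (\<beta> + \<delta> + real (n - 2 * i)) i (x \<bullet> x) * lag_zonal \<beta> i (n - 2 * i) x p)"
  unfolding mehler_kernel_def mehler_coeff_def lag_zonal_def \<delta>_def by (simp add: mult_ac)

lemma real_polynomial_function_mehler_kernel: "real_polynomial_function (mehler_kernel \<beta> n x)"
  unfolding mehler_kernel_eq[abs_def]
  by (intro real_polynomial_function_cone_intros real_polynomial_function_lag_zonal) auto

lemma mehler_kernel_commute:
  "mehler_kernel \<beta> n x (y, s) = mehler_kernel \<beta> n y (x, t)"
proof -
  have "mehler_coeff \<delta> \<alpha> n X Y c = mehler_coeff \<delta> \<alpha> n Y X c" for \<delta> \<alpha> X Y c
    unfolding mehler_coeff_def by (simp add: mult_ac)
  then show ?thesis by (simp add: mehler_kernel_def inner_commute)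
qed

text \<open>Zonal orthogonality forces j = j'. The remaining moments
  \<open>pochhammer (\<beta> + \<delta>) (j + (u + v))\<close> are a constant times the moments of
  parameter \<beta> + \<delta> + j, to which \<open>lag_orthogonal\<close> applies.\<close>

lemma cone_mean_lag_zonal:
  fixes a b :: "real ^ 'n"
  assumes \<beta>: "\<beta> \<ge> 0"
  defines "\<delta> \<equiv> real CARD('n) / 2"
  shows "cone_mean \<beta> (\<lambda>p. lag_zonal \<beta> i j a p * lag_zonal \<beta> i' j' b p) =
    (if i = i' \<and> j = j' then pochhammer (\<beta> + \<delta>) j * (fact i / pochhammer (\<beta> + \<delta> + real j) i) * zonal \<delta> j ((a \<bullet> a) * (b \<bullet> b)) (a \<bullet> b) else 0)"
proof -
  define \<mu> where "\<mu> = \<beta> + \<delta> + real j"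
  define \<mu>' where "\<mu>' = \<beta> + \<delta> + real j'"
  have \<delta>: "\<delta> > 0" by (simp add: \<delta>_def)
  then have \<mu>: "\<mu> > 0" using \<beta> by (simp add: \<mu>_def)
  define co where "co = (\<lambda>\<mu> i u. (-1) ^ u * real (i choose u) / pochhammer \<mu> u)"
  have "lag_zonal \<beta> i j a p * lag_zonal \<beta> i' j' b p = (\<Sum>u\<le>i. \<Sum>v\<le>i'. co \<mu> i u * co \<mu>' i' v *
     ((fst p \<bullet> fst p) ^ (u + v) * zonal_fst \<delta> j a p * zonal_fst \<delta> j' b p))" for p
  proof -
    have l: "lag \<mu> i X = (\<Sum>u\<le>i. co \<mu> i u * X ^ u)" for \<mu> i X
      unfolding lag_def co_def by simp
    have "lag_zonal \<beta> i j a p * lag_zonal \<beta> i' j' b p = (lag \<mu> i (fst p \<bullet> fst p) * lag \<mu>' i' (fst p \<bullet> fst p)) *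
       (zonal_fst \<delta> j a p * zonal_fst \<delta> j' b p)"
      unfolding lag_zonal_def \<mu>_def \<mu>'_def \<delta>_def by (simp add: mult_ac)
    then show ?thesis
      unfolding l unfolding sum_product unfolding sum_distrib_right by (simp add: power_add mult_ac)
  qed
  then have "cone_mean \<beta> (\<lambda>p. lag_zonal \<beta> i j a p * lag_zonal \<beta> i' j' b p) = (\<Sum>u\<le>i. \<Sum>v\<le>i'. co \<mu> i u * co \<mu>' i' v *
     cone_mean \<beta> (\<lambda>p. (fst p \<bullet> fst p) ^ (u + v) * zonal_fst \<delta> j a p * zonal_fst \<delta> j' b p))"
    unfolding cone_mean_cmult[symmetric]
    by (simp only:) (subst cone_mean_sum[OF _ \<beta>] | intro real_polynomial_function_cone_intros sum.cong refl finite_atMost)+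
  also have "\<dots> = (if j = j' then (\<Sum>u\<le>i. \<Sum>v\<le>i'. co \<mu> i u * co \<mu> i' v * pochhammer \<mu> (u + v)) * pochhammer (\<beta> + \<delta>) j * zonal \<delta> j ((a \<bullet> a) * (b \<bullet> b)) (a \<bullet> b) else 0)"
  proof (cases "j = j'")
    case True
    have "pochhammer (\<beta> + \<delta>) (j + (u + v)) = pochhammer (\<beta> + \<delta>) j * pochhammer \<mu> (u + v)" for u v
      unfolding \<mu>_def by (rule pochhammer_product')
    moreover have "\<mu>' = \<mu>" using True by (simp add: \<mu>_def \<mu>'_def)
    ultimately show ?thesis using True
      unfolding \<delta>_def cone_mean_zonal_zonal[OF \<beta>] unfolding \<delta>_def[symmetric]
      by (simp add: sum_distrib_right sum_distrib_left mult_ac)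
  next
    case False
    then show ?thesis unfolding \<delta>_def cone_mean_zonal_zonal[OF \<beta>] by simp
  qed
  also have "(\<Sum>u\<le>i. \<Sum>v\<le>i'. co \<mu> i u * co \<mu> i' v * pochhammer \<mu> (u + v)) = (if i = i' then fact i / pochhammer \<mu> i else 0)"
    unfolding co_def using lag_orthogonal[OF \<mu>, of i i'] by auto
  finally show ?thesis by (auto simp: \<mu>_def)
qed

text \<open>Only the term with the same i and j survives, and its weight in the kernel is the
  reciprocal of the norm. The height t is free because \<open>lag_zonal\<close> ignores it.\<close>

lemma cone_mean_mehler_kernel_lag_zonal:
  fixes a x :: "real ^ 'n"
  assumes \<beta>: "\<beta> \<ge> 0"
  shows "cone_mean \<beta> (\<lambda>p. mehler_kernel \<beta> m x p * lag_zonal \<beta> i j a p) = (if 2 * i + j = m then lag_zonal \<beta> i j a (x, t) else 0)"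
proof -
  define \<delta> where "\<delta> = real CARD('n) / 2"
  have \<delta>: "\<delta> > 0" by (simp add: \<delta>_def)
  have pl: "pochhammer (\<beta> + \<delta> + real j) n > 0" "pochhammer (\<beta> + \<delta>) n > 0" for n j using \<beta> \<delta> by (auto intro!: pochhammer_pos)
  define w where "w = (\<lambda>i. pochhammer (\<beta> + \<delta> + real (m - 2 * i)) i / (fact i * pochhammer (\<beta> + \<delta>) (m - 2 * i)) *
     lag (\<beta> + \<delta> + real (m - 2 * i)) i (x \<bullet> x))"
  have "cone_mean \<beta> (\<lambda>p. mehler_kernel \<beta> m x p * lag_zonal \<beta> i j a p) =
     cone_mean \<beta> (\<lambda>p. \<Sum>i'\<le>m div 2. w i' * (lag_zonal \<beta> i' (m - 2 * i') x p * lag_zonal \<beta> i j a p))"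
  proof -
    have "mehler_kernel \<beta> m x p = (\<Sum>i'\<le>m div 2. w i' * lag_zonal \<beta> i' (m - 2 * i') x p)" for p
      unfolding mehler_kernel_eq w_def \<delta>_def ..
    then show ?thesis by (simp only: sum_distrib_right mult.assoc)
  qed
  also have "\<dots> = (\<Sum>i'\<le>m div 2. w i' * cone_mean \<beta> (\<lambda>p. lag_zonal \<beta> i' (m - 2 * i') x p * lag_zonal \<beta> i j a p))"
    unfolding cone_mean_cmult[symmetric]
    by (rule cone_mean_sum[OF _ \<beta>]) (intro real_polynomial_function_cone_intros real_polynomial_function_lag_zonal)
  also have "\<dots> = (\<Sum>i'\<le>m div 2. if i' = i then (if 2 * i + j = m then lag_zonal \<beta> i j a (x, t) else 0) else 0)"
  proof (intro sum.cong refl)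
    fix i' assume i': "i' \<in> {..m div 2}"
    show "w i' * cone_mean \<beta> (\<lambda>p. lag_zonal \<beta> i' (m - 2 * i') x p * lag_zonal \<beta> i j a p) = (if i' = i then (if 2 * i + j = m then lag_zonal \<beta> i j a (x, t) else 0) else 0)"
    proof (cases "i' = i \<and> m - 2 * i' = j")
      case True
      then have m: "2 * i + j = m" and e: "i' = i" "m - 2 * i = j" using i' by auto
      show ?thesis
        unfolding e cone_mean_lag_zonal[OF \<beta>] w_def using pl(1)[of j i] pl(2)[of j] m
        by (simp add: lag_zonal_def \<delta>_def[symmetric] inner_commute[of x a] mult_ac)
    next
      case False
      then show ?thesis unfolding cone_mean_lag_zonal[OF \<beta>] by auto
    qed
  qed
  also have "\<dots> = (if 2 * i + j = m then lag_zonal \<beta> i j a (x, t) else 0)"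
    by auto
  finally show ?thesis .
qed

section \<open>Spanning: polynomials in x from Laguerre and zonal factors\<close>

text \<open>The linear span, given inductively so that a property that is linear in the function
  needs checking only on generators.\<close>

inductive_set lag_zonal_span :: "real \<Rightarrow> nat \<Rightarrow> ((real ^ 'n) \<times> real \<Rightarrow> real) set" for \<beta> n where
  gen: "2 * i + j \<le> n \<Longrightarrow> lag_zonal \<beta> i j a \<in> lag_zonal_span \<beta> n"
| zero: "(\<lambda>p. 0) \<in> lag_zonal_span \<beta> n"
| add: "f \<in> lag_zonal_span \<beta> n \<Longrightarrow> g \<in> lag_zonal_span \<beta> n \<Longrightarrow> (\<lambda>p. f p + g p) \<in> lag_zonal_span \<beta> n"
| cmult: "f \<in> lag_zonal_span \<beta> n \<Longrightarrow> (\<lambda>p. c * f p) \<in> lag_zonal_span \<beta> n"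

lemma lag_zonal_span_sum:
  "(\<And>i. i \<in> A \<Longrightarrow> f i \<in> lag_zonal_span \<beta> n) \<Longrightarrow> (\<lambda>p. \<Sum>i\<in>A. f i p) \<in> lag_zonal_span \<beta> n"
proof (induction A rule: infinite_finite_induct)
  case (insert i A)
  then have "(\<lambda>p. f i p + (\<Sum>i\<in>A. f i p)) \<in> lag_zonal_span \<beta> n"
    by (intro lag_zonal_span.add) auto
  then show ?case using insert.hyps by simp
qed (simp_all add: lag_zonal_span.zero)

text \<open>Write V(\<tau>) for the sum. The combination V(2 \<tau>) - 2^(N+1) V(\<tau>) removes the
  top coefficient and multiplies the lower ones by the nonzero numbers 2^j - 2^(N+1), which gives an
  induction on N.\<close>

lemma lag_zonal_span_coeff:
  assumes "\<And>\<tau>. (\<lambda>p. \<Sum>j\<le>N. \<tau> ^ j * V j p) \<in> lag_zonal_span \<beta> n" "j \<le> N"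
  shows "V j \<in> lag_zonal_span \<beta> n"
  using assms
proof (induction N arbitrary: V j)
  case 0
  then show ?case using "0.prems"(1)[of 1] by simp
next
  case (Suc N)
  have low: "V i \<in> lag_zonal_span \<beta> n" if i: "i \<le> N" for i
  proof -
    have "(\<lambda>p. \<Sum>j\<le>N. \<tau> ^ j * ((2 ^ j - 2 ^ Suc N) * V j p)) \<in> lag_zonal_span \<beta> n" for \<tau>
    proof -
      have "(\<lambda>p. (\<Sum>j\<le>Suc N. (2 * \<tau>) ^ j * V j p) + (- (2 ^ Suc N)) * (\<Sum>j\<le>Suc N. \<tau> ^ j * V j p)) \<in> lag_zonal_span \<beta> n"
        by (intro lag_zonal_span.add lag_zonal_span.cmult Suc.prems(1))
      moreover have "(\<Sum>j\<le>Suc N. (2 * \<tau>) ^ j * V j p) + (- (2 ^ Suc N)) * (\<Sum>j\<le>Suc N. \<tau> ^ j * V j p) = (\<Sum>j\<le>N. \<tau> ^ j * ((2 ^ j - 2 ^ Suc N) * V j p))" for p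
      proof -
        have "(\<Sum>j\<le>Suc N. (2 * \<tau>) ^ j * V j p) + (- (2 ^ Suc N)) * (\<Sum>j\<le>Suc N. \<tau> ^ j * V j p) = (\<Sum>j\<le>Suc N. \<tau> ^ j * ((2 ^ j - 2 ^ Suc N) * V j p))"
          unfolding sum_distrib_left sum.distrib[symmetric]
          by (intro sum.cong refl) (simp only: power_mult_distrib, simp only: algebra_simps)
        then show ?thesis by simp
      qed
      ultimately show ?thesis by (simp only:)
    qed
    then have "(\<lambda>p. (2 ^ i - 2 ^ Suc N) * V i p) \<in> lag_zonal_span \<beta> n"
      using Suc.IH[of "\<lambda>j p. (2 ^ j - 2 ^ Suc N) * V j p" i] i by blast
    then have "(\<lambda>p. (1 / (2 ^ i - 2 ^ Suc N)) * ((2 ^ i - 2 ^ Suc N) * V i p)) \<in> lag_zonal_span \<beta> n"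
      by (rule lag_zonal_span.cmult)
    moreover have "(2 :: real) ^ i - 2 ^ Suc N \<noteq> 0"
      using i power_strict_increasing[of i "Suc N" "2::real"] by simp
    ultimately show ?thesis by simp
  qed
  show ?case
  proof (cases "j = Suc N")
    case True
    have "(\<lambda>p. (\<Sum>j\<le>Suc N. 1 ^ j * V j p) + (-1) * (\<Sum>j\<le>N. V j p)) \<in> lag_zonal_span \<beta> n"
      by (intro lag_zonal_span.add lag_zonal_span.cmult Suc.prems(1) lag_zonal_span_sum) (auto intro: low)
    then show ?thesis using True by simp
  next
    case False
    then show ?thesis using low Suc.prems(2) by auto
  qed
qed

lemma power_zonal_in_lag_zonal_span:
  fixes a :: "real ^ 'n"
  assumes \<beta>: "\<beta> \<ge> 0" and le: "2 * q + j \<le> n"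
  shows "(\<lambda>p. (fst p \<bullet> fst p) ^ q * zonal_fst (real CARD('n) / 2) j a p) \<in> lag_zonal_span \<beta> n"
proof -
  have "\<beta> + real CARD('n) / 2 + real j > 0"
  proof -
    have "real CARD('n) / 2 > 0" by simp
    then show ?thesis using \<beta> of_nat_0_le_iff[of j, where 'a=real] by linarith
  qed
  from power_eq_sum_lag[OF this, of q] obtain e where
    e: "\<And>X. X ^ q = (\<Sum>i\<le>q. e i * lag (\<beta> + real CARD('n) / 2 + real j) i X)" by blast
  have "(\<lambda>p. \<Sum>i\<le>q. e i * lag_zonal \<beta> i j a p) \<in> lag_zonal_span \<beta> n"
    using le by (intro lag_zonal_span_sum lag_zonal_span.cmult lag_zonal_span.gen) auto
  then show ?thesis unfolding e lag_zonal_def by (simp add: sum_distrib_right sum_distrib_left mult_ac)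
qed

lemma power_in_lag_zonal_span:
  fixes a :: "real ^ 'n"
  assumes \<beta>: "\<beta> \<ge> 0" and le: "2 * q + k \<le> n"
  shows "(\<lambda>p. (fst p \<bullet> fst p) ^ q * (a \<bullet> fst p) ^ k) \<in> lag_zonal_span \<beta> n"
proof -
  define \<delta> where "\<delta> = real CARD('n) / 2"
  have \<delta>: "\<delta> > 0" by (simp add: \<delta>_def)
  let ?S = "\<lambda>p :: (real ^ 'n) \<times> real. \<Sum>i\<le>k div 2. fact k / 2 ^ k * (a \<bullet> a) ^ i / (fact i * pochhammer \<delta> (k - i)) *
     ((fst p \<bullet> fst p) ^ (q + i) * zonal_fst \<delta> (k - 2 * i) a p)"
  have "(fst p \<bullet> fst p) ^ q * (a \<bullet> fst p) ^ k = ?S p" for p :: "(real ^ 'n) \<times> real"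
  proof -
    have "(fst p \<bullet> fst p) ^ q * (a \<bullet> fst p) ^ k = fact k / 2 ^ k * (fst p \<bullet> fst p) ^ q * (2 ^ k * (a \<bullet> fst p) ^ k / fact k)" by simp
    then show ?thesis
      unfolding power_eq_sum_zonal[OF \<delta>, of k "a \<bullet> fst p" "(a \<bullet> a) * (fst p \<bullet> fst p)"] sum_distrib_left
      by (simp add: power_add power_mult_distrib mult_ac)
  qed
  moreover have "?S \<in> lag_zonal_span \<beta> n"
    unfolding \<delta>_def using le by (intro lag_zonal_span_sum lag_zonal_span.cmult power_zonal_in_lag_zonal_span[OF \<beta>]) auto
  ultimately show ?thesis by (simp only:)
qed

text \<open>Polarization, since at first only powers of a single linear form are at hand. To bring
  in coordinate i, take the linear form \<tau> e_i + a with exponent \<alpha> i + k and extract the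
  coefficient of \<tau> to the power \<alpha> i; a and k therefore vary in the induction.\<close>

lemma monomial_in_lag_zonal_span:
  fixes a :: "real ^ 'n"
  assumes \<beta>: "\<beta> \<ge> 0" and "finite I" and "(\<Sum>i\<in>I. \<alpha> i) + 2 * q + k \<le> n"
  shows "(\<lambda>p. (\<Prod>i\<in>I. (fst p $ i) ^ \<alpha> i) * ((fst p \<bullet> fst p) ^ q * (a \<bullet> fst p) ^ k)) \<in> lag_zonal_span \<beta> n"
  using assms(2,3)
proof (induction I arbitrary: a k rule: finite_induct)
  case empty
  then show ?case using power_in_lag_zonal_span[OF \<beta>] by simp
next
  case (insert i I)
  let ?V = "\<lambda>j p. real ((\<alpha> i + k) choose j) * ((\<Prod>i\<in>I. (fst p $ i) ^ \<alpha> i) * ((fst p \<bullet> fst p) ^ q * ((fst p $ i) ^ j * (a \<bullet> fst p) ^ (\<alpha> i + k - j))))"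
  have "(\<lambda>p. \<Sum>j\<le>\<alpha> i + k. \<tau> ^ j * ?V j p) \<in> lag_zonal_span \<beta> n" for \<tau>
  proof -
    have "(\<lambda>p. (\<Prod>i\<in>I. (fst p $ i) ^ \<alpha> i) * ((fst p \<bullet> fst p) ^ q * ((\<tau> *\<^sub>R axis i 1 + a) \<bullet> fst p) ^ (\<alpha> i + k))) \<in> lag_zonal_span \<beta> n"
      using insert by (intro insert.IH) auto
    moreover have "((\<tau> *\<^sub>R axis i 1 + a) \<bullet> fst p) ^ (\<alpha> i + k) = (\<Sum>j\<le>\<alpha> i + k. real ((\<alpha> i + k) choose j) * (\<tau> * fst p $ i) ^ j * (a \<bullet> fst p) ^ (\<alpha> i + k - j))" for p :: "(real ^ 'n) \<times> real"
      by (simp only: inner_add_left inner_scaleR_left inner_axis' inner_real_def mult_1 binomial_ring)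
    ultimately show ?thesis by (simp add: sum_distrib_left power_mult_distrib mult_ac)
  qed
  then have "?V (\<alpha> i) \<in> lag_zonal_span \<beta> n"
    by (rule lag_zonal_span_coeff) simp
  then have "(\<lambda>p. (1 / real ((\<alpha> i + k) choose \<alpha> i)) * ?V (\<alpha> i) p) \<in> lag_zonal_span \<beta> n"
    by (rule lag_zonal_span.cmult)
  moreover have "real ((\<alpha> i + k) choose \<alpha> i) \<noteq> 0" by simp
  ultimately show ?case using insert.hyps by (simp add: mult_ac)
qed

text \<open>The element f is the sum of its projections of degrees at most n, and the higher ones
  vanish. The claims are linear in f and known on generators; polynomiality is carried along because
  additivity of the mean rests on integrability.\<close>

lemma lag_zonal_span_reproducing:
  fixes f :: "(real ^ 'n) \<times> real \<Rightarrow> real"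
  assumes \<beta>: "\<beta> \<ge> 0" and "f \<in> lag_zonal_span \<beta> n"
  shows "real_polynomial_function f \<and>
    (\<forall>x t. f (x, t) = (\<Sum>m\<le>n. cone_mean \<beta> (\<lambda>p. mehler_kernel \<beta> m x p * f p))) \<and>
    (\<forall>x m. m > n \<longrightarrow> cone_mean \<beta> (\<lambda>p. mehler_kernel \<beta> m x p * f p) = 0)"
  using assms(2)
proof induction
  case (gen i j a)
  have "lag_zonal \<beta> i j a (x, t) = (\<Sum>m\<le>n. cone_mean \<beta> (\<lambda>p. mehler_kernel \<beta> m x p * lag_zonal \<beta> i j a p))" for x t
    unfolding cone_mean_mehler_kernel_lag_zonal[OF \<beta>, where t=t] using gen by simp
  moreover have "cone_mean \<beta> (\<lambda>p. mehler_kernel \<beta> m x p * lag_zonal \<beta> i j a p) = 0" if "m > n" for m x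
    unfolding cone_mean_mehler_kernel_lag_zonal[OF \<beta>, where t=0] using gen that by simp
  ultimately show ?case using real_polynomial_function_lag_zonal by blast
next
  case zero
  have "cone_mean \<beta> (\<lambda>p :: (real ^ 'n) \<times> real. 0) = 0"
    using cone_mean_cmult[of \<beta> 0 "\<lambda>p :: (real ^ 'n) \<times> real. 0"] by simp
  then show ?case using real_polynomial_function.intros(2)[of 0] by simp
next
  case (add f g)
  have "cone_mean \<beta> (\<lambda>p. mehler_kernel \<beta> m x p * (f p + g p)) = cone_mean \<beta> (\<lambda>p. mehler_kernel \<beta> m x p * f p) + cone_mean \<beta> (\<lambda>p. mehler_kernel \<beta> m x p * g p)" for m x
    unfolding distrib_left
    by (intro cone_mean_add[OF _ _ \<beta>] real_polynomial_function.intros(4) real_polynomial_function_mehler_kernel) (use add in auto)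
  then show ?case using add.IH by (simp add: sum.distrib real_polynomial_function.intros(3))
next
  case (cmult f c)
  have "cone_mean \<beta> (\<lambda>p. mehler_kernel \<beta> m x p * (c * f p)) = c * cone_mean \<beta> (\<lambda>p. mehler_kernel \<beta> m x p * f p)" for m x
    unfolding mult.left_commute[of _ c] by (rule cone_mean_cmult)
  then show ?case using cmult.IH by (simp add: sum_distrib_left real_polynomial_function.intros)
qed


section \<open>Polynomials of bounded degree\<close>

definition monomial_fun :: "('n \<Rightarrow> nat) \<Rightarrow> nat \<Rightarrow> (real ^ 'n) \<times> real \<Rightarrow> real" where
  "monomial_fun \<alpha> k p = (\<Prod>i\<in>UNIV. (fst p $ i) ^ \<alpha> i) * snd p ^ k"

lemma poly_deg_le_altdef:
  "q \<in> poly_deg_le n \<longleftrightarrow>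
    (\<exists>c. \<forall>p. q p = (\<Sum>(\<alpha>, k) | (\<Sum>i\<in>UNIV. \<alpha> i) + k \<le> n. c \<alpha> k * monomial_fun \<alpha> k p))"
  unfolding poly_deg_le_def monomial_fun_def by (simp add: mult.assoc)

lemma poly_deg_le_add:
  assumes "f \<in> poly_deg_le n" "g \<in> poly_deg_le n"
  shows "(\<lambda>p. f p + g p) \<in> poly_deg_le n"
proof -
  obtain c c' where "\<forall>p. f p = (\<Sum>(\<alpha>, k) | (\<Sum>i\<in>UNIV. \<alpha> i) + k \<le> n. c \<alpha> k * monomial_fun \<alpha> k p)"
    "\<forall>p. g p = (\<Sum>(\<alpha>, k) | (\<Sum>i\<in>UNIV. \<alpha> i) + k \<le> n. c' \<alpha> k * monomial_fun \<alpha> k p)"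
    using assms unfolding poly_deg_le_altdef by blast
  then have "\<forall>p. f p + g p = (\<Sum>(\<alpha>, k) | (\<Sum>i\<in>UNIV. \<alpha> i) + k \<le> n. (c \<alpha> k + c' \<alpha> k) * monomial_fun \<alpha> k p)"
    by (simp add: case_prod_unfold distrib_right sum.distrib)
  then show ?thesis unfolding poly_deg_le_altdef by (intro exI[of _ "\<lambda>\<alpha> k. c \<alpha> k + c' \<alpha> k"])
qed

lemma poly_deg_le_cmult:
  assumes "f \<in> poly_deg_le n"
  shows "(\<lambda>p. a * f p) \<in> poly_deg_le n"
proof -
  obtain c where "\<forall>p. f p = (\<Sum>(\<alpha>, k) | (\<Sum>i\<in>UNIV. \<alpha> i) + k \<le> n. c \<alpha> k * monomial_fun \<alpha> k p)"
    using assms unfolding poly_deg_le_altdef by blast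
  then have "\<forall>p. a * f p = (\<Sum>(\<alpha>, k) | (\<Sum>i\<in>UNIV. \<alpha> i) + k \<le> n. (a * c \<alpha> k) * monomial_fun \<alpha> k p)"
    by (simp add: case_prod_unfold sum_distrib_left mult.assoc)
  then show ?thesis unfolding poly_deg_le_altdef by (intro exI[of _ "\<lambda>\<alpha> k. a * c \<alpha> k"])
qed

lemma monomial_in_poly_deg_le:
  fixes \<alpha> :: "'n::finite \<Rightarrow> nat"
  assumes "(\<Sum>i\<in>UNIV. \<alpha> i) + k \<le> n"
  shows "monomial_fun \<alpha> k \<in> poly_deg_le n"
proof -
  have "monomial_fun \<alpha> k p = (\<Sum>(\<alpha>', k') | (\<Sum>i\<in>UNIV. \<alpha>' i) + k' \<le> n. (if (\<alpha>', k') = (\<alpha>, k) then 1 else 0) * monomial_fun \<alpha>' k' p)" for p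
  proof -
    have "(\<Sum>(\<alpha>', k') | (\<Sum>i\<in>UNIV. \<alpha>' i) + k' \<le> n. (if (\<alpha>', k') = (\<alpha>, k) then 1 else 0) * monomial_fun \<alpha>' k' p)
      = (\<Sum>z\<in>{(\<alpha>', k'). (\<Sum>i\<in>UNIV. \<alpha>' i) + k' \<le> n}. if z = (\<alpha>, k) then monomial_fun \<alpha> k p else 0)"
      by (intro sum.cong refl) (auto split: if_splits)
    then show ?thesis using assms by (simp add: sum.delta finite_multi_indices)
  qed
  then show ?thesis unfolding poly_deg_le_altdef
    by (intro exI[of _ "\<lambda>\<alpha>' k'. if (\<alpha>', k') = (\<alpha>, k) then 1 else 0"]) simp
qed

lemma poly_deg_le_zero: "(\<lambda>p. 0) \<in> poly_deg_le n"
  unfolding poly_deg_le_altdef by (intro exI[of _ "\<lambda>_ _. 0"]) (simp add: case_prod_unfold)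

lemma poly_deg_le_sum:
  "(\<And>i. i \<in> A \<Longrightarrow> f i \<in> poly_deg_le n) \<Longrightarrow> (\<lambda>p. \<Sum>i\<in>A. f i p) \<in> poly_deg_le n"
proof (induction A rule: infinite_finite_induct)
  case (insert i A)
  then have "(\<lambda>p. f i p + (\<Sum>i\<in>A. f i p)) \<in> poly_deg_le n"
    by (intro poly_deg_le_add) auto
  then show ?case using insert.hyps by simp
qed (simp_all add: poly_deg_le_zero)

lemma poly_deg_le_induct [consumes 1, case_names zero monomial add cmult]:
  fixes q :: "(real ^ 'n) \<times> real \<Rightarrow> real"
  assumes q: "q \<in> poly_deg_le n"
    and zero: "P (\<lambda>p. 0)"
    and monomial: "\<And>\<alpha> k. (\<Sum>i\<in>UNIV. \<alpha> i) + k \<le> n \<Longrightarrow> P (monomial_fun \<alpha> k)"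
    and add: "\<And>f g. P f \<Longrightarrow> P g \<Longrightarrow> P (\<lambda>p. f p + g p)"
    and cmult: "\<And>f a. P f \<Longrightarrow> P (\<lambda>p. a * f p)"
  shows "P q"
proof -
  obtain c where c: "\<And>p. q p = (\<Sum>(\<alpha>, k) | (\<Sum>i\<in>UNIV. \<alpha> i) + k \<le> n. c \<alpha> k * monomial_fun \<alpha> k p)"
    using q unfolding poly_deg_le_altdef by blast
  have "P (\<lambda>p. \<Sum>z\<in>S. c (fst z) (snd z) * monomial_fun (fst z) (snd z) p)"
    if "S \<subseteq> {(\<alpha> :: 'n \<Rightarrow> nat, k). (\<Sum>i\<in>UNIV. \<alpha> i) + k \<le> n}" for S
    using that
  proof (induction S rule: infinite_finite_induct)
    case (insert z S)
    have "P (\<lambda>p. c (fst z) (snd z) * monomial_fun (fst z) (snd z) p)"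
      using insert.prems by (intro cmult monomial) auto
    then have "P (\<lambda>p. c (fst z) (snd z) * monomial_fun (fst z) (snd z) p + (\<Sum>z\<in>S. c (fst z) (snd z) * monomial_fun (fst z) (snd z) p))"
      using insert by (intro add) auto
    then show ?case using insert.hyps by simp
  qed (simp_all add: zero)
  from this[OF subset_refl] show ?thesis unfolding c[abs_def] case_prod_unfold .
qed

lemma poly_deg_le_mult:
  fixes f g :: "(real ^ 'n) \<times> real \<Rightarrow> real"
  assumes "f \<in> poly_deg_le m" "g \<in> poly_deg_le n"
  shows "(\<lambda>p. f p * g p) \<in> poly_deg_le (m + n)"
  using assms(1)
proof (induction rule: poly_deg_le_induct)
  case (monomial \<alpha> k)
  show ?case using assms(2)
  proof (induction rule: poly_deg_le_induct)
    case (monomial \<alpha>' k')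
    have "(\<lambda>p. monomial_fun \<alpha> k p * monomial_fun \<alpha>' k' p) = monomial_fun (\<lambda>i. \<alpha> i + \<alpha>' i) (k + k')"
      by (simp add: fun_eq_iff monomial_fun_def power_add prod.distrib)
    moreover have "monomial_fun (\<lambda>i. \<alpha> i + \<alpha>' i) (k + k') \<in> poly_deg_le (m + n)"
      using monomial \<open>sum \<alpha> UNIV + k \<le> m\<close> by (intro monomial_in_poly_deg_le) (simp add: sum.distrib)
    ultimately show ?case by simp
  next
    case (cmult f a)
    then show ?case using poly_deg_le_cmult[OF cmult, of a] by (simp add: mult.left_commute)
  qed (simp_all add: poly_deg_le_zero poly_deg_le_add distrib_left)
next
  case (cmult f a)
  then show ?case using poly_deg_le_cmult[OF cmult, of a] by (simp add: mult.assoc)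
qed (simp_all add: poly_deg_le_zero poly_deg_le_add distrib_right)

lemma poly_deg_le_mono:
  assumes "f \<in> poly_deg_le m" "m \<le> n"
  shows "f \<in> poly_deg_le n"
  using assms(1)
  by (induction rule: poly_deg_le_induct)
     (use assms(2) in \<open>auto intro: poly_deg_le_zero poly_deg_le_add poly_deg_le_cmult monomial_in_poly_deg_le\<close>)

lemma poly_deg_le_const: "(\<lambda>p. c) \<in> poly_deg_le n"
proof -
  have "(\<lambda>p. c * monomial_fun (\<lambda>_. 0) 0 p) \<in> poly_deg_le n"
    by (intro poly_deg_le_cmult monomial_in_poly_deg_le) simp
  then show ?thesis by (simp add: monomial_fun_def)
qed

lemma poly_deg_le_power:
  assumes "f \<in> poly_deg_le m"
  shows "(\<lambda>p. f p ^ k) \<in> poly_deg_le (k * m)"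
  by (induction k) (use poly_deg_le_mult[OF assms] in \<open>auto intro: poly_deg_le_const\<close>)

lemma poly_deg_le_inner_fst:
  fixes a :: "real ^ 'n"
  shows "(\<lambda>p. a \<bullet> fst p) \<in> poly_deg_le 1"
proof -
  have "(\<Prod>i\<in>UNIV. (fst p $ i) ^ (if i = j then 1 else 0)) = fst p $ j" for j and p :: "(real ^ 'n) \<times> real"
  proof -
    have "(\<Prod>i\<in>UNIV. (fst p $ i) ^ (if i = j then 1 else 0)) = (\<Prod>i\<in>UNIV. if i = j then fst p $ i else 1)"
      by (intro prod.cong) auto
    then show ?thesis by simp
  qed
  then have "(\<lambda>p. a \<bullet> fst p) = (\<lambda>p. \<Sum>j\<in>UNIV. a $ j * monomial_fun (\<lambda>i. if i = j then 1 else 0) 0 p)"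
    by (simp add: monomial_fun_def inner_vec_def)
  moreover have "(\<lambda>p. \<Sum>j\<in>UNIV. a $ j * monomial_fun (\<lambda>i. if i = j then 1 else 0) 0 p) \<in> poly_deg_le 1"
    by (intro poly_deg_le_sum poly_deg_le_cmult monomial_in_poly_deg_le) simp
  ultimately show ?thesis by simp
qed

lemma poly_deg_le_norm_fst: "(\<lambda>p :: (real ^ 'n) \<times> real. fst p \<bullet> fst p) \<in> poly_deg_le 2"
proof -
  have "(\<lambda>p :: (real ^ 'n) \<times> real. \<Sum>i\<in>UNIV. (axis i 1 \<bullet> fst p) * (axis i 1 \<bullet> fst p)) \<in> poly_deg_le 2"
    using poly_deg_le_mult[OF poly_deg_le_inner_fst poly_deg_le_inner_fst]
    by (intro poly_deg_le_sum) (simp add: numeral_2_eq_2)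
  then show ?thesis by (simp only: norm_fst_eq_sum)
qed

lemma poly_deg_le_zonal:
  fixes a :: "real ^ 'n"
  shows "(\<lambda>p. zonal \<delta> k (c * (fst p \<bullet> fst p)) (a \<bullet> fst p)) \<in> poly_deg_le k"
proof (induction k rule: less_induct)
  case (less k)
  have "(\<lambda>p. pochhammer \<delta> k * ((2 ^ k / fact k) * (a \<bullet> fst p) ^ k +
     (\<Sum>i\<in>{1..k div 2}. (- (c ^ i) / (fact i * pochhammer \<delta> (k - i))) * ((fst p \<bullet> fst p) ^ i * zonal \<delta> (k - 2 * i) (c * (fst p \<bullet> fst p)) (a \<bullet> fst p))))) \<in> poly_deg_le k"
  proof (intro poly_deg_le_cmult poly_deg_le_add poly_deg_le_sum)
    show "(\<lambda>p. (a \<bullet> fst p) ^ k) \<in> poly_deg_le k"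
      using poly_deg_le_power[OF poly_deg_le_inner_fst, of a k] by simp
    fix i assume i: "i \<in> {1..k div 2}"
    then have "k - 2 * i < k" by (simp only: atLeastAtMost_iff) linarith
    then have "(\<lambda>p. (fst p \<bullet> fst p) ^ i * zonal \<delta> (k - 2 * i) (c * (fst p \<bullet> fst p)) (a \<bullet> fst p)) \<in> poly_deg_le (i * 2 + (k - 2 * i))"
      by (intro poly_deg_le_mult poly_deg_le_power poly_deg_le_norm_fst less)
    then show "(\<lambda>p. (fst p \<bullet> fst p) ^ i * zonal \<delta> (k - 2 * i) (c * (fst p \<bullet> fst p)) (a \<bullet> fst p)) \<in> poly_deg_le k"
      by (rule poly_deg_le_mono) (use i in auto)
  qed
  then show ?case
    by (subst zonal.simps) (simp add: power_mult_distrib sum_negf mult.assoc)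
qed

lemma poly_deg_le_lag: "(\<lambda>p :: (real ^ 'n) \<times> real. lag \<mu> i (fst p \<bullet> fst p)) \<in> poly_deg_le (2 * i)"
proof -
  have "(\<lambda>p :: (real ^ 'n) \<times> real. \<Sum>u\<le>i. ((-1) ^ u * real (i choose u) / pochhammer \<mu> u) * (fst p \<bullet> fst p) ^ u) \<in> poly_deg_le (2 * i)"
  proof (intro poly_deg_le_sum poly_deg_le_cmult)
    fix u assume "u \<in> {..i}"
    then show "(\<lambda>p :: (real ^ 'n) \<times> real. (fst p \<bullet> fst p) ^ u) \<in> poly_deg_le (2 * i)"
      by (intro poly_deg_le_mono[OF poly_deg_le_power[OF poly_deg_le_norm_fst]]) auto
  qed
  then show ?thesis by (simp add: lag_def)
qed

lemma poly_deg_le_lag_zonal: "lag_zonal \<beta> i j a \<in> poly_deg_le (2 * i + j)"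
  unfolding lag_zonal_def[abs_def] by (intro poly_deg_le_mult poly_deg_le_lag poly_deg_le_zonal)

lemma poly_deg_le_mehler_kernel: "mehler_kernel \<beta> n x \<in> poly_deg_le n"
  unfolding mehler_kernel_eq[abs_def]
  by (intro poly_deg_le_sum poly_deg_le_cmult poly_deg_le_mono[OF poly_deg_le_lag_zonal]) auto

lemma real_polynomial_function_poly_deg_le:
  fixes q :: "(real ^ 'n) \<times> real \<Rightarrow> real"
  assumes "q \<in> poly_deg_le n"
  shows "real_polynomial_function q"
  using assms
proof (induction rule: poly_deg_le_induct)
  case (monomial \<alpha> k)
  have "real_polynomial_function (\<lambda>p :: (real ^ 'n) \<times> real. fst p $ i)" for i
    using real_polynomial_function_inner_fst[of "axis i 1"] by (simp add: inner_axis')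
  moreover have "real_polynomial_function (snd :: (real ^ 'n) \<times> real \<Rightarrow> real)"
    by (rule real_polynomial_function.intros(1)[OF bounded_linear_snd])
  ultimately show ?case unfolding monomial_fun_def[abs_def]
    by (intro real_polynomial_function.intros(4) real_polynomial_function_prod real_polynomial_function_power) auto
qed (auto intro: real_polynomial_function.intros)

lemma poly_deg_le_reflect:
  fixes q :: "(real ^ 'n) \<times> real \<Rightarrow> real"
  assumes "q \<in> poly_deg_le n"
  shows "(\<lambda>p. q (fst p, - snd p)) \<in> poly_deg_le n"
  using assms
proof (induction rule: poly_deg_le_induct)
  case (monomial \<alpha> k)
  have "(\<lambda>p. monomial_fun \<alpha> k (fst p, - snd p)) = (\<lambda>p. (-1) ^ k * monomial_fun \<alpha> k p)"
    by (simp add: fun_eq_iff monomial_fun_def power_minus[of "snd _"])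
  then show ?case using poly_deg_le_cmult[OF monomial_in_poly_deg_le[OF monomial]] by simp
qed (simp_all add: poly_deg_le_zero poly_deg_le_add poly_deg_le_cmult)

text \<open>Symmetrization in t keeps only even powers of t, and on the cone t^2 equals
  \<open>x \<bullet> x\<close>. This replaces t without raising the degree.\<close>

lemma poly_deg_le_even_part:
  fixes q :: "(real ^ 'n) \<times> real \<Rightarrow> real"
  assumes \<beta>: "\<beta> \<ge> 0" and "q \<in> poly_deg_le n"
  shows "\<exists>f\<in>lag_zonal_span \<beta> n. \<forall>p\<in>double_cone. (q p + q (fst p, - snd p)) / 2 = f p"
  using assms(2)
proof (induction rule: poly_deg_le_induct)
  case zero
  show ?case by (intro bexI[OF _ lag_zonal_span.zero] ballI) simp
next
  case (monomial \<alpha> k)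
  show ?case
  proof (cases "even k")
    case True
    then obtain m where k: "k = 2 * m" by (elim evenE)
    have "(\<lambda>p. (\<Prod>i\<in>UNIV. (fst p $ i) ^ \<alpha> i) * ((fst p \<bullet> fst p) ^ m * (0 \<bullet> fst p) ^ 0)) \<in> lag_zonal_span \<beta> n"
      using monomial k by (intro monomial_in_lag_zonal_span[OF \<beta>]) auto
    moreover have "(monomial_fun \<alpha> k p + monomial_fun \<alpha> k (fst p, - snd p)) / 2 = (\<Prod>i\<in>UNIV. (fst p $ i) ^ \<alpha> i) * ((fst p \<bullet> fst p) ^ m * (0 \<bullet> fst p) ^ 0)"
      if "p \<in> double_cone" for p
    proof -
      have "fst p \<bullet> fst p = (snd p)\<^sup>2"
        using that by (auto simp: double_cone_def simp flip: power2_norm_eq_inner)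
      then show ?thesis by (simp add: monomial_fun_def k power_mult)
    qed
    ultimately show ?thesis
      by (intro bexI[of _ "\<lambda>p. (\<Prod>i\<in>UNIV. (fst p $ i) ^ \<alpha> i) * ((fst p \<bullet> fst p) ^ m * (0 \<bullet> fst p) ^ 0)"] ballI)
  next
    case False
    then have "(monomial_fun \<alpha> k p + monomial_fun \<alpha> k (fst p, - snd p)) / 2 = 0" for p
      by (simp add: monomial_fun_def power_minus[of "snd p"])
    then show ?thesis by (intro bexI[OF _ lag_zonal_span.zero] ballI)
  qed
next
  case (add f g)
  then obtain f' g' where "f' \<in> lag_zonal_span \<beta> n" "\<And>p. p \<in> double_cone \<Longrightarrow> (f p + f (fst p, - snd p)) / 2 = f' p"
    "g' \<in> lag_zonal_span \<beta> n" "\<And>p. p \<in> double_cone \<Longrightarrow> (g p + g (fst p, - snd p)) / 2 = g' p"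
    by blast
  then have *: "f' \<in> lag_zonal_span \<beta> n" "g' \<in> lag_zonal_span \<beta> n"
    and eq: "\<And>p. p \<in> double_cone \<Longrightarrow> (f p + f (fst p, - snd p)) / 2 = f' p" "\<And>p. p \<in> double_cone \<Longrightarrow> (g p + g (fst p, - snd p)) / 2 = g' p"
    by auto
  have "(f p + g p + (f (fst p, - snd p) + g (fst p, - snd p))) / 2 = f' p + g' p" if "p \<in> double_cone" for p
    unfolding eq[OF that, symmetric] by (simp add: add_divide_distrib)
  then show ?case by (intro bexI[OF _ lag_zonal_span.add[OF *]] ballI)
next
  case (cmult f a)
  then obtain f' where f': "f' \<in> lag_zonal_span \<beta> n" "\<And>p. p \<in> double_cone \<Longrightarrow> (f p + f (fst p, - snd p)) / 2 = f' p"
    by blast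
  have "(a * f p + a * f (fst p, - snd p)) / 2 = a * f' p" if "p \<in> double_cone" for p
    unfolding f'(2)[OF that, symmetric] by (simp add: algebra_simps)
  then show ?case by (intro bexI[OF _ lag_zonal_span.cmult[OF f'(1)]] ballI)
qed

section \<open>Identification of the reproducing kernels\<close>

text \<open>Orthogonality is against all lower polynomials, so g is split: its odd part gives an odd
  integrand, and its even part agrees on the cone with an element of the span of degree m <
  n.\<close>

lemma cone_mean_mehler_kernel_poly:
  fixes g :: "(real ^ 'n) \<times> real \<Rightarrow> real"
  assumes \<beta>: "\<beta> \<ge> 0" and g: "g \<in> poly_deg_le m" and "m < n"
  shows "cone_mean \<beta> (\<lambda>p. mehler_kernel \<beta> n x p * g p) = 0"
proof -
  let ?ge = "\<lambda>p. (g p + g (fst p, - snd p)) / 2"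
  let ?go = "\<lambda>p. (g p - g (fst p, - snd p)) / 2"
  have gr: "real_polynomial_function (\<lambda>p. g (fst p, - snd p))"
    using real_polynomial_function_poly_deg_le[OF poly_deg_le_reflect[OF g]] .
  have gp: "real_polynomial_function g" using real_polynomial_function_poly_deg_le[OF g] .
  obtain f where f: "f \<in> lag_zonal_span \<beta> m" "\<And>p. p \<in> double_cone \<Longrightarrow> ?ge p = f p"
    using poly_deg_le_even_part[OF \<beta> g] by blast
  have "cone_mean \<beta> (\<lambda>p. mehler_kernel \<beta> n x p * g p) = cone_mean \<beta> (\<lambda>p. mehler_kernel \<beta> n x p * ?ge p + mehler_kernel \<beta> n x p * ?go p)"
    by (simp add: algebra_simps add_divide_distrib diff_divide_distrib)
  also have "\<dots> = cone_mean \<beta> (\<lambda>p. mehler_kernel \<beta> n x p * ?ge p) + cone_mean \<beta> (\<lambda>p. mehler_kernel \<beta> n x p * ?go p)"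
    by (intro cone_mean_add[OF _ _ \<beta>] real_polynomial_function.intros(3,4) real_polynomial_function_mehler_kernel
        real_polynomial_function_divide real_polynomial_function_diff gr gp)
  also have "cone_mean \<beta> (\<lambda>p. mehler_kernel \<beta> n x p * ?go p) = 0"
    by (rule cone_mean_odd) (simp add: mehler_kernel_def algebra_simps diff_divide_distrib)
  also have "cone_mean \<beta> (\<lambda>p. mehler_kernel \<beta> n x p * ?ge p) = cone_mean \<beta> (\<lambda>p. mehler_kernel \<beta> n x p * f p)"
    by (rule cone_mean_cong) (simp add: f(2))
  also have "\<dots> = 0" using lag_zonal_span_reproducing[OF \<beta> f(1)] \<open>m < n\<close> by blast
  finally show ?thesis by simp
qed

text \<open>f is the sum of its projections of degrees m \<le> n. Those with m < n vanish, because
  the kernel of degree m is itself a polynomial to which f is orthogonal.\<close>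

lemma cone_mean_mehler_kernel_orth_poly_even:
  fixes f :: "(real ^ 'n) \<times> real \<Rightarrow> real"
  assumes \<beta>: "\<beta> \<ge> 0" and f: "f \<in> orth_poly_even \<beta> n" and xt: "(x, t) \<in> double_cone"
  shows "cone_mean \<beta> (\<lambda>p. mehler_kernel \<beta> n x p * f p) = f (x, t)"
proof -
  obtain q where q: "f = (\<lambda>p. if p \<in> double_cone then q p else 0)" "q \<in> poly_deg_le n"
    "\<And>x t. q (x, - t) = q (x, t)" "\<And>m g. m < n \<Longrightarrow> g \<in> poly_deg_le m \<Longrightarrow> cone_inner \<beta> q g = 0"
    using f unfolding orth_poly_even_def by blast
  obtain h where h: "h \<in> lag_zonal_span \<beta> n" "\<And>p. p \<in> double_cone \<Longrightarrow> (q p + q (fst p, - snd p)) / 2 = h p"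
    using poly_deg_le_even_part[OF \<beta> q(2)] by blast
  have hq: "h p = q p" if "p \<in> double_cone" for p
    using h(2)[OF that] q(3)[of "fst p" "snd p"] by simp
  have eq: "cone_mean \<beta> (\<lambda>p. mehler_kernel \<beta> m x p * h p) = cone_mean \<beta> (\<lambda>p. mehler_kernel \<beta> m x p * q p)" for m
    by (rule cone_mean_cong) (simp add: hq)
  have low: "cone_mean \<beta> (\<lambda>p. mehler_kernel \<beta> m x p * q p) = 0" if "m < n" for m
    using q(4)[OF that poly_deg_le_mehler_kernel] by (simp add: cone_inner_eq_cone_mean mult.commute)
  have "f (x, t) = h (x, t)" using xt by (simp add: q(1) hq)
  also have "\<dots> = (\<Sum>m\<le>n. cone_mean \<beta> (\<lambda>p. mehler_kernel \<beta> m x p * h p))"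
    using lag_zonal_span_reproducing[OF \<beta> h(1)] by blast
  also have "\<dots> = (\<Sum>m\<in>{n}. cone_mean \<beta> (\<lambda>p. mehler_kernel \<beta> m x p * h p))"
    by (rule sum.mono_neutral_right) (auto simp: eq low)
  also have "\<dots> = cone_mean \<beta> (\<lambda>p. mehler_kernel \<beta> n x p * f p)"
    by (simp, rule cone_mean_cong) (simp add: hq q(1))
  finally show ?thesis by simp
qed

text \<open>For uniqueness, pair a candidate k with the kernel at p. Reproduction by the kernel
  gives k p, reproduction by k gives the kernel at (x, t), and the kernel is symmetric. Off the cone
  both functions are 0 by convention.\<close>

lemma repr_kernel_even_eq:
  fixes x y :: "real ^ 'n"
  assumes \<beta>: "\<beta> \<ge> 0" and xt: "(x, t) \<in> double_cone" and ys: "(y, s) \<in> double_cone"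
  shows "repr_kernel_even \<beta> n (x, t) (y, s) = mehler_kernel \<beta> n x (y, s)"
proof -
  define K where "K = (\<lambda>(x :: real ^ 'n, t :: real) p. if p \<in> double_cone then mehler_kernel \<beta> n x p else 0)"
  have K: "K z \<in> orth_poly_even \<beta> n" for z
  proof -
    have "cone_inner \<beta> (mehler_kernel \<beta> n (fst z)) g = 0" if "m < n" "g \<in> poly_deg_le m" for m g
      unfolding cone_inner_eq_cone_mean by (rule cone_mean_mehler_kernel_poly[OF \<beta> that(2,1)])
    moreover have "mehler_kernel \<beta> n (fst z) (u, - v) = mehler_kernel \<beta> n (fst z) (u, v)" for u v
      by (simp add: mehler_kernel_def)
    ultimately show ?thesis
      unfolding orth_poly_even_def mem_Collect_eq K_def
      by (intro exI[of _ "mehler_kernel \<beta> n (fst z)"]) (auto simp: poly_deg_le_mehler_kernel case_prod_beta)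
  qed
  have repr: "cone_inner \<beta> f (K z) = f z" if "f \<in> orth_poly_even \<beta> n" "z \<in> double_cone" for f z
  proof -
    obtain u v where z: "z = (u, v)" by (cases z)
    have "cone_inner \<beta> f (K z) = cone_mean \<beta> (\<lambda>p. mehler_kernel \<beta> n u p * f p)"
      unfolding cone_inner_eq_cone_mean by (rule cone_mean_cong) (simp add: K_def z)
    then show ?thesis using cone_mean_mehler_kernel_orth_poly_even[OF \<beta> that(1), of u v] that(2) z by simp
  qed
  have "repr_kernel_even \<beta> n (x, t) = K (x, t)"
    unfolding repr_kernel_even_def
  proof (rule the_equality)
    show "K (x, t) \<in> orth_poly_even \<beta> n \<and> (\<forall>f\<in>orth_poly_even \<beta> n. cone_inner \<beta> f (K (x, t)) = f (x, t))"
      using K repr xt by blast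
    fix k assume k: "k \<in> orth_poly_even \<beta> n \<and> (\<forall>f\<in>orth_poly_even \<beta> n. cone_inner \<beta> f k = f (x, t))"
    show "k = K (x, t)"
    proof
      fix p :: "(real ^ 'n) \<times> real"
      show "k p = K (x, t) p"
      proof (cases "p \<in> double_cone")
        case True
        obtain u v where p: "p = (u, v)" by (cases p)
        have "k p = cone_inner \<beta> k (K p)" using repr k True by simp
        also have "\<dots> = cone_inner \<beta> (K p) k" by (simp add: cone_inner_eq_cone_mean mult.commute)
        also have "\<dots> = K p (x, t)" using k K by blast
        also have "\<dots> = K (x, t) p"
          using True xt mehler_kernel_commute[of \<beta> n u x t v] by (simp add: K_def p)
        finally show ?thesis .
      next
        case False
        then show ?thesis using k by (auto simp: K_def orth_poly_even_def)
      qed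
    qed
  qed
  then show ?thesis using ys by (simp add: K_def)
qed

section \<open>The generating function\<close>

lemma has_sum_times_nat:
  fixes f g :: "nat \<Rightarrow> real"
  assumes f: "summable (\<lambda>n. \<bar>f n\<bar>)" and g: "summable (\<lambda>n. \<bar>g n\<bar>)"
  shows "((\<lambda>z. f (fst z) * g (snd z)) has_sum (suminf f * suminf g)) UNIV"
    and "(\<lambda>z. \<bar>f (fst z) * g (snd z)\<bar>) summable_on UNIV"
proof -
  have hs: "(h has_sum suminf h) UNIV" if "summable (\<lambda>n. \<bar>h n\<bar>)" for h :: "nat \<Rightarrow> real"
    using norm_summable_imp_has_sum[of h] that summable_rabs_cancel[OF that] by (simp add: summable_sums)
  have hs': "((\<lambda>n. \<bar>h n\<bar>) has_sum (\<Sum>n. \<bar>h n\<bar>)) UNIV" if "summable (\<lambda>n. \<bar>h n\<bar>)" for h :: "nat \<Rightarrow> real"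
    using that by (intro sums_nonneg_imp_has_sum summable_sums) auto
  have "(\<lambda>z. \<bar>f (fst z) * g (snd z)\<bar>) summable_on (SIGMA m:UNIV. UNIV)"
  proof (rule summable_on_SigmaI)
    show "((\<lambda>y. \<bar>f (fst (x, y)) * g (snd (x, y))\<bar>) has_sum (\<bar>f x\<bar> * (\<Sum>n. \<bar>g n\<bar>))) UNIV" for x
      using has_sum_cmult_right[OF hs'[OF g]] by (simp add: abs_mult)
    show "(\<lambda>x. \<bar>f x\<bar> * (\<Sum>n. \<bar>g n\<bar>)) summable_on UNIV"
      using has_sum_cmult_left[OF hs'[OF f]] by (auto simp: summable_on_def)
  qed auto
  then show abs: "(\<lambda>z. \<bar>f (fst z) * g (snd z)\<bar>) summable_on UNIV" by simp
  have "((\<lambda>z. f (fst z) * g (snd z)) has_sum (suminf f * suminf g)) (SIGMA m:UNIV. UNIV)"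
  proof (rule has_sum_SigmaI)
    show "((\<lambda>y. f (fst (x, y)) * g (snd (x, y))) has_sum (f x * suminf g)) UNIV" for x
      using has_sum_cmult_right[OF hs[OF g]] by simp
    show "((\<lambda>x. f x * suminf g) has_sum (suminf f * suminf g)) UNIV"
      by (rule has_sum_cmult_left[OF hs[OF f]])
    show "(\<lambda>z. f (fst z) * g (snd z)) summable_on (SIGMA m:UNIV. UNIV)"
      using abs_summable_summable[of "\<lambda>z. f (fst z) * g (snd z)" UNIV] abs by simp
  qed
  then show "((\<lambda>z. f (fst z) * g (snd z)) has_sum (suminf f * suminf g)) UNIV" by simp
qed

lemma pochhammer_has_sum:
  fixes a w :: real
  assumes a: "a > 0" and w: "0 \<le> w" "w < 1"
  shows "((\<lambda>q. pochhammer a q / fact q * w ^ q) has_sum (1 - w) powr (- a)) UNIV"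
proof (rule sums_nonneg_imp_has_sum)
  have "(\<lambda>n. ((- a) gchoose n) * (- w) ^ n) sums (1 + (- w)) powr (- a)"
    using w by (intro gen_binomial_real) auto
  moreover have "((- a) gchoose n) * (- w) ^ n = pochhammer a n / fact n * w ^ n" for n
  proof -
    have "(-1 :: real) ^ n * (-1) ^ n = 1" by (simp flip: power_mult_distrib)
    moreover have "((- a) gchoose n) * (- w) ^ n = ((-1) ^ n * (-1) ^ n) * (pochhammer a n / fact n * w ^ n)"
      unfolding gbinomial_pochhammer power_minus[of w n] by simp
    ultimately show ?thesis by simp
  qed
  ultimately show "(\<lambda>q. pochhammer a q / fact q * w ^ q) sums (1 - w) powr (- a)" by simp
  show "pochhammer a n / fact n * w ^ n \<ge> 0" for n
    using pochhammer_pos[OF a, of n] w by simp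
qed

text \<open>Both sides regroup the absolutely convergent triple series over
  \<open>p\<close> (exponential), \<open>k\<close> (\<open>cone_coeff\<close>) and \<open>q\<close> (powers of \<open>1 / (1 - r\<^sup>2)\<close>), grouped by
  \<open>n = 2 p + 2 q + k\<close>.\<close>
lemma mehler_coeff_sums:
  fixes r :: real
  assumes \<delta>: "\<delta> > 0" and \<beta>: "\<beta> \<ge> 0" and r: "0 \<le> r" "r < 1"
    and sm: "\<And>R. summable (\<lambda>k. \<bar>R ^ k * cone_coeff \<delta> \<beta> k (X * Y) c\<bar>)"
  shows "(\<lambda>n. mehler_coeff \<delta> (\<beta> + \<delta>) n X Y c * r ^ n) sums
    ((1 - r\<^sup>2) powr (- (\<beta> + \<delta>)) * exp (- (X + Y) * (r\<^sup>2 / (1 - r\<^sup>2))) *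
     (\<Sum>k. (2 * r / (1 - r\<^sup>2)) ^ k * cone_coeff \<delta> \<beta> k (X * Y) c))"
proof -
  define w where "w = r\<^sup>2"
  have w: "0 \<le> w" "w < 1" using r by (auto simp: w_def power_less_one_iff abs_square_less_1)
  define \<alpha> where "\<alpha> = \<beta> + \<delta>"
  have \<alpha>: "\<alpha> > 0" using \<beta> \<delta> by (simp add: \<alpha>_def)
  define f where "f = (\<lambda>p. (- (X + Y) * (w / (1 - w))) ^ p / fact p)"
  define g where "g = (\<lambda>k. (2 * r / (1 - w)) ^ k * cone_coeff \<delta> \<beta> k (X * Y) c)"
  define S where "S = suminf f * suminf g * (1 - w) powr (- \<alpha>)"
  define T where "T = (\<lambda>p k q. (- (X + Y)) ^ p / fact p * (2 ^ k * cone_coeff \<delta> \<beta> k (X * Y) c) *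
     (pochhammer (\<alpha> + real (p + k)) q / fact q) * r ^ (2 * p + 2 * q + k))"
  have fs: "summable (\<lambda>n. \<bar>f n\<bar>)"
    using summable_norm_exp[of "- (X + Y) * (w / (1 - w))"] unfolding f_def by (simp add: abs_mult field_simps)
  have gs: "summable (\<lambda>n. \<bar>g n\<bar>)" unfolding g_def by (rule sm)
  have sf: "suminf f = exp (- (X + Y) * (w / (1 - w)))"
    unfolding exp_def f_def by (simp add: divideR_right scaleR_conv_of_real field_simps)
  \<comment> \<open>The binomial series in q sums to (1 - w)^(-(\<alpha> + p + k)); its factors (1 -
    w)^(-p) and (1 - w)^(-k) are the denominators built into f and g.\<close>
  have q: "((\<lambda>q. T p k q) has_sum (f p * g k * (1 - w) powr (- \<alpha>))) UNIV" for p k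
  proof -
    define A where "A = (- (X + Y)) ^ p / fact p * (2 ^ k * cone_coeff \<delta> \<beta> k (X * Y) c) * w ^ p * r ^ k"
    have "((\<lambda>q. A * (pochhammer (\<alpha> + real (p + k)) q / fact q * w ^ q)) has_sum (A * (1 - w) powr (- (\<alpha> + real (p + k))))) UNIV"
      using \<alpha> w by (intro has_sum_cmult_right pochhammer_has_sum) auto
    moreover have "A * (pochhammer (\<alpha> + real (p + k)) q / fact q * w ^ q) = T p k q" for q
    proof -
      have rp: "r ^ (2 * p + 2 * q + k) = w ^ p * w ^ q * r ^ k"
        unfolding w_def by (simp only: power_add power_mult)
      show ?thesis unfolding A_def T_def rp by (simp add: mult_ac)
    qed
    moreover have "A * (1 - w) powr (- (\<alpha> + real (p + k))) = f p * g k * (1 - w) powr (- \<alpha>)"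
    proof -
      have "(1 - w) powr (- (\<alpha> + real (p + k))) = (1 - w) powr (- \<alpha>) / (1 - w) ^ (p + k)"
      proof -
        have "- (\<alpha> + real (p + k)) = - \<alpha> - real (p + k)" by simp
        moreover have "(1 - w) powr real (p + k) = (1 - w) ^ (p + k)" using w by (intro powr_realpow) simp
        ultimately show ?thesis by (simp only: powr_diff)
      qed
      then show ?thesis
        unfolding A_def f_def g_def by (simp add: power_add power_divide power_mult_distrib mult_ac)
    qed
    ultimately show ?thesis by simp
  qed
  \<comment> \<open>For fixed p and k all terms have the sign of the same constant, so the sum of
    absolute values is the absolute value of the sum.\<close>
  have qa: "((\<lambda>q. \<bar>T p k q\<bar>) has_sum \<bar>f p * g k * (1 - w) powr (- \<alpha>)\<bar>) UNIV" for p k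
  proof -
    define A where "A = (- (X + Y)) ^ p / fact p * (2 ^ k * cone_coeff \<delta> \<beta> k (X * Y) c)"
    have nn: "pochhammer (\<alpha> + real (p + k)) q / fact q * r ^ (2 * p + 2 * q + k) \<ge> 0" for q
      using \<alpha> r pochhammer_pos[of "\<alpha> + real (p + k)" q] by simp
    have T: "T p k q = A * (pochhammer (\<alpha> + real (p + k)) q / fact q * r ^ (2 * p + 2 * q + k))" for q
      unfolding T_def A_def by simp
    show ?thesis
    proof (cases "A \<ge> 0")
      case True
      then have "\<bar>T p k q\<bar> = T p k q" for q unfolding T by (intro abs_of_nonneg mult_nonneg_nonneg nn)
      moreover from this have "f p * g k * (1 - w) powr (- \<alpha>) \<ge> 0"
        using q[of p k] by (intro has_sum_nonneg[OF q[of p k]]) (metis abs_ge_zero)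
      ultimately show ?thesis using q[of p k] by simp
    next
      case False
      then have T': "\<bar>T p k q\<bar> = - T p k q" for q unfolding T by (intro abs_of_nonpos mult_nonpos_nonneg nn) simp
      have m: "((\<lambda>q. - T p k q) has_sum (- (f p * g k * (1 - w) powr (- \<alpha>)))) UNIV"
        using q[of p k] by (simp add: has_sum_uminus)
      have "- (f p * g k * (1 - w) powr (- \<alpha>)) \<ge> 0"
        by (rule has_sum_nonneg[OF m]) (metis T' abs_ge_zero)
      then show ?thesis using m by (simp add: T')
    qed
  qed
  define F where "F = (\<lambda>((p, k), q). T p k q)"
  have Fa: "(\<lambda>z. \<bar>F z\<bar>) summable_on (SIGMA z:UNIV. UNIV)"
  proof (rule summable_on_SigmaI)
    show "((\<lambda>y. \<bar>F (x, y)\<bar>) has_sum \<bar>f (fst x) * g (snd x)\<bar> * (1 - w) powr (- \<alpha>)) UNIV" for x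
      using qa[of "fst x" "snd x"] by (simp add: F_def case_prod_beta abs_mult)
    show "(\<lambda>x. \<bar>f (fst x) * g (snd x)\<bar> * (1 - w) powr (- \<alpha>)) summable_on UNIV"
      by (rule summable_on_cmult_left[OF has_sum_times_nat(2)[OF fs gs]])
  qed auto
  have FS: "(F has_sum S) (SIGMA z:UNIV. UNIV)"
  proof (rule has_sum_SigmaI)
    show "((\<lambda>y. F (x, y)) has_sum (f (fst x) * g (snd x) * (1 - w) powr (- \<alpha>))) UNIV" for x
      using q[of "fst x" "snd x"] by (simp add: F_def case_prod_beta)
    show "((\<lambda>x. f (fst x) * g (snd x) * (1 - w) powr (- \<alpha>)) has_sum S) UNIV"
      unfolding S_def by (rule has_sum_cmult_left[OF has_sum_times_nat(1)[OF fs gs]])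
    show "F summable_on (SIGMA z:UNIV. UNIV)"
      by (rule abs_summable_summable) (use Fa in simp)
  qed
  define B where "B = (\<lambda>n. {(m, p). m \<le> n div 2 \<and> p \<le> (m :: nat)})"
  define t where "t = (\<lambda>n m p. T p (n - 2 * m) (m - p))"
  \<comment> \<open>Here m = p + q, so that k = n - 2m and q = m - p, the index pattern of
    \<open>mehler_coeff_eq\<close>.\<close>
  have "bij_betw (\<lambda>(n, m, p). ((p, n - 2 * m), m - p)) (SIGMA n:UNIV. B n) (SIGMA z:UNIV. UNIV)"
    by (rule bij_betwI[where g="\<lambda>((p, k), q). (2 * p + 2 * q + k, p + q, p)"]) (auto simp: B_def)
  then have "((\<lambda>z. F ((\<lambda>(n, m, p). ((p, n - 2 * m), m - p)) z)) has_sum S) (SIGMA n:UNIV. B n)"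
    using FS by (simp add: has_sum_reindex_bij_betw)
  then have ts: "((\<lambda>(n, m, p). t n m p) has_sum S) (SIGMA n:UNIV. B n)"
    by (simp add: F_def t_def case_prod_unfold)
  have fB: "finite (B n)" for n
    by (rule finite_subset[of _ "{..n} \<times> {..n}"]) (auto simp: B_def)
  have "((\<lambda>n. \<Sum>(m, p)\<in>B n. t n m p) has_sum S) UNIV"
  proof (rule has_sum_SigmaD[OF ts])
    show "((\<lambda>y. case (n, y) of (n, m, p) \<Rightarrow> t n m p) has_sum (\<Sum>(m, p)\<in>B n. t n m p)) (B n)" for n
      using has_sum_finite[OF fB, of "\<lambda>(m, p). t n m p" n] by simp
  qed
  moreover have "(\<Sum>(m, p)\<in>B n. t n m p) = mehler_coeff \<delta> (\<beta> + \<delta>) n X Y c * r ^ n" for n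
  proof -
    have "(\<Sum>(m, p)\<in>B n. t n m p) = (\<Sum>m\<le>n div 2. \<Sum>p\<le>m. t n m p)"
    proof -
      have "B n = (SIGMA m:{..n div 2}. {..m})" by (auto simp: B_def)
      then show ?thesis by (simp add: sum.Sigma)
    qed
    also have "\<dots> = mehler_coeff \<delta> (\<beta> + \<delta>) n X Y c * r ^ n"
      unfolding mehler_coeff_eq[OF \<delta> \<beta>] sum_distrib_right
    proof (intro sum.cong refl)
      fix m p assume "m \<in> {..n div 2}" "p \<in> {..m}"
      then have "2 * p + 2 * (m - p) + (n - 2 * m) = n" by auto
      then show "t n m p = (- (X + Y)) ^ p / fact p * (2 ^ (n - 2 * m) * cone_coeff \<delta> \<beta> (n - 2 * m) (X * Y) c) *
        (pochhammer (\<beta> + \<delta> + real (p + (n - 2 * m))) (m - p) / fact (m - p)) * r ^ n"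
        unfolding t_def T_def \<alpha>_def by simp
    qed
    finally show ?thesis .
  qed
  ultimately have "((\<lambda>n. mehler_coeff \<delta> (\<beta> + \<delta>) n X Y c * r ^ n) has_sum S) UNIV" by simp
  then have "(\<lambda>n. mehler_coeff \<delta> (\<beta> + \<delta>) n X Y c * r ^ n) sums S" by (rule has_sum_imp_sums)
  then show ?thesis unfolding S_def sf unfolding g_def \<alpha>_def w_def by (simp add: mult_ac)
qed

section \<open>Moments of the Jacobi and Gegenbauer weights\<close>

lemma Beta_has_bochner_integral:
  assumes a: "a > 0" and b: "b > (0::real)"
  shows "has_bochner_integral lborel (\<lambda>z. indicator {-1..1} z * (((1 - z) / 2) powr (a - 1) * ((1 + z) / 2) powr (b - 1))) (2 * Beta a b)"
proof -
  let ?f = "\<lambda>z::real. indicator {-1..1} z * (((1 - z) / 2) powr (a - 1) * ((1 + z) / 2) powr (b - 1)) :: real"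
  have si: "set_integrable lborel {0..1} (\<lambda>t. t powr (a - 1) * (1 - t) powr (b - 1))"
    using integrable_Beta[OF a b] .
  then have "(LINT t:{0..1}|lborel. t powr (a - 1) * (1 - t) powr (b - 1)) = Beta a b"
    using set_borel_integral_eq_integral(2)[OF si] has_integral_Beta_real[OF a b] by (simp add: integral_unique)
  then have "has_bochner_integral lborel (\<lambda>t. indicator {0..1} t *\<^sub>R (t powr (a - 1) * (1 - t) powr (b - 1))) (Beta a b)"
    using si unfolding set_integrable_def set_lebesgue_integral_def by (simp add: has_bochner_integral_iff)
  moreover have "indicator {0..1} t *\<^sub>R (t powr (a - 1) * (1 - t) powr (b - 1)) = ?f (1 + (-2) * t)" for t
  proof -
    have "(1 - (1 + (-2) * t)) / 2 = t" "(1 + (1 + (-2) * t)) / 2 = 1 - t" by (simp_all add: field_simps)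
    then show ?thesis by (simp only:) (auto simp: indicator_def)
  qed
  ultimately have "has_bochner_integral lborel (\<lambda>t. ?f (1 + (-2) * t)) (Beta a b)" by (simp only:)
  then show ?thesis
    using lborel_has_bochner_integral_real_affine_iff[of "-2" ?f "2 * Beta a b" 1] by simp
qed

text \<open>The power of 2 makes this a probability density on [-1, 1];
  \<open>gegenbauer_density\<close> is one by its constant alone.\<close>

definition jacobi_density :: "real \<Rightarrow> real \<Rightarrow> real \<Rightarrow> real" where
  "jacobi_density \<delta> \<beta> z = indicator {-1..1} z * (jacobi_const (\<delta> - 1) (\<beta> - 1) * (1 - z) powr (\<delta> - 1) * (1 + z) powr (\<beta> - 1) / 2 powr (\<beta> + \<delta> - 1))"

definition gegenbauer_density :: "real \<Rightarrow> real \<Rightarrow> real" where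
  "gegenbauer_density \<beta> z = indicator {-1..1} z * (gegenbauer_const \<beta> * (1 - z\<^sup>2) powr (\<beta> - 1 / 2))"

lemma not_nonpos_Ints_pos: "(x::real) > 0 \<Longrightarrow> x \<notin> \<int>\<^sub>\<le>\<^sub>0"
  by (auto elim!: nonpos_Ints_cases)

lemma power_times_powr:
  fixes x :: real
  assumes "x \<ge> 0"
  shows "x ^ i * x powr a = x powr (real i + a)"
  using assms by (cases "x = 0") (auto simp: powr_add powr_realpow power_0_left)

lemma jacobi_density_moment:
  assumes \<delta>: "\<delta> > 0" and \<beta>: "\<beta> > 0"
  shows "has_bochner_integral lborel (\<lambda>z. ((1 - z) / 2) ^ i * ((1 + z) / 2) ^ l * jacobi_density \<delta> \<beta> z)
    (pochhammer \<delta> i * pochhammer \<beta> l / pochhammer (\<beta> + \<delta>) (i + l))"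
proof -
  let ?J = "jacobi_const (\<delta> - 1) (\<beta> - 1)"
  have pos: "real i + \<delta> > 0" "real l + \<beta> > 0" using \<delta> \<beta> by auto
  have G: "Gamma \<delta> > 0" "Gamma \<beta> > 0" "Gamma (\<beta> + \<delta>) > 0" using \<delta> \<beta> by (auto intro!: Gamma_real_pos)
  have gi: "Gamma (x + real n) = pochhammer x n * Gamma x" if "x > 0" for x n
    using pochhammer_Gamma[OF not_nonpos_Ints_pos[OF that], of n] Gamma_real_pos[OF that] by simp
  have "has_bochner_integral lborel (\<lambda>z. ?J / 2 * (indicator {-1..1} z * (((1 - z) / 2) powr (real i + \<delta> - 1) * ((1 + z) / 2) powr (real l + \<beta> - 1)))) (?J / 2 * (2 * Beta (real i + \<delta>) (real l + \<beta>)))"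
    by (intro has_bochner_integral_mult_right Beta_has_bochner_integral pos)
  moreover have "?J / 2 * (indicator {-1..1} z * (((1 - z) / 2) powr (real i + \<delta> - 1) * ((1 + z) / 2) powr (real l + \<beta> - 1)))
     = ((1 - z) / 2) ^ i * ((1 + z) / 2) ^ l * jacobi_density \<delta> \<beta> z" for z
  proof (cases "z \<in> {-1..1}")
    case True
    have 1: "((1 - z) / 2) powr (real i + \<delta> - 1) = ((1 - z) / 2) ^ i * ((1 - z) powr (\<delta> - 1) / 2 powr (\<delta> - 1))"
      using True power_times_powr[of "(1 - z) / 2" i "\<delta> - 1"] by (simp add: powr_divide add_diff_eq)
    have 2: "((1 + z) / 2) powr (real l + \<beta> - 1) = ((1 + z) / 2) ^ l * ((1 + z) powr (\<beta> - 1) / 2 powr (\<beta> - 1))"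
      using True power_times_powr[of "(1 + z) / 2" l "\<beta> - 1"] by (simp add: powr_divide add_diff_eq)
    have 3: "2 powr (\<beta> + \<delta> - 1) = 2 * (2 powr (\<delta> - 1) * (2::real) powr (\<beta> - 1))"
    proof -
      have "\<beta> + \<delta> - 1 = 1 + ((\<delta> - 1) + (\<beta> - 1))" by simp
      then show ?thesis by (simp only: powr_add) simp
    qed
    show ?thesis unfolding 1 2 jacobi_density_def 3 using True by (simp add: mult_ac)
  qed (simp add: jacobi_density_def)
  moreover have "?J / 2 * (2 * Beta (real i + \<delta>) (real l + \<beta>)) = pochhammer \<delta> i * pochhammer \<beta> l / pochhammer (\<beta> + \<delta>) (i + l)"
  proof -
    have 1: "Gamma (real i + \<delta>) = pochhammer \<delta> i * Gamma \<delta>" using gi[OF \<delta>, of i] by (simp add: add.commute)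
    have 2: "Gamma (real l + \<beta>) = pochhammer \<beta> l * Gamma \<beta>" using gi[OF \<beta>, of l] by (simp add: add.commute)
    have "\<beta> + \<delta> > 0" using \<beta> \<delta> by simp
    moreover have "real i + \<delta> + (real l + \<beta>) = \<beta> + \<delta> + real (i + l)" by simp
    ultimately have 3: "Gamma (real i + \<delta> + (real l + \<beta>)) = pochhammer (\<beta> + \<delta>) (i + l) * Gamma (\<beta> + \<delta>)"
      using gi[of "\<beta> + \<delta>" "i + l"] by (simp only:)
    have 4: "\<delta> - 1 + (\<beta> - 1) + 2 = \<beta> + \<delta>" "\<delta> - 1 + 1 = \<delta>" "\<beta> - 1 + 1 = \<beta>" by auto
    show ?thesis unfolding Beta_def jacobi_const_def 1 2 3 4 using G by simp
  qed
  ultimately show ?thesis by simp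
qed

lemma gegenbauer_density_moment:
  assumes \<beta>: "\<beta> > 0"
  shows "has_bochner_integral lborel (\<lambda>z. z ^ l * gegenbauer_density \<beta> z)
    (if even l then pochhammer (1 / 2) (l div 2) / pochhammer (\<beta> + 1) (l div 2) else 0)"
proof -
  have ev: "has_bochner_integral lborel (\<lambda>z. z ^ (2 * j) * gegenbauer_density \<beta> z) (pochhammer (1 / 2) j / pochhammer (\<beta> + 1) j)" for j
  proof -
    \<comment> \<open>The substitution u = z^2 turns the even moment into the Beta integral with
      parameters j + 1/2 and \<beta> + 1/2; the Jacobian lowers the exponent of u by 1/2.\<close>
    define a where "a = real j + 1 / 2"
    define b where "b = \<beta> + 1 / 2"
    have ab: "a > 0" "b > 0" using \<beta> by (auto simp: a_def b_def)
    define f where "f = (\<lambda>u::real. indicator {0..1} u * (u powr (a - 1) * (1 - u) powr (b - 1)))"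
    have si: "set_integrable lborel {0..1} (\<lambda>t. t powr (a - 1) * (1 - t) powr (b - 1))"
      using integrable_Beta[OF ab] .
    have fm: "f \<in> borel_measurable lborel" unfolding f_def by measurable
    have fi: "integrable lborel f"
      using si unfolding set_integrable_def f_def by simp
    then have fl: "integrable lebesgue f" unfolding integrable_completion[OF fm] .
    then have fa: "f absolutely_integrable_on {0<..}"
      unfolding set_integrable_def by (rule integrable_mult_indicator[rotated]) simp
    have "(LINT t:{0..1}|lborel. t powr (a - 1) * (1 - t) powr (b - 1)) = Beta a b"
      using set_borel_integral_eq_integral(2)[OF si] has_integral_Beta_real[OF ab] by (simp add: integral_unique)
    then have fv: "(LINT u|lborel. f u) = Beta a b"
      unfolding set_lebesgue_integral_def f_def by simp
    have "integral {0<..} f = (LINT u:{0<..}|lebesgue. f u)"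
      using set_lebesgue_integral_eq_integral(2)[OF fa] by simp
    also have "\<dots> = (LINT u|lebesgue. f u)"
      unfolding set_lebesgue_integral_def
      by (intro Bochner_Integration.integral_cong refl) (auto simp: f_def indicator_def)
    also have "\<dots> = Beta a b" unfolding integral_completion[OF fm] fv ..
    finally have fv': "integral {0<..} f = Beta a b" .
    have "has_bochner_integral lborel (\<lambda>z. indicator {-1..1} z * (z ^ (2 * j) * (1 - z\<^sup>2) powr (\<beta> - 1 / 2))) (Beta a b)"
    proof (rule integral_square_substitution[OF fa fv'])
      fix t :: real assume t: "t \<noteq> 0"
      have I: "indicator {0..1} (t\<^sup>2) = (indicator {-1..1} t :: real)"
        by (auto simp: indicator_def abs_square_le_1 abs_le_iff)
      have M: "\<bar>t\<bar> * (t\<^sup>2) powr (a - 1) = t ^ (2 * j)"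
      proof -
        have "\<bar>t\<bar> * (t\<^sup>2) powr (a - 1) = \<bar>t\<bar> powr 1 * \<bar>t\<bar> powr (2 * (a - 1))"
          using t powr_powr[of "\<bar>t\<bar>" 2 "a - 1"] by simp
        also have "\<dots> = \<bar>t\<bar> powr (real (2 * j))"
          unfolding powr_add[symmetric] by (simp add: a_def algebra_simps)
        also have "\<dots> = \<bar>t\<bar> ^ (2 * j)" using t by (intro powr_realpow) auto
        finally show ?thesis by (simp add: power_even_abs)
      qed
      have b: "b - 1 = \<beta> - 1 / 2" by (simp add: b_def)
      have "\<bar>t\<bar> * f (t\<^sup>2) = indicator {-1..1} t * ((\<bar>t\<bar> * (t\<^sup>2) powr (a - 1)) * (1 - t\<^sup>2) powr (b - 1))"
        unfolding f_def I by (simp only: mult_ac)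
      then show "indicator {-1..1} t * (t ^ (2 * j) * (1 - t\<^sup>2) powr (\<beta> - 1 / 2)) = \<bar>t\<bar> * f (t\<^sup>2)"
        unfolding M b by (rule sym)
    qed measurable
    then have "has_bochner_integral lborel (\<lambda>z. gegenbauer_const \<beta> * (indicator {-1..1} z * (z ^ (2 * j) * (1 - z\<^sup>2) powr (\<beta> - 1 / 2)))) (gegenbauer_const \<beta> * Beta a b)"
      by (intro has_bochner_integral_mult_right)
    moreover have "gegenbauer_const \<beta> * Beta a b = pochhammer (1 / 2) j / pochhammer (\<beta> + 1) j"
    proof -
      have gi: "Gamma (x + real n) = pochhammer x n * Gamma x" if "x > 0" for x n
        using pochhammer_Gamma[OF not_nonpos_Ints_pos[OF that], of n] Gamma_real_pos[OF that] by simp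
      have 1: "Gamma a = pochhammer (1 / 2) j * Gamma (1 / 2)" using gi[of "1 / 2" j] by (simp add: a_def add.commute)
      have "a + b = \<beta> + 1 + real j" by (simp add: a_def b_def)
      then have 2: "Gamma (a + b) = pochhammer (\<beta> + 1) j * Gamma (\<beta> + 1)" using gi[of "\<beta> + 1" j] \<beta> by simp
      have "Gamma (1 / 2 :: real) > 0" "Gamma b > 0" "Gamma (\<beta> + 1) > 0" using \<beta> ab by (auto intro!: Gamma_real_pos)
      then show ?thesis unfolding gegenbauer_const_def Beta_def 1 2 b_def[symmetric] by (simp add: Gamma_one_half_real)
    qed
    ultimately show ?thesis unfolding gegenbauer_density_def by (simp add: mult_ac)
  qed
  show ?thesis
  proof (cases "even l")
    case True
    then obtain j where "l = 2 * j" by (elim evenE)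
    then show ?thesis using ev[of j] by simp
  next
    case False
    let ?h = "\<lambda>z. z ^ l * gegenbauer_density \<beta> z"
    have i0: "integrable lborel (gegenbauer_density \<beta>)" using ev[of 0] by (simp add: has_bochner_integral_iff)
    have hm: "?h \<in> borel_measurable lborel" unfolding gegenbauer_density_def by measurable
    have "norm (?h z) \<le> norm (gegenbauer_density \<beta> z)" for z
    proof (cases "z \<in> {-1..1}")
      case True
      then have "\<bar>z\<bar> ^ l \<le> 1" by (intro power_le_one) auto
      then show ?thesis by (simp add: abs_mult power_abs mult_left_le_one_le)
    qed (simp add: gegenbauer_density_def)
    then have ih: "integrable lborel ?h"
      by (intro Bochner_Integration.integrable_bound[OF i0 hm]) auto
    have "(LINT z|lborel. ?h z) = (LINT z|lborel. ?h (0 + (-1) * z))"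
      using lborel_integral_real_affine[of "-1" ?h 0] by simp
    also have "\<dots> = (LINT z|lborel. - ?h z)"
      using False by (intro Bochner_Integration.integral_cong refl) (auto simp: gegenbauer_density_def indicator_def)
    also have "\<dots> = - (LINT z|lborel. ?h z)" by simp
    finally have "(LINT z|lborel. ?h z) = 0" by simp
    then show ?thesis using False ih by (simp add: has_bochner_integral_iff)
  qed
qed

lemma has_bochner_integral_lborel_times:
  fixes f g :: "real \<Rightarrow> real"
  assumes f: "has_bochner_integral lborel f A" and g: "has_bochner_integral lborel g B"
  shows "has_bochner_integral lborel (\<lambda>z. f (fst z) * g (snd z)) (A * B)"
proof -
  have [measurable]: "f \<in> borel_measurable borel" "g \<in> borel_measurable borel"
    using f g by (auto dest: borel_measurable_has_bochner_integral)
  have i: "integrable lborel f" "integrable lborel g" and v: "integral\<^sup>L lborel f = A" "integral\<^sup>L lborel g = B"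
    using f g by (auto simp: has_bochner_integral_iff)
  have int: "integrable (lborel \<Otimes>\<^sub>M lborel) (\<lambda>z. f (fst z) * g (snd z))"
  proof (rule lborel_pair.Fubini_integrable)
    show "integrable lborel (\<lambda>x. LINT y|lborel. norm (f (fst (x, y)) * g (snd (x, y))))"
      using i by (simp add: abs_mult)
    show "AE x in lborel. integrable lborel (\<lambda>y. f (fst (x, y)) * g (snd (x, y)))"
      using i by simp
  qed measurable
  have "(LINT z|(lborel \<Otimes>\<^sub>M lborel). f (fst z) * g (snd z)) = A * B"
    using lborel_pair.integral_fst'[OF int] v by simp
  then show ?thesis using int unfolding lborel_prod by (simp add: has_bochner_integral_iff)
qed

section \<open>The double integral as a power series\<close>

text \<open>By the binomial theorem the integral becomes a sum of products of Jacobi and Gegenbauer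
  moments, and odd powers of \<open>snd z\<close> integrate to 0. In the even terms, duplication for
  (2j)! cancels the factor (1/2)_j of the Gegenbauer moment and leaves
  \<open>rothe_coeff\<close>.\<close>

lemma cone_coeff_has_bochner_integral:
  fixes T c :: real
  assumes \<delta>: "\<delta> > 0" and \<beta>: "\<beta> > 0"
  shows "has_bochner_integral lborel (\<lambda>z. ((1 - fst z) / 2 * c + (1 + fst z) / 2 * snd z * T) ^ k *
      (jacobi_density \<delta> \<beta> (fst z) * gegenbauer_density \<beta> (snd z))) (fact k * cone_coeff \<delta> \<beta> k (T\<^sup>2) c)"
proof -
  define m where "m = (\<lambda>l. if even l then pochhammer (1 / 2) (l div 2) / pochhammer (\<beta> + 1) (l div 2) else 0 :: real)"
  define d where "d = (\<lambda>l. real (k choose l) * c ^ (k - l) * T ^ l * (pochhammer \<delta> (k - l) * pochhammer \<beta> l / pochhammer (\<beta> + \<delta>) (k - l + l) * m l))"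
  have "has_bochner_integral lborel (\<lambda>z. \<Sum>l\<le>k. real (k choose l) * c ^ (k - l) * T ^ l *
      ((((1 - fst z) / 2) ^ (k - l) * ((1 + fst z) / 2) ^ l * jacobi_density \<delta> \<beta> (fst z)) * (snd z ^ l * gegenbauer_density \<beta> (snd z)))) (\<Sum>l\<le>k. d l)"
    unfolding d_def m_def
    by (intro has_bochner_integral_sum has_bochner_integral_mult_right has_bochner_integral_lborel_times
        jacobi_density_moment[OF \<delta> \<beta>] gegenbauer_density_moment[OF \<beta>])
  moreover have "(\<Sum>l\<le>k. real (k choose l) * c ^ (k - l) * T ^ l *
      ((((1 - fst z) / 2) ^ (k - l) * ((1 + fst z) / 2) ^ l * jacobi_density \<delta> \<beta> (fst z)) * (snd z ^ l * gegenbauer_density \<beta> (snd z))))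
    = ((1 - fst z) / 2 * c + (1 + fst z) / 2 * snd z * T) ^ k * (jacobi_density \<delta> \<beta> (fst z) * gegenbauer_density \<beta> (snd z))" for z
    unfolding add.commute[of "(1 - fst z) / 2 * c"] binomial_ring sum_distrib_right
    by (intro sum.cong refl) (simp only: power_mult_distrib mult_ac)
  moreover have "(\<Sum>l\<le>k. d l) = fact k * cone_coeff \<delta> \<beta> k (T\<^sup>2) c"
  proof -
    have "(\<Sum>l\<le>k. d l) = (\<Sum>l\<in>(\<lambda>j. 2 * j) ` {..k div 2}. d l)"
    proof (rule sum.mono_neutral_right)
      show "\<forall>l\<in>{..k} - (\<lambda>j. 2 * j) ` {..k div 2}. d l = 0"
      proof
        fix l assume l: "l \<in> {..k} - (\<lambda>j. 2 * j) ` {..k div 2}"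
        have "odd l"
        proof
          assume "even l"
          then obtain j where "l = 2 * j" by (elim evenE)
          then show False using l by auto
        qed
        then show "d l = 0" by (simp add: d_def m_def)
      qed
    qed auto
    also have "\<dots> = (\<Sum>j\<le>k div 2. d (2 * j))" by (subst sum.reindex) (auto simp: inj_on_def)
    also have "\<dots> = (\<Sum>j\<le>k div 2. fact k * (pochhammer \<delta> (k - 2 * j) / fact (k - 2 * j) * rothe_coeff \<beta> j * (T\<^sup>2 / 4) ^ j * c ^ (k - 2 * j) / pochhammer (\<beta> + \<delta>) k))"
    proof (intro sum.cong refl)
      fix j assume "j \<in> {..k div 2}"
      then have j: "2 * j \<le> k" by auto
      have 1: "real (k choose (2 * j)) = fact k / ((4 ^ j * pochhammer (1 / 2) j * fact j) * fact (k - 2 * j))"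
        using j fact_double[of j, where 'a=real] by (simp add: binomial_fact power_mult)
      have 2: "T ^ (2 * j) = 4 ^ j * (T\<^sup>2 / 4) ^ j" by (simp add: power_mult power_divide)
      have 3: "rothe_coeff \<beta> j = pochhammer \<beta> (2 * j) / (pochhammer (\<beta> + 1) j * fact j)"
        using \<beta> by (intro rothe_coeff_eq) simp
      have "pochhammer (1 / 2 :: real) j > 0" by (intro pochhammer_pos) simp
      then show "d (2 * j) = fact k * (pochhammer \<delta> (k - 2 * j) / fact (k - 2 * j) * rothe_coeff \<beta> j * (T\<^sup>2 / 4) ^ j * c ^ (k - 2 * j) / pochhammer (\<beta> + \<delta>) k)"
        unfolding d_def m_def 1 2 3 using j by (simp add: mult_ac)
    qed
    also have "\<dots> = fact k * cone_coeff \<delta> \<beta> k (T\<^sup>2) c"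
      unfolding cone_coeff_def sum_divide_distrib sum_distrib_left ..
    finally show ?thesis .
  qed
  ultimately show ?thesis by simp
qed

lemma densities_nonneg:
  assumes "\<delta> > 0" "\<beta> > 0"
  shows "jacobi_density \<delta> \<beta> u \<ge> 0" "gegenbauer_density \<beta> v \<ge> 0"
proof -
  have "Gamma \<delta> > 0" "Gamma \<beta> > 0" "Gamma (\<delta> + \<beta>) > 0" "Gamma (\<beta> + 1) > 0" "Gamma (\<beta> + 1 / 2) > 0" "Gamma (1 / 2 :: real) > 0"
    using assms by (auto intro!: Gamma_real_pos)
  then show "jacobi_density \<delta> \<beta> u \<ge> 0" "gegenbauer_density \<beta> v \<ge> 0"
    by (auto simp: jacobi_density_def gegenbauer_density_def jacobi_const_def gegenbauer_const_def)
qed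

text \<open>A convex combination of c and v T, both of absolute value at most T.\<close>

lemma abs_eta_le:
  fixes c T :: real
  assumes c: "\<bar>c\<bar> \<le> T" and u: "u \<in> {-1..1}" and v: "v \<in> {-1..1}"
  shows "\<bar>(1 - u) / 2 * c + (1 + u) / 2 * v * T\<bar> \<le> T"
proof -
  have T: "T \<ge> 0" using c by linarith
  have "\<bar>(1 - u) / 2 * c\<bar> \<le> (1 - u) / 2 * T"
    using c u by (simp add: abs_mult mult_left_mono)
  moreover have "\<bar>(1 + u) / 2 * v * T\<bar> \<le> (1 + u) / 2 * T"
  proof -
    have "\<bar>v\<bar> * T \<le> T" using v T by (simp add: mult_left_le_one_le abs_le_iff)
    then have "(1 + u) / 2 * (\<bar>v\<bar> * T) \<le> (1 + u) / 2 * T" using u by (intro mult_left_mono) auto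
    moreover have "\<bar>(1 + u) / 2 * v * T\<bar> = (1 + u) / 2 * (\<bar>v\<bar> * T)" using u T by (simp add: abs_mult)
    ultimately show ?thesis by simp
  qed
  ultimately have "\<bar>(1 - u) / 2 * c + (1 + u) / 2 * v * T\<bar> \<le> (1 - u) / 2 * T + (1 + u) / 2 * T" by linarith
  then show ?thesis by (simp add: field_simps)
qed

text \<open>\<open>fact k * cone_coeff\<close> is the mean of the k-th power of a function bounded
  by T; that the total mass is 1 is the case k = 0 of the moment formula.\<close>

lemma cone_coeff_bound_pos:
  assumes \<delta>: "\<delta> > 0" and \<beta>: "\<beta> > 0" and c: "\<bar>c\<bar> \<le> T"
  shows "\<bar>cone_coeff \<delta> \<beta> k (T\<^sup>2) c\<bar> \<le> T ^ k / fact k"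
proof -
  let ?D = "\<lambda>z. jacobi_density \<delta> \<beta> (fst z) * gegenbauer_density \<beta> (snd z)"
  let ?e = "\<lambda>z. (1 - fst z) / 2 * c + (1 + fst z) / 2 * snd z * T"
  have k: "has_bochner_integral lborel (\<lambda>z. ?e z ^ k * ?D z) (fact k * cone_coeff \<delta> \<beta> k (T\<^sup>2) c)"
    by (rule cone_coeff_has_bochner_integral[OF \<delta> \<beta>])
  have "has_bochner_integral lborel ?D 1"
    using cone_coeff_has_bochner_integral[OF \<delta> \<beta>, of c T 0] by (simp add: cone_coeff_def rothe_coeff_def)
  then have D: "has_bochner_integral lborel (\<lambda>z. T ^ k * ?D z) (T ^ k * 1)"
    by (rule has_bochner_integral_mult_right)
  have le: "\<bar>?e z ^ k * ?D z\<bar> \<le> T ^ k * ?D z" for z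
  proof (cases "fst z \<in> {-1..1} \<and> snd z \<in> {-1..1}")
    case True
    then have "\<bar>?e z\<bar> ^ k \<le> T ^ k" using abs_eta_le[OF c] by (intro power_mono) auto
    then show ?thesis using densities_nonneg[OF \<delta> \<beta>] by (simp add: abs_mult power_abs mult_right_mono)
  qed (auto simp: jacobi_density_def gegenbauer_density_def)
  have "\<bar>fact k * cone_coeff \<delta> \<beta> k (T\<^sup>2) c\<bar> \<le> (LINT z|lborel. \<bar>?e z ^ k * ?D z\<bar>)"
    using k integral_abs_bound[of lborel "\<lambda>z. ?e z ^ k * ?D z"] by (simp add: has_bochner_integral_iff)
  also have "\<dots> \<le> (LINT z|lborel. T ^ k * ?D z)"
    using k D le by (intro integral_mono) (auto simp: has_bochner_integral_iff)
  also have "\<dots> = T ^ k" using D by (simp add: has_bochner_integral_iff)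
  finally show ?thesis by (simp add: abs_mult field_simps)
qed

lemma tendsto_cone_coeff:
  assumes \<delta>: "\<delta> > 0"
  shows "((\<lambda>b. cone_coeff \<delta> b k X c) \<longlongrightarrow> cone_coeff \<delta> 0 k X c) (at_right 0)"
proof -
  have poch: "((\<lambda>b. pochhammer (b + e) n) \<longlongrightarrow> pochhammer (0 + e) n) (at_right (0::real))" for e n
    unfolding pochhammer_prod by (intro tendsto_intros)
  have r: "((\<lambda>b. rothe_coeff b j) \<longlongrightarrow> rothe_coeff 0 j) (at_right 0)" for j
  proof (cases "j = 0")
    case False
    have "((\<lambda>b. b * pochhammer (b + (real j + 1)) (j - 1) / fact j) \<longlongrightarrow> 0 * pochhammer (0 + (real j + 1)) (j - 1) / fact j) (at_right 0)"
      by (intro tendsto_intros poch) simp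
    then show ?thesis using False by (simp add: rothe_coeff_def add.assoc)
  qed (simp add: rothe_coeff_def)
  have "pochhammer (0 + \<delta>) k > 0" using \<delta> by (intro pochhammer_pos) simp
  then show ?thesis unfolding cone_coeff_def by (intro tendsto_intros r poch) simp
qed

lemma cone_coeff_bound:
  assumes \<delta>: "\<delta> > 0" and \<beta>: "\<beta> \<ge> 0" and c: "\<bar>c\<bar> \<le> T"
  shows "\<bar>cone_coeff \<delta> \<beta> k (T\<^sup>2) c\<bar> \<le> T ^ k / fact k"
proof (cases "\<beta> = 0")
  case True
  have "((\<lambda>b. \<bar>cone_coeff \<delta> b k (T\<^sup>2) c\<bar>) \<longlongrightarrow> \<bar>cone_coeff \<delta> 0 k (T\<^sup>2) c\<bar>) (at_right 0)"
    by (intro tendsto_intros tendsto_cone_coeff[OF \<delta>])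
  moreover have "\<forall>\<^sub>F b in at_right 0. \<bar>cone_coeff \<delta> b k (T\<^sup>2) c\<bar> \<le> T ^ k / fact k"
    using eventually_at_right_less[of "0::real"] by eventually_elim (rule cone_coeff_bound_pos[OF \<delta> _ c])
  ultimately show ?thesis using True by (intro tendsto_upperbound) auto
qed (use assms cone_coeff_bound_pos in auto)

lemma summable_power_fact: "summable (\<lambda>k. R ^ k * (T ^ k / fact k) :: real)"
proof -
  have "(\<lambda>k. R ^ k * (T ^ k / fact k)) = (\<lambda>k. inverse (fact k) * (R * T) ^ k)"
    by (simp add: fun_eq_iff power_mult_distrib divide_inverse mult_ac)
  then show ?thesis using summable_exp[of "R * T"] by (simp only:)
qed

lemma summable_cone_coeff:
  assumes \<delta>: "\<delta> > 0" and \<beta>: "\<beta> \<ge> 0" and c: "\<bar>c\<bar> \<le> T"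
  shows "summable (\<lambda>k. \<bar>R ^ k * cone_coeff \<delta> \<beta> k (T\<^sup>2) c\<bar>)"
proof (rule summable_comparison_test')
  show "summable (\<lambda>k. \<bar>R\<bar> ^ k * (T ^ k / fact k))" by (rule summable_power_fact)
  show "norm \<bar>R ^ k * cone_coeff \<delta> \<beta> k (T\<^sup>2) c\<bar> \<le> \<bar>R\<bar> ^ k * (T ^ k / fact k)" for k
    using mult_left_mono[OF cone_coeff_bound[OF assms, of k], of "\<bar>R\<bar> ^ k"] by (simp add: abs_mult power_abs)
qed

lemma exp_integral_eq_suminf_cone_coeff:
  assumes \<delta>: "\<delta> > 0" and \<beta>: "\<beta> > 0" and c: "\<bar>c\<bar> \<le> T" and R: "R \<ge> 0"
  shows "(LINT z|lborel. exp (R * ((1 - fst z) / 2 * c + (1 + fst z) / 2 * snd z * T)) *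
      (jacobi_density \<delta> \<beta> (fst z) * gegenbauer_density \<beta> (snd z))) = (\<Sum>k. R ^ k * cone_coeff \<delta> \<beta> k (T\<^sup>2) c)"
proof -
  let ?D = "\<lambda>z. jacobi_density \<delta> \<beta> (fst z) * gegenbauer_density \<beta> (snd z)"
  let ?e = "\<lambda>z. (1 - fst z) / 2 * c + (1 + fst z) / 2 * snd z * T"
  let ?f = "\<lambda>k z. R ^ k / fact k * (?e z ^ k * ?D z)"
  have T: "T \<ge> 0" using c by linarith
  have k: "has_bochner_integral lborel (?f k) (R ^ k * cone_coeff \<delta> \<beta> k (T\<^sup>2) c)" for k
    using has_bochner_integral_mult_right[OF cone_coeff_has_bochner_integral[OF \<delta> \<beta>, of c T k], of "R ^ k / fact k"] by simp
  have "has_bochner_integral lborel ?D 1"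
    using cone_coeff_has_bochner_integral[OF \<delta> \<beta>, of c T 0] by (simp add: cone_coeff_def rothe_coeff_def)
  then have D: "integrable lborel ?D" "integral\<^sup>L lborel ?D = 1" by (auto simp: has_bochner_integral_iff)
  have Dn: "?D z \<ge> 0" for z using densities_nonneg[OF \<delta> \<beta>] by simp
  have le: "norm (?f k z) \<le> R ^ k * (T ^ k / fact k) * ?D z" for k z
  proof (cases "fst z \<in> {-1..1} \<and> snd z \<in> {-1..1}")
    case True
    then have "\<bar>?e z\<bar> ^ k \<le> T ^ k" using abs_eta_le[OF c] by (intro power_mono) auto
    then have "R ^ k / fact k * (\<bar>?e z\<bar> ^ k * ?D z) \<le> R ^ k / fact k * (T ^ k * ?D z)"
      using R Dn[of z] by (intro mult_left_mono mult_right_mono) auto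
    moreover have "norm (?f k z) = R ^ k / fact k * (\<bar>?e z\<bar> ^ k * ?D z)"
      using R by (simp only: real_norm_def abs_mult power_abs abs_divide abs_of_nonneg[OF fact_ge_zero] abs_of_nonneg[OF R]
        abs_of_nonneg[OF densities_nonneg(1)[OF \<delta> \<beta>]] abs_of_nonneg[OF densities_nonneg(2)[OF \<delta> \<beta>]])
    ultimately show ?thesis by simp
  qed (auto simp: jacobi_density_def gegenbauer_density_def)
  have sumf: "(\<lambda>k. ?f k z) sums (exp (R * ?e z) * ?D z)" for z
  proof -
    have "(\<lambda>k. (R * ?e z) ^ k /\<^sub>R fact k * ?D z) sums (exp (R * ?e z) * ?D z)"
      by (intro sums_mult2 exp_converges)
    moreover have "(R * ?e z) ^ k /\<^sub>R fact k * ?D z = ?f k z" for k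
      by (simp only: power_mult_distrib divide_inverse real_scaleR_def mult_ac)
    ultimately show ?thesis by (simp only:)
  qed
  have "(LINT z|lborel. (\<Sum>k. ?f k z)) = (\<Sum>k. LINT z|lborel. ?f k z)"
  proof (rule integral_suminf)
    show "integrable lborel (?f k)" for k using k has_bochner_integral_iff by blast
    show "AE z in lborel. summable (\<lambda>k. norm (?f k z))"
    proof (rule AE_I2)
      fix z :: "real \<times> real"
      show "summable (\<lambda>k. norm (?f k z))"
        by (rule summable_comparison_test'[OF summable_mult2[OF summable_power_fact, of R T "?D z"]]) (use le in simp)
    qed
    show "summable (\<lambda>k. LINT z|lborel. norm (?f k z))"
    proof (rule summable_comparison_test'[OF summable_power_fact[of R T]])
      fix k
      have "(LINT z|lborel. norm (?f k z)) \<le> (LINT z|lborel. R ^ k * (T ^ k / fact k) * ?D z)"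
      proof (rule integral_mono)
        have "integrable lborel (?f k)" using k has_bochner_integral_iff by blast
        then show "integrable lborel (\<lambda>z. norm (?f k z))" by (rule integrable_norm)
        show "integrable lborel (\<lambda>z. R ^ k * (T ^ k / fact k) * ?D z)"
          using D(1) by (intro integrable_mult_right)
      qed (rule le)
      also have "\<dots> = R ^ k * (T ^ k / fact k)" using D by simp
      finally show "norm (LINT z|lborel. norm (?f k z)) \<le> R ^ k * (T ^ k / fact k)" by simp
    qed
  qed
  moreover have "(\<Sum>k. ?f k z) = exp (R * ?e z) * ?D z" for z using sumf[of z] by (rule sums_unique[symmetric])
  moreover have "(LINT z|lborel. ?f k z) = R ^ k * cone_coeff \<delta> \<beta> k (T\<^sup>2) c" for k
    using k[of k] by (simp only: has_bochner_integral_iff)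
  ultimately show ?thesis by (simp only:)
qed

section \<open>The Poisson kernel\<close>

lemma poisson_integral_eq:
  fixes x y :: "real ^ 'n"
  assumes \<beta>: "\<beta> > 0" and xt: "norm x = \<bar>t\<bar>" and ys: "norm y = \<bar>s\<bar>" and r: "0 \<le> r" "r < 1"
  defines "\<delta> \<equiv> real CARD('n) / 2"
  shows "poisson_integral \<beta> r (x, \<bar>t\<bar>) (y, \<bar>s\<bar>) / 2 powr (\<beta> + (real CARD('n) - 2) / 2) =
    (1 - r\<^sup>2) powr (- (\<beta> + \<delta>)) * exp (- (x \<bullet> x + y \<bullet> y) * (r\<^sup>2 / (1 - r\<^sup>2))) *
     (\<Sum>k. (2 * r / (1 - r\<^sup>2)) ^ k * cone_coeff \<delta> \<beta> k ((x \<bullet> x) * (y \<bullet> y)) (x \<bullet> y))"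
proof -
  define T where "T = \<bar>s\<bar> * \<bar>t\<bar>"
  define R where "R = 2 * r / (1 - r\<^sup>2)"
  have \<delta>: "\<delta> > 0" by (simp add: \<delta>_def)
  have r2: "r\<^sup>2 < 1" using r by (simp add: power_less_one_iff abs_square_less_1)
  have R: "R \<ge> 0" using r r2 by (simp add: R_def)
  have c: "\<bar>x \<bullet> y\<bar> \<le> T" using Cauchy_Schwarz_ineq2[of x y] by (simp add: T_def xt ys mult.commute)
  have XY: "x \<bullet> x = t\<^sup>2" "y \<bullet> y = s\<^sup>2" using xt ys by (simp_all flip: power2_norm_eq_inner)
  have T2: "T\<^sup>2 = (x \<bullet> x) * (y \<bullet> y)" by (simp add: T_def XY power_mult_distrib)
  have d: "(real CARD('n) - 2) / 2 = \<delta> - 1" by (simp add: \<delta>_def field_simps)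
  let ?e = "\<lambda>z. (1 - fst z) / 2 * (x \<bullet> y) + (1 + fst z) / 2 * snd z * T"
  \<comment> \<open>If s t = 0, then \<open>sgn\<close> gives 0 and drops the first summand; this is
    harmless because x or y is then 0, so \<open>x \<bullet> y\<close> vanishes as well.\<close>
  have eta: "cone_eta x \<bar>t\<bar> y \<bar>s\<bar> z = ?e z" for z
  proof (cases "s * t = 0")
    case True
    then have "x \<bullet> y = 0" using xt ys by auto
    then show ?thesis by (simp add: cone_eta_def T_def)
  next
    case False
    then have "sgn (\<bar>s\<bar> * \<bar>t\<bar>) = 1" by simp
    then show ?thesis by (simp add: cone_eta_def T_def)
  qed
  let ?I = "LINT z:{-1..1} \<times> {-1..1}|lborel.
         exp (2 * r / (1 - r\<^sup>2) * cone_eta x \<bar>t\<bar> y \<bar>s\<bar> z) *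
         jacobi_const ((real CARD('n) - 2) / 2) (\<beta> - 1) * gegenbauer_const \<beta> *
         (1 - fst z) powr ((real CARD('n) - 2) / 2) * (1 + fst z) powr (\<beta> - 1) *
         (1 - (snd z)\<^sup>2) powr (\<beta> - 1 / 2)"
  let ?P = "2 powr (\<beta> + (\<delta> - 1)) :: real"
  have "?I =
     (LINT z|lborel. ?P * (exp (R * ?e z) * (jacobi_density \<delta> \<beta> (fst z) * gegenbauer_density \<beta> (snd z))))"
    unfolding set_lebesgue_integral_def eta d R_def[symmetric]
    by (intro Bochner_Integration.integral_cong refl)
       (simp add: jacobi_density_def gegenbauer_density_def indicator_times case_prod_beta add_diff_eq mult_ac)
  also have "\<dots> = ?P * (\<Sum>k. R ^ k * cone_coeff \<delta> \<beta> k ((x \<bullet> x) * (y \<bullet> y)) (x \<bullet> y))"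
    using exp_integral_eq_suminf_cone_coeff[OF \<delta> \<beta> c R] unfolding T2 by simp
  finally have I: "?I = ?P * (\<Sum>k. R ^ k * cone_coeff \<delta> \<beta> k ((x \<bullet> x) * (y \<bullet> y)) (x \<bullet> y))" .
  have e: "- ((\<bar>s\<bar>\<^sup>2 + \<bar>t\<bar>\<^sup>2) / (1 - r\<^sup>2)) * r\<^sup>2 = - (x \<bullet> x + y \<bullet> y) * (r\<^sup>2 / (1 - r\<^sup>2))"
  proof -
    have "- (A / D) * q = - A * (q / D)" for A D q :: real by simp
    then show ?thesis unfolding XY power2_abs add.commute[of "t\<^sup>2"] .
  qed
  have p: "1 / (1 - r\<^sup>2) powr (\<beta> + real CARD('n) / 2) = (1 - r\<^sup>2) powr (- (\<beta> + \<delta>))"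
    unfolding \<delta>_def by (rule powr_minus_divide[symmetric])
  show ?thesis
    unfolding poisson_integral_def prod.case Let_def I p
    unfolding e d R_def by simp
qed

theorem theorem7p6:
  fixes x y :: "real ^ 'n" and t s \<beta> r :: real
  assumes "CARD('n) \<ge> 2" and "\<beta> \<ge> 0"
    and "(x, t) \<in> double_cone" and "(y, s) \<in> double_cone"
    and "0 \<le> r" and "r < 1"
  shows "summable (\<lambda>n. repr_kernel_even \<beta> n (x, t) (y, s) * r ^ n) \<and>
    (\<beta> > 0 \<longrightarrow>
       poisson_kernel_even \<beta> r (x, t) (y, s) =
         poisson_integral \<beta> r (x, \<bar>t\<bar>) (y, \<bar>s\<bar>) / 2 powr (\<beta> + (real CARD('n) - 2) / 2)) \<and>
    (\<beta> = 0 \<longrightarrow>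
       ((\<lambda>b. poisson_integral b r (x, \<bar>t\<bar>) (y, \<bar>s\<bar>) / 2 powr (b + (real CARD('n) - 2) / 2))
         \<longlongrightarrow> poisson_kernel_even \<beta> r (x, t) (y, s)) (at_right 0))"
proof -
  define \<delta> where "\<delta> = real CARD('n) / 2"
  define R where "R = 2 * r / (1 - r\<^sup>2)"
  define T where "T = norm x * norm y"
  define G where "G = (\<lambda>b. \<Sum>k. R ^ k * cone_coeff \<delta> b k ((x \<bullet> x) * (y \<bullet> y)) (x \<bullet> y))"
  define S where "S = (\<lambda>b. (1 - r\<^sup>2) powr (- (b + \<delta>)) * exp (- (x \<bullet> x + y \<bullet> y) * (r\<^sup>2 / (1 - r\<^sup>2))) * G b)"
  have xt: "norm x = \<bar>t\<bar>" and ys: "norm y = \<bar>s\<bar>" using assms(3,4) by (auto simp: double_cone_def)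
  have \<delta>: "\<delta> > 0" by (simp add: \<delta>_def)
  have r2: "r\<^sup>2 < 1" using assms(5,6) by (simp add: power_less_one_iff abs_square_less_1)
  have T2: "(x \<bullet> x) * (y \<bullet> y) = T\<^sup>2" by (simp add: T_def power_mult_distrib power2_norm_eq_inner)
  have c: "\<bar>x \<bullet> y\<bar> \<le> T" unfolding T_def by (rule Cauchy_Schwarz_ineq2)
  have "(\<lambda>n. mehler_coeff \<delta> (\<beta> + \<delta>) n (x \<bullet> x) (y \<bullet> y) (x \<bullet> y) * r ^ n) sums S \<beta>"
    unfolding S_def G_def R_def
    by (rule mehler_coeff_sums[OF \<delta> assms(2,5,6)]) (use summable_cone_coeff[OF \<delta> assms(2) c] in \<open>simp add: T2\<close>)
  then have sums: "(\<lambda>n. repr_kernel_even \<beta> n (x, t) (y, s) * r ^ n) sums S \<beta>"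
    unfolding repr_kernel_even_eq[OF assms(2-4)] by (simp add: mehler_kernel_def \<delta>_def)
  then have P: "poisson_kernel_even \<beta> r (x, t) (y, s) = S \<beta>"
    unfolding poisson_kernel_even_def by (rule sums_unique[symmetric])
  have I: "poisson_integral b r (x, \<bar>t\<bar>) (y, \<bar>s\<bar>) / 2 powr (b + (real CARD('n) - 2) / 2) = S b" if "b > 0" for b
    unfolding S_def G_def R_def \<delta>_def by (rule poisson_integral_eq[OF that xt ys assms(5,6)])
  \<comment> \<open>The Poisson kernel equals S \<beta> at \<beta> = 0 too, whereas the integral
    equals S b only for b > 0; right continuity of S at 0 joins the two.\<close>
  have "(S \<longlongrightarrow> S 0) (at_right 0)"
  proof -
    have "(G \<longlongrightarrow> G 0) (at_right 0)"
    proof -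
      \<comment> \<open>The majorant is free of b and valid for every k as soon as b > 0, which is
        eventually true along the product filter.\<close>
      have bd: "\<forall>\<^sub>F (k, b) in at_top \<times>\<^sub>F at_right 0. norm (R ^ k * cone_coeff \<delta> b k (T\<^sup>2) (x \<bullet> y)) \<le> \<bar>R\<bar> ^ k * (T ^ k / fact k)"
        unfolding eventually_prod_filter
      proof (intro exI conjI allI impI)
        show "\<forall>\<^sub>F k in at_top. True" by simp
        show "\<forall>\<^sub>F b in at_right 0. (0::real) < b" by (rule eventually_at_right_less)
        fix k :: nat and b :: real assume "0 < b"
        then have "\<bar>cone_coeff \<delta> b k (T\<^sup>2) (x \<bullet> y)\<bar> \<le> T ^ k / fact k" by (intro cone_coeff_bound_pos[OF \<delta> _ c])
        from mult_left_mono[OF this, of "\<bar>R\<bar> ^ k"]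
        show "case (k, b) of (k, b) \<Rightarrow> norm (R ^ k * cone_coeff \<delta> b k (T\<^sup>2) (x \<bullet> y)) \<le> \<bar>R\<bar> ^ k * (T ^ k / fact k)"
          by (simp add: abs_mult power_abs)
      qed
      have lim: "((\<lambda>b. R ^ k * cone_coeff \<delta> b k (T\<^sup>2) (x \<bullet> y)) \<longlongrightarrow> R ^ k * cone_coeff \<delta> 0 k (T\<^sup>2) (x \<bullet> y)) (at_right 0)" for k
        by (intro tendsto_mult tendsto_const tendsto_cone_coeff[OF \<delta>])
      show ?thesis unfolding G_def T2
        using tannerys_theorem[OF lim bd summable_power_fact trivial_limit_at_right_real] by (elim conjE)
    qed
    moreover have "((\<lambda>b. (1 - r\<^sup>2) powr (- (b + \<delta>))) \<longlongrightarrow> (1 - r\<^sup>2) powr (- (0 + \<delta>))) (at_right 0)"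
      using r2 by (intro tendsto_intros) auto
    ultimately show ?thesis unfolding S_def by (intro tendsto_mult tendsto_const)
  qed
  moreover have "\<forall>\<^sub>F b in at_right 0. S b = poisson_integral b r (x, \<bar>t\<bar>) (y, \<bar>s\<bar>) / 2 powr (b + (real CARD('n) - 2) / 2)"
    using eventually_at_right_less[of "0::real"] by eventually_elim (simp only: I)
  ultimately have "((\<lambda>b. poisson_integral b r (x, \<bar>t\<bar>) (y, \<bar>s\<bar>) / 2 powr (b + (real CARD('n) - 2) / 2)) \<longlongrightarrow> S 0) (at_right 0)"
    by (rule Lim_transform_eventually)
  then show ?thesis using sums I P by (auto simp: sums_iff)
qed

end
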